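(* Let $\lambda_0>0$ be a non-critical energy, and let for some (sufficiently small) $\varepsilon_0>0$ and all $\lambda\in(\lambda_0-\varepsilon_0,\lambda_0+\varepsilon_0)$ $$F(\lambda)=\bigcup_{n=1}^N F_n(\lambda),\qquad F_n(\lambda)\cap F_m(\lambda)=\emptyset\ \text{ for } n\ne m.$$ Suppose that for all $n=1,\dots,N$ and some points $x_n\in F_n(\lambda_0-\varepsilon_0)$ the inequality $$\langle x-x_n,\nabla v(x)\rangle\ge c_0>0,\qquad x\in F_n(\lambda_0+\varepsilon_0)\cap G(\lambda_0-\varepsilon_0),$$ holds. Let $\psi_\hbar$ denote normalized eigenfunctions of the operator $H_\hbar$ corresponding to eigenvalues $\lambda_\hbar$ in the neighborhood $(\lambda_0-\varepsilon_0/2,\lambda_0+\varepsilon_0/2)$ of the point $\lambda_0$. Then, for sufficiently small $\hbar$, $$K(\psi_\hbar)=\hbar^2\int_{\mathbb{R}^d}|\nabla\psi_\hbar(x)|^2dx\ge c>0$$ with a constant $c$ independent of $\hbar$ and of the eigenvalue $\lambda_\hbar$ in this neighborhood.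
   Context: $H_\hbar=-\hbar^2\Delta+v(x)$, $\hbar>0$, is the Schrödinger operator in $L_2(\mathbb{R}^d)$, where $v\in C^\infty(\mathbb{R}^d)$ is real-valued, $\min_{x\in\mathbb{R}^d}v(x)=0$ and $v_\infty:=\liminf_{|x|\to\infty}v(x)>0$. The energy $\lambda_0$ lies in $(0,v_\infty)$; non-critical means that $\nabla v(x)\ne0$ for all $x$ with $v(x)=\lambda_0$. Eigenfunctions satisfy $-\hbar^2\Delta\psi_\hbar+v\psi_\hbar=\lambda_\hbar\psi_\hbar$, $\psi_\hbar\in L_2(\mathbb{R}^d)$, and are real; normalized means $\int_{\mathbb{R}^d}\psi_\hbar^2dx=1$. For $\lambda\in\mathbb{R}$, $F(\lambda)=\{x\in\mathbb{R}^d:v(x)<\lambda\}$ and $G(\lambda)=\mathbb{R}^d\setminus F(\lambda)$. The sets $F_n(\lambda)$ (the potential wells for the energy $\lambda$) are those of the decomposition in the claim; the notation $F_n(\lambda_0\pm\varepsilon_0)$ refers to the same decomposition at the endpoints of the interval. $\langle\cdot,\cdot\rangle$ is the Euclidean scalar product. *)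

theory Defs
  imports "HOL-Analysis.Analysis"
begin

definition partial_deriv :: "'a::euclidean_space \<Rightarrow> ('a \<Rightarrow> real) \<Rightarrow> 'a \<Rightarrow> real" where
  "partial_deriv b f x = frechet_derivative f (at x) b"

definition grad :: "('a::euclidean_space \<Rightarrow> real) \<Rightarrow> 'a \<Rightarrow> 'a" where
  "grad f x = (\<Sum>b\<in>Basis. partial_deriv b f x *\<^sub>R b)"

lemma grad_GDERIV:
  assumes "f differentiable (at x)"
  shows "GDERIV f x :> grad f x"
proof -
  have D: "(f has_derivative frechet_derivative f (at x)) (at x)"
    using assms frechet_derivative_works by blast
  then interpret bounded_linear "frechet_derivative f (at x)"
    by (rule has_derivative_bounded_linear)
  have "frechet_derivative f (at x) h = inner h (grad f x)" for h
  proof -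
    have "frechet_derivative f (at x) h
        = frechet_derivative f (at x) (\<Sum>b\<in>Basis. inner h b *\<^sub>R b)"
      by (simp add: euclidean_representation)
    also have "\<dots> = (\<Sum>b\<in>Basis. inner h b * frechet_derivative f (at x) b)"
      by (simp add: sum scaleR)
    also have "\<dots> = inner h (grad f x)"
      by (simp add: grad_def partial_deriv_def inner_sum_right mult.commute)
    finally show ?thesis .
  qed
  then have "frechet_derivative f (at x) = (\<lambda>h. inner h (grad f x))"
    by (rule ext)
  then show ?thesis
    using D by (simp add: gderiv_def)
qed

primrec Ck :: "nat \<Rightarrow> ('a::euclidean_space \<Rightarrow> real) \<Rightarrow> bool" where
  "Ck 0 f \<longleftrightarrow> continuous_on UNIV f"
| "Ck (Suc k) f \<longleftrightarrow> (\<forall>x. f differentiable (at x)) \<and> (\<forall>b\<in>Basis. Ck k (partial_deriv b f))"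

definition smooth :: "('a::euclidean_space \<Rightarrow> real) \<Rightarrow> bool" where
  "smooth f \<longleftrightarrow> (\<forall>k. Ck k f)"

definition test_function :: "('a::euclidean_space \<Rightarrow> real) \<Rightarrow> bool" where
  "test_function \<phi> \<longleftrightarrow> smooth \<phi> \<and> compact (closure {x. \<phi> x \<noteq> 0})"

text \<open>Elements of \<open>L\<^sub>2\<close> are represented by Borel functions; nothing below depends
  on the choice of the representative.\<close>

definition L2 :: "('a::euclidean_space \<Rightarrow> 'b::euclidean_space) \<Rightarrow> bool" where
  "L2 f \<longleftrightarrow> f \<in> borel_measurable lborel \<and> integrable lborel (\<lambda>x. (norm (f x))\<^sup>2)"

definition has_weak_grad :: "('a::euclidean_space \<Rightarrow> real) \<Rightarrow> ('a \<Rightarrow> 'a) \<Rightarrow> bool" where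
  "has_weak_grad \<psi> g \<longleftrightarrow>
     (\<forall>\<phi>. test_function \<phi> \<longrightarrow>
        (\<forall>b\<in>Basis. (LINT x|lborel. \<psi> x * partial_deriv b \<phi> x)
                  = - (LINT x|lborel. inner (g x) b * \<phi> x)))"

text \<open>The Sobolev space \<open>H\<^sup>1\<close>; the distributional gradient of its elements is determined
  up to null sets, and \<open>weak_grad\<close> picks a representative.\<close>

definition H1 :: "('a::euclidean_space \<Rightarrow> real) \<Rightarrow> bool" where
  "H1 \<psi> \<longleftrightarrow> L2 \<psi> \<and> (\<exists>g. L2 g \<and> has_weak_grad \<psi> g)"

definition weak_grad :: "('a::euclidean_space \<Rightarrow> real) \<Rightarrow> 'a \<Rightarrow> 'a" where
  "weak_grad \<psi> = (SOME g. L2 g \<and> has_weak_grad \<psi> g)"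

text \<open>For \<open>v \<ge> 0\<close> the operator \<open>-h\<^sup>2 \<Delta> + v\<close> in \<open>L\<^sub>2\<close> is the self-adjoint operator of the
  closed quadratic form \<open>h\<^sup>2 \<integral>|\<nabla>\<psi>|\<^sup>2 + \<integral>v|\<psi>|\<^sup>2\<close> on its natural domain: \<open>\<psi>\<close> belongs to the
  operator domain and is mapped to \<open>f \<in> L\<^sub>2\<close> iff the form evaluated at \<open>(\<psi>, \<phi>)\<close> equals
  the scalar product of \<open>f\<close> and \<open>\<phi>\<close> for all \<open>\<phi>\<close> in the form domain. For smooth \<open>v \<ge> 0\<close> this
  is also the closure of the operator on test functions. The operator is real, so only
  real-valued functions are considered; it is given by its graph.\<close>

definition form_domain :: "('a::euclidean_space \<Rightarrow> real) \<Rightarrow> ('a \<Rightarrow> real) set" where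
  "form_domain v = {\<psi>. H1 \<psi> \<and> integrable lborel (\<lambda>x. v x * (\<psi> x)\<^sup>2)}"

definition schroedinger_form ::
  "real \<Rightarrow> ('a::euclidean_space \<Rightarrow> real) \<Rightarrow> ('a \<Rightarrow> real) \<Rightarrow> ('a \<Rightarrow> real) \<Rightarrow> real" where
  "schroedinger_form h v \<psi> \<phi> =
     h\<^sup>2 * (LINT x|lborel. inner (weak_grad \<psi> x) (weak_grad \<phi> x))
     + (LINT x|lborel. v x * \<psi> x * \<phi> x)"

definition schroedinger_op ::
  "real \<Rightarrow> ('a::euclidean_space \<Rightarrow> real) \<Rightarrow> (('a \<Rightarrow> real) \<times> ('a \<Rightarrow> real)) set" where
  "schroedinger_op h v =
     {(\<psi>, f). \<psi> \<in> form_domain v \<and> L2 f \<and>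
        (\<forall>\<phi>\<in>form_domain v. schroedinger_form h v \<psi> \<phi> = (LINT x|lborel. f x * \<phi> x))}"

definition eigenfunction ::
  "real \<Rightarrow> ('a::euclidean_space \<Rightarrow> real) \<Rightarrow> real \<Rightarrow> ('a \<Rightarrow> real) \<Rightarrow> bool" where
  "eigenfunction h v l \<psi> \<longleftrightarrow>
     (\<psi>, \<lambda>x. l * \<psi> x) \<in> schroedinger_op h v \<and> \<not> (AE x in lborel. \<psi> x = 0)"

definition normalized :: "('a::euclidean_space \<Rightarrow> real) \<Rightarrow> bool" where
  "normalized \<psi> \<longleftrightarrow> (LINT x|lborel. (\<psi> x)\<^sup>2) = 1"

definition kinetic_energy :: "real \<Rightarrow> ('a::euclidean_space \<Rightarrow> real) \<Rightarrow> real" where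
  "kinetic_energy h \<psi> = h\<^sup>2 * (LINT x|lborel. (norm (weak_grad \<psi> x))\<^sup>2)"

definition v_infty :: "('a::euclidean_space \<Rightarrow> real) \<Rightarrow> ereal" where
  "v_infty v = Liminf at_infinity (\<lambda>x. ereal (v x))"

definition F_set :: "('a \<Rightarrow> real) \<Rightarrow> real \<Rightarrow> 'a set" where
  "F_set v l = {x. v x < l}"

definition G_set :: "('a \<Rightarrow> real) \<Rightarrow> real \<Rightarrow> 'a set" where
  "G_set v l = UNIV - F_set v l"

definition non_critical :: "('a::euclidean_space \<Rightarrow> real) \<Rightarrow> real \<Rightarrow> bool" where
  "non_critical v l \<longleftrightarrow> (\<forall>x. v x = l \<longrightarrow> grad v x \<noteq> 0)"

end

theory Submission
  imports Defs
begin

text \<open>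
  The hypothesis on the wells makes \<open>\<nabla>v\<close> nonzero on the shell \<open>lam0 - eps0 \<le> v < lam0 + eps0\<close>.
  Write \<open>K\<close> for the kinetic energy.

  Testing the eigenvalue equation with \<open>\<Theta>(v) \<psi>\<close>, where \<open>\<Theta>\<close> increases from negative values to \<open>1\<close>
  and vanishes exactly at \<open>lam\<close>, gives \<open>\<integral> \<Theta>(v) (v - lam) \<psi>\<^sup>2 \<le> C (K + h\<^sup>2)\<close>, so that for small \<open>K\<close>
  and \<open>h\<close> the mass of \<open>\<psi>\<close> concentrates near \<open>{v = lam}\<close>. On the other hand the virial identity for
  the vector field \<open>w = \<chi>(v) \<nabla>v\<close>, with \<open>\<chi>\<close> a bump function of the shell, reads
  \<open>\<integral> \<chi>(v) |\<nabla>v|\<^sup>2 \<psi>\<^sup>2 = h\<^sup>2 \<integral> (2 Dw(\<nabla>\<psi>, \<nabla>\<psi>) + \<psi> \<langle>\<nabla>\<psi>, \<nabla> div w\<rangle>) \<le> C (K + h\<^sup>2)\<close>,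
  and its weight is bounded below near \<open>{v = lam}\<close>. Adding the two, \<open>1 = \<integral> \<psi>\<^sup>2 \<le> C (K + h\<^sup>2)\<close>.

  Eigenfunctions are only known to lie in \<open>H\<^sup>1\<close>, so the virial identity is applied to
  mollifications of \<open>\<psi>\<close>, with Friedrichs' commutator as error term.
\<close>

section \<open>Smooth functions\<close>

text \<open>\<open>v\<close> may grow arbitrarily fast, so products of \<psi> with \<open>v\<close>
  or its derivatives are not known to be square integrable. Every multiplier except the constant 1
  therefore contains the factor \<open>bump (lam0 + eps0 - v x)\<close>. It is supported in {v \<le>
  lam0 + eps0}, which is bounded since lam0 + eps0 lies below \<open>v_infty v\<close>. Accordingly
  \<Theta>(v) is 1 minus a multiple of that factor. The 1 amounts to testing with \<psi> itself,
  which yields exactly -K, a term of favourable sign; the rest is a compactly supported test.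

  The fields x - x_n of the hypothesis change from well to well, whereas \<chi>(v) \<nabla>v is one
  global field, and the weight \<chi>(v) |\<nabla>v|^2 that it produces is nonnegative everywhere.

  All constants must be uniform in lam. The cutoffs depend on lam0 and eps0 only; lam enters
  \<Theta> just through the scalar \<open>bump t\<close> with t = lam0 + eps0 - lam, and t stays
  between eps0/2 and 3 eps0/2. The width of the mollifier tends to 0 with h and \<psi> fixed, so its
  error term may depend on both.\<close>

lemma smooth_Ck: "smooth f \<Longrightarrow> Ck k f"
  by (simp add: smooth_def)

lemma smooth_differentiable: "smooth f \<Longrightarrow> f differentiable (at x)"
  using smooth_Ck[of f "Suc 0"] by simp

lemma smooth_partial_deriv: "smooth f \<Longrightarrow> b \<in> Basis \<Longrightarrow> smooth (partial_deriv b f)"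
  unfolding smooth_def using Ck.simps(2) by blast

lemma smooth_continuous: "smooth f \<Longrightarrow> continuous_on S f"
  using smooth_Ck[of f 0] continuous_on_subset by fastforce

text \<open>Leibniz and chain rules leave undifferentiated factors behind, so the inductions for
  products and compositions have to pass from order k + 1 to order k of the same function.\<close>

lemma Ck_Suc: "Ck (Suc k) f \<Longrightarrow> Ck k f"
proof (induction k arbitrary: f)
  case 0
  then have "f differentiable_on UNIV"
    by (simp add: differentiable_on_def)
  then show ?case
    by (simp add: differentiable_imp_continuous_on)
qed auto

lemma has_derivative_grad:
  "f differentiable (at x) \<Longrightarrow> (f has_derivative (\<lambda>h. inner h (grad f x))) (at x)"
  using grad_GDERIV by (simp add: gderiv_def)

lemma partial_deriv_eq: "(f has_derivative f') (at x) \<Longrightarrow> partial_deriv b f x = f' b"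
  by (simp add: partial_deriv_def frechet_derivative_at[symmetric])

lemma grad_inner_Basis: "b \<in> Basis \<Longrightarrow> inner (grad f x) b = partial_deriv b f x"
  by (simp add: grad_def inner_sum_left inner_Basis if_distrib cong: if_cong)

lemma partial_deriv_const [simp]: "partial_deriv b (\<lambda>x. c) = (\<lambda>x. 0)"
  by (auto simp: partial_deriv_eq[OF has_derivative_const])

lemma partial_deriv_add:
  assumes "f differentiable (at x)" "g differentiable (at x)"
  shows "partial_deriv b (\<lambda>x. f x + g x) x = partial_deriv b f x + partial_deriv b g x"
  by (subst partial_deriv_eq[OF has_derivative_add[OF assms[unfolded frechet_derivative_works]]])
     (simp add: partial_deriv_def)

lemma partial_deriv_mult:
  assumes "f differentiable (at x)" "g differentiable (at x)"
  shows "partial_deriv b (\<lambda>x. f x * g x) x = f x * partial_deriv b g x + partial_deriv b f x * g x"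
  by (subst partial_deriv_eq[OF has_derivative_mult[OF assms[unfolded frechet_derivative_works]]])
     (simp add: partial_deriv_def)

lemma Ck_const [simp]: "Ck k (\<lambda>x. c)"
  by (induction k arbitrary: c) auto

lemma Ck_add: "Ck k f \<Longrightarrow> Ck k g \<Longrightarrow> Ck k (\<lambda>x. f x + g x)"
proof (induction k arbitrary: f g)
  case (Suc k)
  then have "partial_deriv b (\<lambda>x. f x + g x) = (\<lambda>x. partial_deriv b f x + partial_deriv b g x)" for b
    by (intro ext partial_deriv_add) auto
  with Suc show ?case by auto
qed (auto intro: continuous_intros)

lemma Ck_mult: "Ck k f \<Longrightarrow> Ck k g \<Longrightarrow> Ck k (\<lambda>x. f x * g x)"
proof (induction k arbitrary: f g)
  case (Suc k)
  then have "partial_deriv b (\<lambda>x. f x * g x) =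
      (\<lambda>x. f x * partial_deriv b g x + partial_deriv b f x * g x)" for b
    by (intro ext partial_deriv_mult) auto
  with Suc Ck_Suc[OF Suc.prems(1)] Ck_Suc[OF Suc.prems(2)] show ?case by (auto intro!: Ck_add)
qed (auto intro: continuous_intros)

lemma partial_deriv_compose:
  fixes \<theta> :: "real \<Rightarrow> real"
  assumes "\<theta> differentiable (at (f x))" "f differentiable (at x)"
  shows "partial_deriv b (\<lambda>x. \<theta> (f x)) x = partial_deriv 1 \<theta> (f x) * partial_deriv b f x"
proof -
  have "(\<theta> has_derivative (\<lambda>h. h * partial_deriv 1 \<theta> (f x))) (at (f x))"
    using has_derivative_grad[OF assms(1)] by (simp add: grad_def)
  from has_derivative_compose[OF assms(2)[unfolded frechet_derivative_works] this]
  show ?thesis by (subst partial_deriv_eq) (auto simp: partial_deriv_def mult.commute)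
qed

lemma Ck_compose:
  fixes \<theta> :: "real \<Rightarrow> real"
  shows "Ck k \<theta> \<Longrightarrow> Ck k f \<Longrightarrow> Ck k (\<lambda>x. \<theta> (f x))"
proof (induction k arbitrary: \<theta> f)
  case 0
  then show ?case by (auto intro: continuous_on_compose2)
next
  case (Suc k)
  then have "partial_deriv b (\<lambda>x. \<theta> (f x)) = (\<lambda>x. partial_deriv 1 \<theta> (f x) * partial_deriv b f x)" for b
    by (intro ext partial_deriv_compose) auto
  moreover have "(\<lambda>x. \<theta> (f x)) differentiable at x" for x
    using Suc.prems by (intro differentiable_compose[of \<theta> f]) auto
  ultimately show ?case using Suc Ck_Suc[OF Suc.prems(2)] by (auto intro!: Ck_mult)
qed

text \<open>Convolution kernels occur reflected (s = -1) and translated (s = 1), hence this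
  form.\<close>

lemma partial_deriv_affine:
  assumes "f differentiable (at (s *\<^sub>R x + p))"
  shows "partial_deriv b (\<lambda>y. f (s *\<^sub>R y + p)) x = s * partial_deriv b f (s *\<^sub>R x + p)"
proof -
  have 1: "((\<lambda>y. s *\<^sub>R y + p) has_derivative (\<lambda>h. s *\<^sub>R h)) (at x)"
    by (auto intro!: derivative_eq_intros)
  from has_derivative_compose[OF 1 has_derivative_grad[OF assms]]
  have "((\<lambda>y. f (s *\<^sub>R y + p)) has_derivative (\<lambda>h. s * inner h (grad f (s *\<^sub>R x + p)))) (at x)"
    by simp
  from partial_deriv_eq[OF this] partial_deriv_eq[OF has_derivative_grad[OF assms]]
  show ?thesis by simp
qed

lemma Ck_affine: "Ck k f \<Longrightarrow> Ck k (\<lambda>y. f (s *\<^sub>R y + p))"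
proof (induction k arbitrary: f)
  case 0
  then show ?case by (auto intro!: continuous_on_compose2[of UNIV f] continuous_intros)
next
  case (Suc k)
  then have "partial_deriv b (\<lambda>y. f (s *\<^sub>R y + p)) = (\<lambda>y. s * partial_deriv b f (s *\<^sub>R y + p))" for b
    by (intro ext partial_deriv_affine) auto
  moreover have "(\<lambda>y. f (s *\<^sub>R y + p)) differentiable at x" for x
    using Suc.prems by (intro differentiable_compose[of f "\<lambda>y. s *\<^sub>R y + p"]) auto
  ultimately show ?case using Suc by (auto intro!: Ck_mult)
qed

lemma Ck_linear: "Ck k (\<lambda>x. inner x c)"
proof (cases k)
  case 0
  then show ?thesis by (auto intro!: continuous_intros)
next
  case (Suc n)
  have 1: "((\<lambda>x. inner x c) has_derivative (\<lambda>h. inner h c)) (at x)" for x :: 'a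
    by (auto intro!: derivative_eq_intros)
  then have "partial_deriv b (\<lambda>x. inner x c) = (\<lambda>x. inner b c)" for b
    by (intro ext partial_deriv_eq)
  then show ?thesis using 1 Suc by (auto simp: differentiable_def)
qed

named_theorems smooth_intros

lemma smooth_const [smooth_intros]: "smooth (\<lambda>x. c)"
  and smooth_add [smooth_intros]: "smooth f \<Longrightarrow> smooth g \<Longrightarrow> smooth (\<lambda>x. f x + g x)"
  and smooth_mult [smooth_intros]: "smooth f \<Longrightarrow> smooth g \<Longrightarrow> smooth (\<lambda>x. f x * g x)"
  and smooth_affine: "smooth f \<Longrightarrow> smooth (\<lambda>y. f (s *\<^sub>R y + p))"
  by (auto simp: smooth_def Ck_add Ck_mult Ck_affine)

lemma smooth_linear [smooth_intros]: "smooth (\<lambda>x. inner x c)"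
  by (simp add: smooth_def Ck_linear)

lemma smooth_compose:
  fixes \<theta> :: "real \<Rightarrow> real"
  shows "smooth \<theta> \<Longrightarrow> smooth f \<Longrightarrow> smooth (\<lambda>x. \<theta> (f x))"
  by (auto simp: smooth_def Ck_compose)

declare smooth_partial_deriv [smooth_intros]

lemma smooth_diff [smooth_intros]: "smooth f \<Longrightarrow> smooth g \<Longrightarrow> smooth (\<lambda>x. f x - g x)"
  using smooth_add[of f "\<lambda>x. (-1) * g x"] smooth_mult[of "\<lambda>x. -1" g] smooth_const by auto

lemma smooth_sum [smooth_intros]:
  "(\<And>i. i \<in> I \<Longrightarrow> smooth (f i)) \<Longrightarrow> smooth (\<lambda>x. \<Sum>i\<in>I. f i x)"
  by (induction I rule: infinite_finite_induct) (auto intro: smooth_intros)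

lemma smooth_prod [smooth_intros]:
  "(\<And>i. i \<in> I \<Longrightarrow> smooth (f i)) \<Longrightarrow> smooth (\<lambda>x. \<Prod>i\<in>I. f i x)"
  by (induction I rule: infinite_finite_induct) (auto intro: smooth_intros)

lemma smooth_power [smooth_intros]: "smooth f \<Longrightarrow> smooth (\<lambda>x. f x ^ n)"
  by (induction n) (auto intro: smooth_intros)

lemma smooth_inner_self [smooth_intros]: "smooth (\<lambda>x. inner x x)"
  by (subst euclidean_inner) (auto intro!: smooth_intros)

section \<open>The exponential and flat functions on the real line\<close>

lemma DERIV_imp_partial_deriv:
  "(f has_real_derivative D) (at x) \<Longrightarrow> partial_deriv 1 f x = D"
  by (simp add: has_field_derivative_def partial_deriv_eq)

lemma Ck_exp: "Ck k (exp :: real \<Rightarrow> real)"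
proof (induction k)
  case (Suc k)
  have "partial_deriv 1 exp = (exp :: real \<Rightarrow> real)"
    by (intro ext DERIV_imp_partial_deriv DERIV_exp)
  with Suc show ?case
    using field_differentiable_imp_differentiable field_differentiable_within_exp by auto
qed (auto intro: continuous_intros)

lemma smooth_exp: "smooth (exp :: real \<Rightarrow> real)"
  by (simp add: smooth_def Ck_exp)

lemma partial_deriv_sum:
  assumes "\<And>i. i \<in> I \<Longrightarrow> f i differentiable (at x)"
  shows "partial_deriv b (\<lambda>x. \<Sum>i\<in>I. f i x) x = (\<Sum>i\<in>I. partial_deriv b (f i) x)"
  using assms
  by (induction I rule: infinite_finite_induct) (auto simp: partial_deriv_add)

text \<open>The derivatives of \<open>exp (-1/s)\<close> are combinations of the functions below.\<close>

definition flat :: "nat \<Rightarrow> real \<Rightarrow> real" where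
  "flat n s = (if s > 0 then (1/s) ^ n * exp (- (1/s)) else 0)"

text \<open>On the right of 0 the substitution y = 1/s reduces this to the decay of y^n / exp y at
  infinity.\<close>

lemma flat_tendsto_0: "(flat n \<longlongrightarrow> 0) (at 0)"
proof (rule filterlim_split_at)
  have "(flat n \<longlongrightarrow> 0) (at_left 0) \<longleftrightarrow> ((\<lambda>s. 0::real) \<longlongrightarrow> 0) (at_left (0::real))"
    by (intro tendsto_cong) (auto simp: flat_def eventually_at_left_field intro: exI[of _ "-1"])
  then show "(flat n \<longlongrightarrow> 0) (at_left 0)" by simp
  have "((\<lambda>s. (inverse s) ^ n / exp (inverse s)) \<longlongrightarrow> (0::real)) (at_right 0)"
    by (rule filterlim_compose[OF tendsto_power_div_exp_0 filterlim_inverse_at_top_right])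
  moreover have "(flat n \<longlongrightarrow> 0) (at_right 0) \<longleftrightarrow>
      ((\<lambda>s. (inverse s) ^ n / exp (inverse s)) \<longlongrightarrow> (0::real)) (at_right 0)"
    by (intro tendsto_cong)
       (auto simp: flat_def eventually_at_right_field exp_minus divide_inverse intro: exI[of _ 1])
  ultimately show "(flat n \<longlongrightarrow> 0) (at_right 0)" by simp
qed

lemma flat_DERIV: "(flat n has_real_derivative (flat (n+2) s - real n * flat (n+1) s)) (at s)"
proof -
  consider "s > 0" | "s < 0" | "s = 0" by linarith
  then show ?thesis
  proof cases
    case 1
    have "((\<lambda>s. (1/s) ^ n * exp (- (1/s))) has_real_derivative (flat (n+2) s - real n * flat (n+1) s)) (at s)"
      using 1 by (auto intro!: derivative_eq_intros simp: flat_def field_simps power2_eq_square)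
        (cases n; auto simp: field_simps; cases "n - 1"; auto simp: field_simps)
    then show ?thesis
      by (rule has_field_derivative_transform_within_open[where S="{0<..}"])
         (use 1 in \<open>auto simp: flat_def\<close>)
  next
    case 2
    have "((\<lambda>s. 0) has_real_derivative (flat (n+2) s - real n * flat (n+1) s)) (at s)"
      using 2 by (auto simp: flat_def)
    then show ?thesis
      by (rule has_field_derivative_transform_within_open[where S="{..<0}"])
         (use 2 in \<open>auto simp: flat_def\<close>)
  next
    case 3
    \<comment> \<open>At 0 the difference quotient of \<open>flat n\<close> is
      \<open>flat (n+1)\<close> itself, so the derivative there is the limit already
      computed.\<close>
    have "(\<lambda>y. (flat n y - flat n 0) / (y - 0)) = flat (n+1)"
      by (auto simp: flat_def fun_eq_iff)
    with flat_tendsto_0[of "n+1"] show ?thesis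
      unfolding 3 has_field_derivative_iff by (simp add: flat_def)
  qed
qed

lemma Ck_flat: "Ck k (flat n)"
proof (induction k arbitrary: n)
  case 0
  show ?case using DERIV_continuous[OF flat_DERIV] by (auto intro: continuous_at_imp_continuous_on)
next
  case (Suc k)
  have "partial_deriv 1 (flat n) = (\<lambda>s. flat (n+2) s + (- real n) * flat (n+1) s)"
    by (auto intro!: ext simp: DERIV_imp_partial_deriv[OF flat_DERIV])
  moreover have "flat n differentiable (at s)" for s
    using flat_DERIV[of n s] by (auto simp: has_field_derivative_def differentiable_def)
  moreover have "Ck k (\<lambda>s. flat (n+2) s + (- real n) * flat (n+1) s)"
    by (intro Ck_add Ck_mult Ck_const Suc)
  ultimately show ?case by simp
qed

abbreviation bump :: "real \<Rightarrow> real" where "bump \<equiv> flat 0"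

lemma smooth_bump [smooth_intros]: "smooth f \<Longrightarrow> smooth (\<lambda>x. bump (f x))"
  by (rule smooth_compose) (simp add: smooth_def Ck_flat)

lemma bump_pos_iff [simp]: "0 < bump s \<longleftrightarrow> 0 < s"
  and bump_nonneg [simp]: "0 \<le> bump s"
  and bump_eq_0_iff [simp]: "bump s = 0 \<longleftrightarrow> s \<le> 0"
  by (auto simp: flat_def)

lemma bump_mono: "s \<le> t \<Longrightarrow> bump s \<le> bump t"
  by (auto simp: flat_def frac_le)

section \<open>Mean values along lines and symmetry of second derivatives\<close>

lemma smooth_has_derivative:
  "smooth f \<Longrightarrow> (f has_derivative (\<lambda>h. inner h (grad f x))) (at x)"
  by (intro has_derivative_grad smooth_differentiable)

lemma smooth_DERIV_line:
  assumes "smooth f"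
  shows "((\<lambda>t. f (x + t *\<^sub>R b)) has_real_derivative partial_deriv b f (x + t *\<^sub>R b)) (at t within S)"
proof -
  have 1: "((\<lambda>t. x + t *\<^sub>R b) has_derivative (\<lambda>s. s *\<^sub>R b)) (at t within S)"
    by (auto intro!: derivative_eq_intros)
  from has_derivative_compose[OF 1 smooth_has_derivative[OF assms]]
  show ?thesis
    by (simp add: has_field_derivative_def partial_deriv_eq[OF smooth_has_derivative[OF assms]] mult.commute mult_commute_abs)
qed

lemma smooth_mvt_line:
  assumes "smooth f" "0 < (s::real)"
  obtains t where "0 < t" "t < s" "f (x + s *\<^sub>R b) - f x = s * partial_deriv b f (x + t *\<^sub>R b)"
proof -
  from MVT2[OF assms(2), of "\<lambda>t. f (x + t *\<^sub>R b)" "\<lambda>t. partial_deriv b f (x + t *\<^sub>R b)"]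
    smooth_DERIV_line[OF assms(1)] that
  show ?thesis by fastforce
qed

text \<open>Both mixed derivatives are approximated by the same second difference.\<close>

lemma second_difference:
  assumes f: "smooth f" and b: "b \<in> Basis" and s: "0 < (s::real)"
  obtains t r where "0 < t" "t < s" "0 < r" "r < s"
    "f (x + s *\<^sub>R b + s *\<^sub>R c) - f (x + s *\<^sub>R b) - f (x + s *\<^sub>R c) + f x
      = s\<^sup>2 * partial_deriv c (partial_deriv b f) (x + t *\<^sub>R b + r *\<^sub>R c)"
proof -
  define g where "g = (\<lambda>y. f (1 *\<^sub>R y + s *\<^sub>R c) - f y)"
  have g: "smooth g" unfolding g_def by (intro smooth_intros f smooth_affine)
  have Dg: "partial_deriv b g y = partial_deriv b f (y + s *\<^sub>R c) - partial_deriv b f y" for y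
  proof -
    have "(g has_derivative (\<lambda>h. inner h (grad f (y + s *\<^sub>R c)) - inner h (grad f y))) (at y)"
      unfolding g_def
      by (intro has_derivative_diff smooth_has_derivative f has_derivative_compose[OF _ smooth_has_derivative])
         (auto intro!: derivative_eq_intros has_derivative_compose[OF _ smooth_has_derivative[OF f]])
    from partial_deriv_eq[OF this] show ?thesis
      by (simp add: partial_deriv_eq[OF smooth_has_derivative[OF f]])
  qed
  obtain t where t: "0 < t" "t < s" "g (x + s *\<^sub>R b) - g x = s * partial_deriv b g (x + t *\<^sub>R b)"
    using smooth_mvt_line[OF g s] by metis
  obtain r where r: "0 < r" "r < s"
    "partial_deriv b f (x + t *\<^sub>R b + s *\<^sub>R c) - partial_deriv b f (x + t *\<^sub>R b)
      = s * partial_deriv c (partial_deriv b f) (x + t *\<^sub>R b + r *\<^sub>R c)"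
    using smooth_mvt_line[OF smooth_partial_deriv[OF f b] s] by metis
  show thesis
  proof (rule that[OF t(1,2) r(1,2)])
    have "g (x + s *\<^sub>R b) - g x = s\<^sup>2 * partial_deriv c (partial_deriv b f) (x + t *\<^sub>R b + r *\<^sub>R c)"
      using t(3) r(3) by (simp add: Dg power2_eq_square)
    then show "f (x + s *\<^sub>R b + s *\<^sub>R c) - f (x + s *\<^sub>R b) - f (x + s *\<^sub>R c) + f x
      = s\<^sup>2 * partial_deriv c (partial_deriv b f) (x + t *\<^sub>R b + r *\<^sub>R c)"
      by (simp add: g_def)
  qed
qed

lemma partial_deriv_commute:
  assumes f: "smooth f" and b: "b \<in> Basis" and c: "c \<in> Basis"
  shows "partial_deriv c (partial_deriv b f) x = partial_deriv b (partial_deriv c f) x"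
proof (rule ccontr)
  let ?F = "partial_deriv c (partial_deriv b f)" and ?G = "partial_deriv b (partial_deriv c f)"
  assume ne: "?F x \<noteq> ?G x"
  define e where "e = \<bar>?F x - ?G x\<bar> / 2"
  have e: "e > 0" using ne by (simp add: e_def)
  have "isCont ?F x" "isCont ?G x"
    using smooth_differentiable[OF smooth_partial_deriv[OF smooth_partial_deriv[OF f]]] b c
    by (auto intro: differentiable_imp_continuous_within)
  then obtain d1 d2 where d: "d1 > 0" "d2 > 0"
    "\<And>y. dist y x < d1 \<Longrightarrow> dist (?F y) (?F x) < e"
    "\<And>y. dist y x < d2 \<Longrightarrow> dist (?G y) (?G x) < e"
    using e unfolding continuous_at_eps_delta by metis
  define s where "s = min d1 d2 / 3"
  have s: "s > 0" "2 * s < d1" "2 * s < d2" using d(1,2) by (auto simp: s_def)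
  have near: "dist (x + t *\<^sub>R b' + r *\<^sub>R c') x < 2 * s"
    if "0 < t" "t < s" "0 < r" "r < s" "b' \<in> Basis" "c' \<in> Basis" for t r and b' c' :: 'a
  proof -
    have "norm (t *\<^sub>R b' + r *\<^sub>R c') \<le> t + r"
      using that norm_triangle_ineq[of "t *\<^sub>R b'" "r *\<^sub>R c'"] by simp
    then show ?thesis using that by (simp add: dist_norm add.assoc)
  qed
  obtain t r where 1: "0 < t" "t < s" "0 < r" "r < s"
    "f (x + s *\<^sub>R b + s *\<^sub>R c) - f (x + s *\<^sub>R b) - f (x + s *\<^sub>R c) + f x
      = s\<^sup>2 * ?F (x + t *\<^sub>R b + r *\<^sub>R c)"
    using second_difference[OF f b s(1)] by metis
  obtain t' r' where 2: "0 < t'" "t' < s" "0 < r'" "r' < s"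
    "f (x + s *\<^sub>R c + s *\<^sub>R b) - f (x + s *\<^sub>R c) - f (x + s *\<^sub>R b) + f x
      = s\<^sup>2 * ?G (x + t' *\<^sub>R c + r' *\<^sub>R b)"
    using second_difference[OF f c s(1)] by metis
  have "s\<^sup>2 * ?F (x + t *\<^sub>R b + r *\<^sub>R c) = s\<^sup>2 * ?G (x + t' *\<^sub>R c + r' *\<^sub>R b)"
    unfolding 1(5)[symmetric] 2(5)[symmetric] by (simp add: algebra_simps)
  then have "?F (x + t *\<^sub>R b + r *\<^sub>R c) = ?G (x + t' *\<^sub>R c + r' *\<^sub>R b)" using s(1) by simp
  moreover have "dist (?F (x + t *\<^sub>R b + r *\<^sub>R c)) (?F x) < e"
    using near[OF 1(1-4) b c] s d(3) by fastforce
  moreover have "dist (?G (x + t' *\<^sub>R c + r' *\<^sub>R b)) (?G x) < e"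
    using near[OF 2(1-4) c b] s d(4) by fastforce
  ultimately have "dist (?F x) (?G x) < 2 * e"
    using dist_triangle_half_r[of _ "?F x" "2 * e" "?G x"] by simp
  then show False by (simp add: e_def dist_real_def)
qed

section \<open>Test functions and convolution\<close>

lemma test_functionD: "test_function f \<Longrightarrow> smooth f"
  by (simp add: test_function_def)

lemma test_function_iff: "test_function f \<longleftrightarrow> smooth f \<and> (\<exists>R. \<forall>x. f x \<noteq> 0 \<longrightarrow> norm x \<le> R)"
proof -
  have "compact (closure {x. f x \<noteq> 0}) \<longleftrightarrow> bounded {x. f x \<noteq> 0}"
    by (simp add: compact_closure)
  then show ?thesis
    by (auto simp: test_function_def bounded_iff)
qed

lemma test_functionE:
  assumes "test_function f"
  obtains R where "R > 0" "\<And>x. norm x > R \<Longrightarrow> f x = 0"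
proof -
  from assms obtain R where R: "\<forall>x. f x \<noteq> 0 \<longrightarrow> norm x \<le> R"
    by (auto simp: test_function_iff)
  show thesis by (rule that[of "max R 1"]) (use R in fastforce)+
qed

lemma test_function_mult_left [smooth_intros]:
  "test_function f \<Longrightarrow> smooth g \<Longrightarrow> test_function (\<lambda>x. f x * g x)"
  by (auto simp: test_function_iff intro: smooth_intros)

lemma test_function_mult_right [smooth_intros]:
  "test_function f \<Longrightarrow> smooth g \<Longrightarrow> test_function (\<lambda>x. g x * f x)"
  by (auto simp: test_function_iff intro: smooth_intros)

lemma test_function_add [smooth_intros]:
  assumes "test_function f" "test_function g"
  shows "test_function (\<lambda>x. f x + g x)"
proof -
  obtain R S where "\<And>x. norm x > R \<Longrightarrow> f x = 0" "\<And>x. norm x > S \<Longrightarrow> g x = 0"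
    by (metis assms test_functionE)
  then have "\<forall>x. f x + g x \<noteq> 0 \<longrightarrow> norm x \<le> max R S"
    by (metis add_0 linorder_not_le max.bounded_iff max.strict_boundedE)
  then show ?thesis
    using assms unfolding test_function_iff by (auto intro: smooth_intros)
qed

lemma test_function_0 [smooth_intros]: "test_function (\<lambda>x. 0)"
  by (auto simp: test_function_iff intro: smooth_intros)

lemma test_function_sum [smooth_intros]:
  "(\<And>i. i \<in> I \<Longrightarrow> test_function (f i)) \<Longrightarrow> test_function (\<lambda>x. \<Sum>i\<in>I. f i x)"
  by (induction I rule: infinite_finite_induct) (auto intro: smooth_intros)

lemma partial_deriv_eq_0_outside:
  assumes "\<And>x. norm x > R \<Longrightarrow> f x = 0" "norm x > R"
  shows "partial_deriv b f x = 0"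
proof -
  have "open {x::'a. norm x > R}" by (intro open_Collect_less continuous_intros)
  then have "(f has_derivative (\<lambda>h. 0)) (at x)"
    by (rule has_derivative_transform_within_open[OF has_derivative_const[of 0]]) (use assms in auto)
  then show ?thesis by (rule partial_deriv_eq)
qed

lemma test_function_partial_deriv [smooth_intros]:
  assumes "test_function f" "b \<in> Basis"
  shows "test_function (partial_deriv b f)"
proof -
  obtain R where "\<And>x. norm x > R \<Longrightarrow> f x = 0" by (metis assms(1) test_functionE)
  from partial_deriv_eq_0_outside[OF this, where b=b]
  have "\<forall>x. partial_deriv b f x \<noteq> 0 \<longrightarrow> norm x \<le> R" by force
  then show ?thesis
    using assms by (auto simp: test_function_iff intro: smooth_intros)
qed

lemma test_function_affine:
  assumes "test_function f" "s \<noteq> 0"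
  shows "test_function (\<lambda>y. f (s *\<^sub>R y + p))"
proof -
  obtain R where R: "\<And>x. norm x > R \<Longrightarrow> f x = 0" by (metis assms(1) test_functionE)
  have "norm y \<le> (R + norm p) / \<bar>s\<bar>" if "f (s *\<^sub>R y + p) \<noteq> 0" for y
  proof -
    have "norm (s *\<^sub>R y + p) \<le> R" using that R by force
    then have "\<bar>s\<bar> * norm y \<le> R + norm p"
      using norm_triangle_ineq4[of "s *\<^sub>R y + p" p] by simp
    then show ?thesis using assms(2) by (simp add: field_simps)
  qed
  then show ?thesis
    using assms by (auto simp: test_function_iff intro: smooth_affine)
qed

lemma smooth_bounded_cball:
  assumes "smooth f"
  obtains B where "B > 0" "\<And>x. norm x \<le> R \<Longrightarrow> \<bar>f x\<bar> \<le> B"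
proof -
  have "compact (f ` cball 0 R)"
    by (intro compact_continuous_image smooth_continuous assms compact_cball)
  then obtain B where "B > 0" "\<And>x. x \<in> cball 0 R \<Longrightarrow> \<bar>f x\<bar> \<le> B"
    using compact_imp_bounded bounded_pos by (metis image_eqI real_norm_def)
  then show thesis by (intro that[of B]) auto
qed

lemma test_function_bounded:
  assumes "test_function f"
  obtains B where "B > 0" "\<And>x. \<bar>f x\<bar> \<le> B"
proof -
  obtain R where R: "\<And>x. norm x > R \<Longrightarrow> f x = 0" by (metis assms test_functionE)
  obtain B where "B > 0" "\<And>x. norm x \<le> R \<Longrightarrow> \<bar>f x\<bar> \<le> B"
    using smooth_bounded_cball[OF test_functionD[OF assms]] by metis
  then show thesis
    by (intro that[of B]) (use R in \<open>force simp: not_le\<close>)+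
qed

lemma smooth_borel_measurable [measurable_dest]: "smooth f \<Longrightarrow> f \<in> borel_measurable borel"
  by (intro borel_measurable_continuous_onI smooth_continuous)

lemma test_function_borel_measurable [measurable_dest]:
  "test_function f \<Longrightarrow> f \<in> borel_measurable borel"
  by (intro smooth_borel_measurable test_functionD)

text \<open>A class wide enough for everything that is convolved below: L2 functions, constants, and
  products such as v \<psi> that may leave L2.\<close>

definition locally_integrable :: "('a::euclidean_space \<Rightarrow> real) \<Rightarrow> bool" where
  "locally_integrable f \<longleftrightarrow> (\<forall>R. set_integrable lborel (cball 0 R) f)"

lemma locally_integrable_measurable [measurable_dest]:
  assumes "locally_integrable f"
  shows "f \<in> borel_measurable borel"
proof (rule borel_measurable_LIMSEQ_metric)
  show "(\<lambda>x. indicator (cball 0 (real i)) x *\<^sub>R f x) \<in> borel_measurable borel" for i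
    using assms borel_measurable_integrable[of lborel "\<lambda>x. indicator (cball 0 (real i)) x *\<^sub>R f x"]
    by (simp add: locally_integrable_def set_integrable_def)
  show "(\<lambda>i. indicator (cball 0 (real i)) x *\<^sub>R f x) \<longlonglongrightarrow> f x" for x :: 'a
  proof (rule tendsto_eventually)
    show "\<forall>\<^sub>F i in sequentially. indicator (cball 0 (real i)) x *\<^sub>R f x = f x"
      using eventually_ge_at_top[of "nat \<lceil>norm x\<rceil>"]
      by eventually_elim (auto simp: indicator_def nat_le_iff ceiling_le_iff)
  qed
qed

lemma L2_locally_integrable:
  assumes "L2 f"
  shows "locally_integrable f"
  unfolding locally_integrable_def set_integrable_def
proof
  fix R
  have [measurable]: "f \<in> borel_measurable borel" using assms by (simp add: L2_def)
  note [measurable] = borel_closed[OF closed_cball]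
  show "integrable lborel (\<lambda>x. indicator (cball 0 R) x *\<^sub>R f x)"
  proof (rule Bochner_Integration.integrable_bound)
    show "integrable lborel (\<lambda>x. indicator (cball 0 R) x + (norm (f x))\<^sup>2)"
      using assms by (intro Bochner_Integration.integrable_add integrable_real_indicator)
        (auto simp: L2_def emeasure_bounded_finite[OF bounded_cball, unfolded infinity_ennreal_def])
    have "\<bar>t\<bar> \<le> 1 + t\<^sup>2" for t :: real
      using zero_le_power2[of "\<bar>t\<bar> - 1"] by (simp add: power2_eq_square algebra_simps abs_if split: if_splits)
    then show "AE x in lborel. norm (indicator (cball 0 R) x *\<^sub>R f x)
        \<le> norm (indicator (cball 0 R) x + (norm (f x))\<^sup>2)"
      by (auto simp: indicator_def)
  qed measurable
qed

lemma test_mult_integrable: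
  assumes "locally_integrable f" "test_function \<phi>"
  shows "integrable lborel (\<lambda>x. \<phi> x * f x)"
proof -
  obtain R where R: "\<And>x. norm x > R \<Longrightarrow> \<phi> x = 0" by (metis assms(2) test_functionE)
  obtain B where B: "B > 0" "\<And>x. \<bar>\<phi> x\<bar> \<le> B" by (metis assms(2) test_function_bounded)
  note [measurable] = borel_closed[OF closed_cball] locally_integrable_measurable[OF assms(1)] test_function_borel_measurable[OF assms(2)]
  show ?thesis
  proof (rule Bochner_Integration.integrable_bound)
    show "integrable lborel (\<lambda>x. B * (indicator (cball 0 R) x *\<^sub>R f x))"
      using assms(1) by (intro integrable_mult_right) (auto simp: locally_integrable_def set_integrable_def)
    show "AE x in lborel. norm (\<phi> x * f x) \<le> norm (B * (indicator (cball 0 R) x *\<^sub>R f x))"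
      using B R by (auto simp: indicator_def abs_mult intro!: mult_right_mono)
  qed measurable
qed

lemma locally_integrable_const [simp]: "locally_integrable (\<lambda>x. c)"
  by (auto simp: locally_integrable_def set_integrable_def emeasure_bounded_finite[OF bounded_cball, unfolded infinity_ennreal_def]
      intro!: integrable_mult_left integrable_real_indicator)

lemma test_integrable: "test_function \<phi> \<Longrightarrow> integrable lborel \<phi>"
  using test_mult_integrable[of "\<lambda>x. 1" \<phi>] by simp

lemma smooth_locally_integrable:
  assumes "smooth f"
  shows "locally_integrable f"
  unfolding locally_integrable_def set_integrable_def
  by (intro allI borel_integrable_compact smooth_continuous assms compact_cball) 

lemma locally_integrable_mult_smooth:
  assumes "locally_integrable f" "smooth g"
  shows "locally_integrable (\<lambda>x. g x * f x)"
  unfolding locally_integrable_def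
proof
  fix R
  obtain B where B: "B > 0" "\<And>x. norm x \<le> R \<Longrightarrow> \<bar>g x\<bar> \<le> B"
    using smooth_bounded_cball[OF assms(2)] by metis
  note [measurable] = borel_closed[OF closed_cball] locally_integrable_measurable[OF assms(1)] smooth_borel_measurable[OF assms(2)]
  show "set_integrable lborel (cball 0 R) (\<lambda>x. g x * f x)"
    unfolding set_integrable_def
  proof (rule Bochner_Integration.integrable_bound)
    show "integrable lborel (\<lambda>x. B * (indicator (cball 0 R) x *\<^sub>R f x))"
      using assms(1) by (intro integrable_mult_right) (auto simp: locally_integrable_def set_integrable_def)
    show "AE x in lborel. norm (indicator (cball 0 R) x *\<^sub>R (g x * f x))
      \<le> norm (B * (indicator (cball 0 R) x *\<^sub>R f x))"
      using B by (auto simp: indicator_def abs_mult intro!: mult_right_mono)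
  qed measurable
qed

section \<open>Convolution with test functions\<close>

definition conv :: "('a::euclidean_space \<Rightarrow> real) \<Rightarrow> ('a \<Rightarrow> real) \<Rightarrow> 'a \<Rightarrow> real" where
  "conv \<kappa> f x = (LINT y|lborel. \<kappa> (x - y) * f y)"

lemma test_function_reflect: "test_function \<kappa> \<Longrightarrow> test_function (\<lambda>y. \<kappa> (x - y))"
  using test_function_affine[of \<kappa> "-1" x] by simp

lemma partial_deriv_reflect:
  "smooth \<kappa> \<Longrightarrow> partial_deriv b (\<lambda>y. \<kappa> (x - y)) y = - partial_deriv b \<kappa> (x - y)"
  using partial_deriv_affine[of \<kappa> "-1" y x b] smooth_differentiable[of \<kappa>] by simp

lemma conv_integrable:
  "locally_integrable f \<Longrightarrow> test_function \<kappa> \<Longrightarrow> integrable lborel (\<lambda>y. \<kappa> (x - y) * f y)"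
  by (intro test_mult_integrable test_function_reflect)

lemma test_function_Lipschitz:
  assumes "test_function f"
  obtains L where "L > 0" "\<And>x y. \<bar>f x - f y\<bar> \<le> L * norm (x - y)"
proof -
  have "\<exists>B>0. \<forall>x. \<bar>partial_deriv b f x\<bar> \<le> B" if "b \<in> Basis" for b
    using test_function_bounded[OF test_function_partial_deriv[OF assms that]] by metis
  then obtain B where B: "\<And>b. b \<in> Basis \<Longrightarrow> B b > 0" "\<And>b x. b \<in> Basis \<Longrightarrow> \<bar>partial_deriv b f x\<bar> \<le> B b"
    by metis
  define L where "L = (\<Sum>b\<in>Basis. B b)"
  have gradL: "norm (grad f x) \<le> L" for x
    unfolding grad_def L_def by (rule sum_norm_le) (use B in auto)
  have "norm (f x - f y) \<le> L * norm (x - y)" for x y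
  proof (rule differentiable_bound[of UNIV f "\<lambda>x h. inner h (grad f x)"])
    show "(f has_derivative (\<lambda>h. h \<bullet> grad f x)) (at x within UNIV)" for x
      using smooth_has_derivative[OF test_functionD[OF assms]] .
    show "onorm (\<lambda>h. h \<bullet> grad f x) \<le> L" for x
      by (rule onorm_le) (metis Cauchy_Schwarz_ineq2 gradL mult.commute mult_left_mono norm_ge_zero
          order_trans real_norm_def)
  qed auto
  moreover have "L > 0" unfolding L_def using B by (intro sum_pos) auto
  ultimately show thesis by (intro that) auto
qed

text \<open>The mean value theorem on the segment from x to x + h, together with a Lipschitz bound
  for the gradient. The remainder is uniform in x, which allows differentiation under the
  convolution integral by a direct estimate.\<close>

lemma test_function_Taylor:
  assumes "test_function f"
  obtains L where "L > 0" "\<And>x h. \<bar>f (x + h) - f x - inner h (grad f x)\<bar> \<le> L * (norm h)\<^sup>2"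
proof -
  have "\<exists>L>0. \<forall>x y. \<bar>partial_deriv b f x - partial_deriv b f y\<bar> \<le> L * norm (x - y)" if "b \<in> Basis" for b
    using test_function_Lipschitz[OF test_function_partial_deriv[OF assms that]] by metis
  then obtain L where L: "\<And>b. b \<in> Basis \<Longrightarrow> L b > 0"
    "\<And>b x y. b \<in> Basis \<Longrightarrow> \<bar>partial_deriv b f x - partial_deriv b f y\<bar> \<le> L b * norm (x - y)"
    by metis
  define M where "M = (\<Sum>b\<in>Basis. L b)"
  have M: "M > 0" unfolding M_def using L by (intro sum_pos) auto
  have gradM: "norm (grad f x - grad f y) \<le> M * norm (x - y)" for x y
    unfolding grad_def M_def sum_subtractf[symmetric] scaleR_diff_left[symmetric] sum_distrib_right
    by (rule sum_norm_le) (use L in auto)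
  show thesis
  proof (rule that[OF M])
    fix x h
    show "\<bar>f (x + h) - f x - inner h (grad f x)\<bar> \<le> M * (norm h)\<^sup>2"
    proof (cases "norm h = 0")
      case False
      define g where "g = (\<lambda>t. f (x + t *\<^sub>R h) - t * inner h (grad f x))"
      have "(g has_real_derivative inner h (grad f (x + t *\<^sub>R h) - grad f x)) (at t)" for t
        unfolding g_def inner_diff_right
        using smooth_DERIV_line[OF test_functionD[OF assms], of x h t UNIV]
          partial_deriv_eq[OF smooth_has_derivative[OF test_functionD[OF assms]]]
        by (auto intro!: derivative_eq_intros)
      then obtain t where t: "0 < t" "t < 1" "g 1 - g 0 = inner h (grad f (x + t *\<^sub>R h) - grad f x)"
        using MVT2[of 0 1 g "\<lambda>t. inner h (grad f (x + t *\<^sub>R h) - grad f x)"] by auto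
      have "\<bar>g 1 - g 0\<bar> \<le> norm h * norm (grad f (x + t *\<^sub>R h) - grad f x)"
        unfolding t(3) by (rule Cauchy_Schwarz_ineq2)
      also have "\<dots> \<le> norm h * (M * norm h)"
      proof -
        have "norm (grad f (x + t *\<^sub>R h) - grad f x) \<le> M * (t * norm h)"
          using gradM[of "x + t *\<^sub>R h" x] t by simp
        also have "\<dots> \<le> M * (1 * norm h)" using t M by (intro mult_left_mono mult_right_mono) auto
        finally show ?thesis by (intro mult_left_mono) auto
      qed
      finally show ?thesis by (simp add: g_def power2_eq_square algebra_simps)
    qed simp
  qed
qed

lemma conv_has_derivative:
  assumes f: "locally_integrable f" and \<kappa>: "test_function \<kappa>"
  shows "(conv \<kappa> f has_derivative (\<lambda>h. \<Sum>b\<in>Basis. inner h b * conv (partial_deriv b \<kappa>) f x)) (at x)"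
proof -
  obtain L where L: "L > 0" "\<And>x h. \<bar>\<kappa> (x + h) - \<kappa> x - inner h (grad \<kappa> x)\<bar> \<le> L * (norm h)\<^sup>2"
    using test_function_Taylor[OF \<kappa>] by metis
  obtain R where R: "R > 0" "\<And>x. norm x > R \<Longrightarrow> \<kappa> x = 0" by (metis \<kappa> test_functionE)
  \<comment> \<open>For \<open>norm h \<le> 1\<close> the Taylor remainder at x - y vanishes when y
    is outside this ball, because both x - y and x + h - y then lie outside the support of the
    kernel.\<close>
  define C where "C = (LINT y|lborel. \<bar>indicator (cball 0 (norm x + R + 1)) y *\<^sub>R f y\<bar>)"
  let ?D = "\<lambda>h. \<Sum>b\<in>Basis. inner h b * conv (partial_deriv b \<kappa>) f x"
  have fC: "integrable lborel (\<lambda>y. \<bar>indicator (cball 0 (norm x + R + 1)) y *\<^sub>R f y\<bar>)"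
    using f by (auto simp: locally_integrable_def set_integrable_def intro: integrable_abs)
  have D: "integrable lborel (\<lambda>y. inner h (grad \<kappa> (x - y)) * f y)
      \<and> ?D h = (LINT y|lborel. inner h (grad \<kappa> (x - y)) * f y)" for h
  proof -
    have i: "integrable lborel (\<lambda>y. partial_deriv b \<kappa> (x - y) * f y)" if "b \<in> Basis" for b
      by (intro conv_integrable f test_function_partial_deriv \<kappa> that)
    have e: "inner h (grad \<kappa> (x - y)) * f y = (\<Sum>b\<in>Basis. inner h b * (partial_deriv b \<kappa> (x - y) * f y))" for y
      by (simp add: grad_def inner_sum_right sum_distrib_right sum_distrib_left mult_ac)
    show ?thesis unfolding e conv_def using i by (auto simp: integral_sum)
  qed
  have est: "\<bar>conv \<kappa> f (x + h) - conv \<kappa> f x - ?D h\<bar> \<le> L * (norm h)\<^sup>2 * C" if h: "norm h \<le> 1" for h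
  proof -
    have "conv \<kappa> f (x + h) - conv \<kappa> f x - ?D h
      = (LINT y|lborel. \<kappa> (x + h - y) * f y - \<kappa> (x - y) * f y - inner h (grad \<kappa> (x - y)) * f y)"
      using D[of h] conv_integrable[OF f \<kappa>] unfolding conv_def by simp
    also have "\<bar>\<dots>\<bar> \<le> (LINT y|lborel. L * (norm h)\<^sup>2 * \<bar>indicator (cball 0 (norm x + R + 1)) y *\<^sub>R f y\<bar>)"
    proof (rule integral_abs_bound[THEN order_trans], rule integral_mono)
      fix y
      let ?e = "\<kappa> (x + h - y) - \<kappa> (x - y) - inner h (grad \<kappa> (x - y))"
      have "\<bar>?e\<bar> \<le> L * (norm h)\<^sup>2" using L(2)[of "x - y" h] by (simp add: algebra_simps)
      moreover have "?e = 0" if "y \<notin> cball 0 (norm x + R + 1)"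
      proof -
        have "norm y > norm x + R + 1" using that by simp
        then have "norm (x - y) > R + norm h" "norm (x - y) > R"
          using norm_triangle_ineq2[of y x] h by (auto simp: norm_minus_commute)
        moreover from this have "norm (x + h - y) > R"
          using norm_triangle_ineq4[of "x + h - y" h] by simp
        ultimately show ?thesis
          using R(2) partial_deriv_eq_0_outside[of R \<kappa> "x - y"] by (simp add: grad_def)
      qed
      ultimately have "\<bar>?e\<bar> * \<bar>f y\<bar> \<le> L * (norm h)\<^sup>2 * (indicator (cball 0 (norm x + R + 1)) y * \<bar>f y\<bar>)"
        by (cases "y \<in> cball 0 (norm x + R + 1)") (auto intro: mult_right_mono)
      then show "\<bar>\<kappa> (x + h - y) * f y - \<kappa> (x - y) * f y - inner h (grad \<kappa> (x - y)) * f y\<bar>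
        \<le> L * (norm h)\<^sup>2 * \<bar>indicator (cball 0 (norm x + R + 1)) y *\<^sub>R f y\<bar>"
        by (simp add: abs_mult[symmetric] left_diff_distrib abs_mult)
    next
      show "integrable lborel (\<lambda>y. \<bar>\<kappa> (x + h - y) * f y - \<kappa> (x - y) * f y - inner h (grad \<kappa> (x - y)) * f y\<bar>)"
        using D[of h] conv_integrable[OF f \<kappa>] by auto
    qed (use fC in auto)
    finally show ?thesis by (simp add: C_def)
  qed
  have C0: "C \<ge> 0" unfolding C_def by simp
  show ?thesis
    unfolding has_derivative_at_alt
  proof (intro conjI allI impI)
    show "bounded_linear ?D"
      by (intro bounded_linear_sum bounded_linear_mult_const bounded_linear_inner_left)
    fix e :: real assume e: "e > 0"
    \<comment> \<open>The added 1 keeps the denominator positive when \<open>C = 0\<close>.\<close>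
    define d where "d = min 1 (e / (L * C + 1))"
    have d: "d > 0" using e L C0 by (auto simp: d_def add_nonneg_pos)
    have "\<bar>conv \<kappa> f y - conv \<kappa> f x - ?D (y - x)\<bar> \<le> e * norm (y - x)" if "norm (y - x) < d" for y
    proof -
      have "\<bar>conv \<kappa> f y - conv \<kappa> f x - ?D (y - x)\<bar> \<le> L * (norm (y - x))\<^sup>2 * C"
        using est[of "y - x"] that by (simp add: d_def)
      also have "\<dots> = (L * C * norm (y - x)) * norm (y - x)" by (simp add: power2_eq_square)
      also have "\<dots> \<le> e * norm (y - x)"
      proof (rule mult_right_mono)
        have "L * C * norm (y - x) \<le> (L * C + 1) * (e / (L * C + 1))"
          using that L C0 e by (intro mult_mono) (auto simp: d_def)
        also have "\<dots> = e" using L C0 by (simp add: add_nonneg_eq_0_iff)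
        finally show "L * C * norm (y - x) \<le> e" .
      qed simp
      finally show ?thesis .
    qed
    with d show "\<exists>d>0. \<forall>y. norm (y - x) < d \<longrightarrow>
        norm (conv \<kappa> f y - conv \<kappa> f x - ?D (y - x)) \<le> e * norm (y - x)" by auto
  qed
qed

lemma partial_deriv_conv:
  assumes "locally_integrable f" "test_function \<kappa>" "b \<in> Basis"
  shows "partial_deriv b (conv \<kappa> f) = conv (partial_deriv b \<kappa>) f"
proof
  fix x
  have "partial_deriv b (conv \<kappa> f) x = (\<Sum>c\<in>Basis. inner b c * conv (partial_deriv c \<kappa>) f x)"
    by (rule partial_deriv_eq[OF conv_has_derivative[OF assms(1,2)]])
  also have "\<dots> = (\<Sum>c\<in>Basis. if c = b then conv (partial_deriv c \<kappa>) f x else 0)"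
    using assms(3) by (intro sum.cong) (auto simp: inner_Basis)
  finally show "partial_deriv b (conv \<kappa> f) x = conv (partial_deriv b \<kappa>) f x"
    using assms(3) by simp
qed

text \<open>Each derivative falls on the kernel, which remains a test function; hence the induction
  over all kernels.\<close>

lemma smooth_conv [smooth_intros]:
  assumes f: "locally_integrable f" and \<kappa>: "test_function \<kappa>"
  shows "smooth (conv \<kappa> f)"
proof -
  have diff: "conv \<kappa> f differentiable (at x)" if "test_function \<kappa>" for \<kappa> x
    using conv_has_derivative[OF f that] by (auto simp: differentiable_def)
  have "Ck k (conv \<kappa> f)" for k
    using \<kappa>
  proof (induction k arbitrary: \<kappa>)
    case 0
    then show ?case using diff
      by (simp add: differentiable_imp_continuous_on differentiable_on_def)
  next
    case (Suc k)
    then show ?case using diff partial_deriv_conv[OF f] by (auto intro: smooth_intros)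
  qed
  then show ?thesis by (simp add: smooth_def)
qed

lemma lborel_distr_reflect:
  fixes x :: "'a::euclidean_space"
  shows "distr lborel borel (\<lambda>y. x - y) = lborel"
  using lborel_affine[of "-1" x] by (simp add: density_1)

lemma integral_reflect:
  fixes f :: "'a::euclidean_space \<Rightarrow> real"
  assumes [measurable]: "f \<in> borel_measurable borel"
  shows "(LINT y|lborel. f (x - y)) = (LINT y|lborel. f y)"
  by (subst (2) lborel_distr_reflect[of x, symmetric]) (simp add: integral_distr)

text \<open>Convolving \<phi> with the constant 1 gives a constant function, whose derivative is 0
  but also equals the convolution of the derivative of \<phi> with 1. This is the divergence theorem
  on which \<open>integral_by_parts\<close> and \<open>virial_identity\<close> rest.\<close>

lemma integral_partial_deriv_eq_0:
  assumes \<phi>: "test_function \<phi>" and b: "b \<in> Basis"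
  shows "(LINT x|lborel. partial_deriv b \<phi> x) = 0"
proof -
  have "conv \<phi> (\<lambda>_. 1) = (\<lambda>x. LINT y|lborel. \<phi> y)"
    using integral_reflect[OF test_function_borel_measurable[OF \<phi>]] by (simp add: conv_def fun_eq_iff)
  then have "conv (partial_deriv b \<phi>) (\<lambda>_. 1) 0 = 0"
    using partial_deriv_conv[OF _ \<phi> b, of "\<lambda>_. 1"] by (metis locally_integrable_const partial_deriv_const)
  then show ?thesis
    using integral_reflect[OF test_function_borel_measurable[OF test_function_partial_deriv[OF \<phi> b]], of 0]
    by (simp add: conv_def)
qed

section \<open>Density of test functions in L2\<close>

lemma L2_measurable [measurable_dest]: "L2 f \<Longrightarrow> f \<in> borel_measurable borel"
  by (simp add: L2_def)

lemma L2_real_iff: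
  fixes f :: "'a::euclidean_space \<Rightarrow> real"
  shows "L2 f \<longleftrightarrow> f \<in> borel_measurable borel \<and> integrable lborel (\<lambda>x. (f x)\<^sup>2)"
  by (simp add: L2_def)

lemma L2_mult_integrable:
  fixes f g :: "'a::euclidean_space \<Rightarrow> real"
  assumes "L2 f" "L2 g"
  shows "integrable lborel (\<lambda>x. f x * g x)"
proof (rule Bochner_Integration.integrable_bound)
  note [measurable] = L2_measurable[OF assms(1)] L2_measurable[OF assms(2)]
  show "integrable lborel (\<lambda>x. (f x)\<^sup>2 + (g x)\<^sup>2)"
    using assms by (auto simp: L2_real_iff)
  show "(\<lambda>x. f x * g x) \<in> borel_measurable lborel" by measurable
  have "\<bar>s * t\<bar> \<le> s\<^sup>2 + t\<^sup>2" for s t :: real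
    using sum_squares_bound[of "\<bar>s\<bar>" "\<bar>t\<bar>"] mult_nonneg_nonneg[of "\<bar>s\<bar>" "\<bar>t\<bar>"]
    by (simp add: abs_mult del: mult_nonneg_nonneg)
  then show "AE x in lborel. norm (f x * g x) \<le> norm ((f x)\<^sup>2 + (g x)\<^sup>2)"
    by simp
qed

lemma L2_dominated:
  fixes f g :: "'a::euclidean_space \<Rightarrow> real"
  assumes "L2 g" "f \<in> borel_measurable borel" "\<And>x. \<bar>f x\<bar> \<le> \<bar>g x\<bar>"
  shows "L2 f"
  unfolding L2_real_iff
proof (intro conjI assms)
  note [measurable] = assms(2)
  show "integrable lborel (\<lambda>x. (f x)\<^sup>2)"
    by (rule Bochner_Integration.integrable_bound[of _ "\<lambda>x. (g x)\<^sup>2"])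
       (use assms in \<open>auto simp: L2_real_iff abs_le_square_iff\<close>)
qed

lemma L2_cmult: "L2 f \<Longrightarrow> L2 (\<lambda>x. c * f x :: real)"
  by (auto simp: L2_real_iff power_mult_distrib)

lemma L2_add:
  fixes f g :: "'a::euclidean_space \<Rightarrow> real"
  assumes "L2 f" "L2 g"
  shows "L2 (\<lambda>x. f x + g x)"
  using assms L2_mult_integrable[OF assms]
  by (auto simp: L2_real_iff power2_sum mult.assoc)

lemma L2_diff:
  fixes f g :: "'a::euclidean_space \<Rightarrow> real"
  shows "L2 f \<Longrightarrow> L2 g \<Longrightarrow> L2 (\<lambda>x. f x - g x)"
  using L2_add[of f "\<lambda>x. (-1) * g x"] L2_cmult[of g "-1"] by simp

lemma test_function_L2: "test_function \<phi> \<Longrightarrow> L2 \<phi>"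
  using test_integrable[OF test_function_mult_left[of \<phi> \<phi>]]
  by (auto simp: L2_real_iff power2_eq_square dest: test_functionD intro: smooth_borel_measurable)

lemma L2_bounded_mult:
  fixes f :: "'a::euclidean_space \<Rightarrow> real"
  assumes "L2 f" "g \<in> borel_measurable borel" "\<And>x. \<bar>g x\<bar> \<le> B"
  shows "L2 (\<lambda>x. g x * f x)"
proof (rule L2_dominated[OF L2_cmult[OF assms(1), of B]])
  note [measurable] = L2_measurable[OF assms(1)] assms(2)
  show "(\<lambda>x. g x * f x) \<in> borel_measurable borel" by measurable
  show "\<bar>g x * f x\<bar> \<le> \<bar>B * f x\<bar>" for x
    using assms(3)[of x] by (simp add: abs_mult mult_right_mono)
qed

lemma L2_test_mult: "L2 f \<Longrightarrow> test_function \<eta> \<Longrightarrow> L2 (\<lambda>x. \<eta> x * f x)"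
  by (metis L2_bounded_mult test_function_bounded test_function_borel_measurable)

definition L2_approximable :: "('a::euclidean_space \<Rightarrow> real) \<Rightarrow> bool" where
  "L2_approximable f \<longleftrightarrow> L2 f \<and>
     (\<forall>e>0. \<exists>\<phi>. test_function \<phi> \<and> (LINT x|lborel. (f x - \<phi> x)\<^sup>2) < e)"

lemma integral_square_triangle:
  fixes f g k :: "'a::euclidean_space \<Rightarrow> real"
  assumes "L2 f" "L2 g" "L2 k"
  shows "(LINT x|lborel. (f x - k x)\<^sup>2)
      \<le> 2 * (LINT x|lborel. (f x - g x)\<^sup>2) + 2 * (LINT x|lborel. (g x - k x)\<^sup>2)"
proof -
  have 1: "integrable lborel (\<lambda>x. (f x - g x)\<^sup>2)" "integrable lborel (\<lambda>x. (g x - k x)\<^sup>2)"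
    "integrable lborel (\<lambda>x. (f x - k x)\<^sup>2)"
    using L2_diff assms by (auto simp: L2_real_iff)
  have "(f x - k x)\<^sup>2 \<le> 2 * (f x - g x)\<^sup>2 + 2 * (g x - k x)\<^sup>2" for x
    using zero_le_power2[of "(f x - g x) - (g x - k x)"] by (simp add: power2_eq_square algebra_simps)
  then have "(LINT x|lborel. (f x - k x)\<^sup>2)
      \<le> (LINT x|lborel. 2 * (f x - g x)\<^sup>2 + 2 * (g x - k x)\<^sup>2)"
    using 1 by (intro integral_mono) auto
  then show ?thesis using 1 by simp
qed

lemma L2_approximable_closed:
  assumes "L2 f" "\<And>e. e > 0 \<Longrightarrow> \<exists>g. L2_approximable g \<and> (LINT x|lborel. (f x - g x)\<^sup>2) < e"
  shows "L2_approximable f"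
  unfolding L2_approximable_def
proof (intro conjI allI impI assms(1))
  fix e :: real assume e: "e > 0"
  obtain g where g: "L2_approximable g" "(LINT x|lborel. (f x - g x)\<^sup>2) < e/4"
    using assms(2)[of "e/4"] e by auto
  obtain \<phi> where \<phi>: "test_function \<phi>" "(LINT x|lborel. (g x - \<phi> x)\<^sup>2) < e/4"
    using g(1) e unfolding L2_approximable_def by (metis divide_pos_pos zero_less_numeral)
  have "(LINT x|lborel. (f x - \<phi> x)\<^sup>2) < e"
    using integral_square_triangle[OF assms(1) _ test_function_L2[OF \<phi>(1)], of g] g \<phi>
    by (auto simp: L2_approximable_def)
  with \<phi> show "\<exists>\<phi>. test_function \<phi> \<and> (LINT x|lborel. (f x - \<phi> x)\<^sup>2) < e" by blast
qed

text \<open>Dominated convergence with majorant (2 g)^2. It serves every limit passage of the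
  density proof: smooth cutoffs tending to a box, countable disjoint unions, exhaustion by boxes,
  and monotone limits.\<close>

lemma L2_approximable_dominated:
  fixes f :: "'a::euclidean_space \<Rightarrow> real"
  assumes s: "\<And>i. L2_approximable (s i)" and f: "f \<in> borel_measurable borel"
    and lim: "\<And>x. (\<lambda>i. s i x) \<longlonglongrightarrow> f x" and g: "L2 g" "\<And>i x. \<bar>s i x\<bar> \<le> \<bar>g x\<bar>"
  shows "L2_approximable f"
proof -
  have sm: "s i \<in> borel_measurable borel" for i using s by (simp add: L2_approximable_def L2_real_iff)
  note [measurable] = sm f L2_measurable[OF g(1)]
  have fg: "\<bar>f x\<bar> \<le> \<bar>g x\<bar>" for x
    by (rule tendsto_upperbound[OF tendsto_rabs[OF lim]]) (use g in auto)
  have f2: "L2 f" by (rule L2_dominated[OF g(1) f fg])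
  have "(\<lambda>i. LINT x|lborel. (f x - s i x)\<^sup>2) \<longlonglongrightarrow> (LINT x::'a|lborel. (0::real))"
  proof (rule integral_dominated_convergence)
    show "integrable lborel (\<lambda>x. 4 * (g x)\<^sup>2)" using g by (auto simp: L2_real_iff)
    have "(\<lambda>i. (f x - s i x)\<^sup>2) \<longlonglongrightarrow> (f x - f x)\<^sup>2" for x by (intro tendsto_intros lim)
    then show "AE x in lborel. (\<lambda>i. (f x - s i x)\<^sup>2) \<longlonglongrightarrow> 0" by simp
    show "AE x in lborel. norm ((f x - s i x)\<^sup>2) \<le> 4 * (g x)\<^sup>2" for i
    proof (rule AE_I2)
      fix x
      have "\<bar>f x - s i x\<bar> \<le> \<bar>2 * g x\<bar>" using fg[of x] g(2)[of i x] by linarith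
      then have "(f x - s i x)\<^sup>2 \<le> (2 * g x)\<^sup>2" by (simp add: abs_le_square_iff)
      then show "norm ((f x - s i x)\<^sup>2) \<le> 4 * (g x)\<^sup>2" by (simp add: power_mult_distrib)
    qed
  qed auto
  then have lim0: "(\<lambda>i. LINT x|lborel. (f x - s i x)\<^sup>2) \<longlonglongrightarrow> 0" by simp
  show ?thesis
  proof (rule L2_approximable_closed[OF f2])
    fix e :: real assume "e > 0"
    then obtain i where "(LINT x|lborel. (f x - s i x)\<^sup>2) < e"
      using order_tendstoD(2)[OF lim0] by (auto simp: eventually_sequentially)
    with s show "\<exists>g. L2_approximable g \<and> (LINT x|lborel. (f x - g x)\<^sup>2) < e" by blast
  qed
qed

lemma test_L2_approximable: "test_function \<phi> \<Longrightarrow> L2_approximable \<phi>"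
  by (auto simp: L2_approximable_def test_function_L2 intro!: exI[of _ \<phi>])

lemma L2_approximable_cmult:
  assumes "L2_approximable f"
  shows "L2_approximable (\<lambda>x. c * f x)"
proof (cases "c = 0")
  case False
  show ?thesis
    unfolding L2_approximable_def
  proof (intro conjI allI impI)
    show "L2 (\<lambda>x. c * f x)" using assms by (auto simp: L2_approximable_def L2_cmult)
    fix e :: real assume "e > 0"
    with False have "e / c\<^sup>2 > 0" by simp
    then obtain \<phi> where \<phi>: "test_function \<phi>" "(LINT x|lborel. (f x - \<phi> x)\<^sup>2) < e / c\<^sup>2"
      using assms unfolding L2_approximable_def by blast
    have "(LINT x|lborel. (c * f x - c * \<phi> x)\<^sup>2) = c\<^sup>2 * (LINT x|lborel. (f x - \<phi> x)\<^sup>2)"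
      by (simp add: right_diff_distrib[symmetric] power_mult_distrib)
    also have "\<dots> < e" using \<phi> False by (simp add: field_simps)
    finally show "\<exists>\<phi>. test_function \<phi> \<and> (LINT x|lborel. (c * f x - \<phi> x)\<^sup>2) < e"
      using \<phi>(1) by (intro exI[of _ "\<lambda>x. c * \<phi> x"]) (auto intro: smooth_intros)
  qed
qed (simp add: test_L2_approximable test_function_0)

lemma L2_approximable_add:
  assumes "L2_approximable f" "L2_approximable g"
  shows "L2_approximable (\<lambda>x. f x + g x)"
  unfolding L2_approximable_def
proof (intro conjI allI impI)
  have L: "L2 f" "L2 g" using assms by (auto simp: L2_approximable_def)
  show "L2 (\<lambda>x. f x + g x)" using L by (rule L2_add)
  fix e :: real assume "e > 0"
  then have e: "e / 4 > 0" by simp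
  obtain \<phi> where \<phi>: "test_function \<phi>" "(LINT x|lborel. (f x - \<phi> x)\<^sup>2) < e/4"
    using assms(1) e unfolding L2_approximable_def by blast
  obtain \<theta> where \<theta>: "test_function \<theta>" "(LINT x|lborel. (g x - \<theta> x)\<^sup>2) < e/4"
    using assms(2) e unfolding L2_approximable_def by blast
  have "(LINT x|lborel. ((f x + g x) - (\<phi> x + \<theta> x))\<^sup>2)
    \<le> 2 * (LINT x|lborel. ((f x + g x) - (\<phi> x + g x))\<^sup>2) + 2 * (LINT x|lborel. ((\<phi> x + g x) - (\<phi> x + \<theta> x))\<^sup>2)"
    by (intro integral_square_triangle L2_add L test_function_L2 \<phi> \<theta>)
  then have "(LINT x|lborel. ((f x + g x) - (\<phi> x + \<theta> x))\<^sup>2) < e" using \<phi>(2) \<theta>(2) by simp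
  then show "\<exists>\<phi>. test_function \<phi> \<and> (LINT x|lborel. (f x + g x - \<phi> x)\<^sup>2) < e"
    using \<phi>(1) \<theta>(1) by (intro exI[of _ "\<lambda>x. \<phi> x + \<theta> x"]) (auto intro: smooth_intros)
qed

lemma L2_approximable_diff:
  "L2_approximable f \<Longrightarrow> L2_approximable g \<Longrightarrow> L2_approximable (\<lambda>x. f x - g x)"
  using L2_approximable_add[of f "\<lambda>x. (-1) * g x"] L2_approximable_cmult[of g "-1"] by simp

lemma L2_indicator:
  assumes "A \<in> sets borel" "emeasure lborel A < \<infinity>"
  shows "L2 (indicator A :: 'a::euclidean_space \<Rightarrow> real)"
proof -
  have "(indicator A x :: real)\<^sup>2 = indicator A x" for x :: 'a by (simp add: indicator_def)
  then show ?thesis using assms by (auto simp: L2_real_iff)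
qed

text \<open>The product \<open>p\<close> of bumps is smooth and positive exactly on the box, so 1 -
  exp (- n p) is a test function that vanishes off the box and tends to 1 on it.\<close>

lemma L2_approximable_box: "L2_approximable (indicator (box a b :: 'a::euclidean_space set))"
proof -
  define p :: "'a \<Rightarrow> real" where
    "p = (\<lambda>x. \<Prod>i\<in>Basis. bump (inner x i - inner a i) * bump (inner b i - inner x i))"
  have p: "smooth p" unfolding p_def by (intro smooth_intros)
  have p0: "p x \<ge> 0" for x unfolding p_def by (intro prod_nonneg) auto
  have ppos: "p x > 0" if "x \<in> box a b" for x
    unfolding p_def using that by (intro prod_pos) (auto simp: box_def)
  have p00: "p x = 0" if "x \<notin> box a b" for x
    unfolding p_def using that by (auto simp: box_def not_less intro!: prod_zero)
  have t: "test_function (\<lambda>x. 1 - exp ((- real n) * p x))" for n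
  proof -
    obtain R where R: "\<And>x. x \<in> box a b \<Longrightarrow> norm x \<le> R"
      using bounded_box[of a b] by (auto simp: bounded_iff)
    have "smooth (\<lambda>x. 1 - exp ((- real n) * p x))"
      by (intro smooth_diff smooth_const smooth_compose[OF smooth_exp] smooth_mult p)
    moreover have "norm x \<le> R" if "1 - exp ((- real n) * p x) \<noteq> 0" for x
      using that R[of x] p00[of x] by (cases "x \<in> box a b") auto
    ultimately show ?thesis unfolding test_function_iff by blast
  qed
  show ?thesis
  proof (rule L2_approximable_dominated[where s="\<lambda>n x. 1 - exp ((- real n) * p x)" and g="indicator (box a b)"])
    show "(\<lambda>n. 1 - exp ((- real n) * p x)) \<longlonglongrightarrow> indicator (box a b) x" for x
    proof (cases "x \<in> box a b")
      case True
      have "(\<lambda>n. exp (- p x) ^ n) \<longlonglongrightarrow> 0"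
        using ppos[OF True] by (intro LIMSEQ_power_zero) auto
      then have "(\<lambda>n. 1 - exp (- p x) ^ n) \<longlonglongrightarrow> 1 - 0" by (rule tendsto_diff[OF tendsto_const])
      moreover have "exp ((- real n) * p x) = exp (- p x) ^ n" for n
        using exp_of_nat_mult[of n "- p x"] by simp
      ultimately show ?thesis using True by (simp only: indicator_simps diff_0_right)
    qed (simp add: p00)
    show "\<bar>1 - exp ((- real n) * p x)\<bar> \<le> \<bar>indicator (box a b) x\<bar>" for n x
      using p0[of x] p00[of x] by (cases "x \<in> box a b") auto
    show "L2 (indicator (box a b) :: 'a \<Rightarrow> real)" by (rule L2_indicator) (auto simp: emeasure_lborel_box_eq)
    show "L2_approximable (\<lambda>x. 1 - exp ((- real n) * p x))" for n by (rule test_L2_approximable[OF t])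
  qed auto
qed

text \<open>Induction from boxes, which are stable under intersection. Cutting with a fixed box
  keeps all indicators in L2: a complement becomes a difference of approximable functions, and a
  disjoint union a dominated limit of finite sums.\<close>

lemma L2_approximable_indicator_box:
  fixes A :: "'a::euclidean_space set"
  assumes "A \<in> sets borel"
  shows "L2_approximable (indicator (A \<inter> box a b))"
proof -
  let ?E = "range (\<lambda>(a, b). box a b :: 'a set)"
  have "Int_stable ?E"
    by (auto simp: Int_stable_def box_Int_box)
  moreover have "?E \<subseteq> Pow UNIV" by simp
  moreover have "A \<in> sigma_sets UNIV ?E" using assms by (simp add: borel_eq_box)
  ultimately show ?thesis
  proof (induction rule: sigma_sets_induct_disjoint)
    case (basic A)
    then show ?case by (auto simp: box_Int_box L2_approximable_box)
  next
    case empty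
    then show ?case using test_L2_approximable[OF test_function_0] by simp
  next
    case (compl A)
    have "indicator ((UNIV - A) \<inter> box a b) = (\<lambda>x. indicator (box a b) x - indicator (A \<inter> box a b) x :: real)"
      by (auto simp: indicator_def fun_eq_iff)
    then show ?case using compl L2_approximable_box by (auto intro: L2_approximable_diff)
  next
    case (union F)
    then have F: "F i \<in> sets borel" for i by (auto simp: borel_eq_box)
    show ?case
    proof (rule L2_approximable_dominated[where s="\<lambda>n. indicator (\<Union>i<n. F i \<inter> box a b)" and g="indicator (box a b)"])
      have "disjoint_family_on (\<lambda>i. F i \<inter> box a b) {..<n}" for n
        using union(1) by (auto simp: disjoint_family_on_def)
      then have *: "indicator (\<Union>i<n. F i \<inter> box a b) = (\<lambda>x. \<Sum>i<n. indicator (F i \<inter> box a b) x :: real)" for n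
        by (intro ext indicator_UN_disjoint) auto
      have "L2_approximable (\<lambda>x. \<Sum>i<n. indicator (F i \<inter> box a b) x)" for n
        by (induction n) (auto simp: union intro: L2_approximable_add test_L2_approximable[OF test_function_0])
      then show "L2_approximable (indicator (\<Union>i<n. F i \<inter> box a b))" for n unfolding * .
      show "(\<lambda>n. indicator (\<Union>i<n. F i \<inter> box a b) x) \<longlonglongrightarrow> (indicator (\<Union> (range F) \<inter> box a b) x :: real)" for x
        using LIMSEQ_indicator_UN[of "\<lambda>i. F i \<inter> box a b" x] by simp
      show "\<bar>indicator (\<Union>i<n. F i \<inter> box a b) x :: real\<bar> \<le> \<bar>indicator (box a b) x\<bar>" for n x
        by (auto simp: indicator_def)
      show "L2 (indicator (box a b) :: 'a \<Rightarrow> real)" by (rule L2_indicator) (auto simp: emeasure_lborel_box_eq)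
      show "indicator (\<Union> (range F) \<inter> box a b) \<in> borel_measurable borel"
        using F by (intro borel_measurable_indicator) auto
    qed
  qed
qed

lemma L2_approximable_indicator:
  fixes A :: "'a::euclidean_space set"
  assumes A: "A \<in> sets borel" and L: "L2 (indicator A :: 'a \<Rightarrow> real)"
  shows "L2_approximable (indicator A)"
proof (rule L2_approximable_dominated[where g="indicator A"])
  let ?B = "\<lambda>n. box (- (real n *\<^sub>R One)) (real n *\<^sub>R One) :: 'a set"
  show "L2_approximable (indicator (A \<inter> ?B n))" for n
    by (rule L2_approximable_indicator_box[OF A])
  show "(\<lambda>n. indicator (A \<inter> ?B n) x) \<longlonglongrightarrow> (indicator A x :: real)" for x
  proof -
    have "incseq (\<lambda>n. A \<inter> ?B n)"
    proof (rule incseq_SucI)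
      show "A \<inter> ?B n \<subseteq> A \<inter> ?B (Suc n)" for n
        by (intro Int_mono order_refl subset_box_imp(4)) simp
    qed
    from LIMSEQ_indicator_incseq[OF this, of x, where 'a=real]
    show ?thesis unfolding Int_UN_distrib[symmetric] UN_box_eq_UNIV by simp
  qed
  show "\<bar>indicator (A \<inter> ?B n) x :: real\<bar> \<le> \<bar>indicator A x\<bar>" for n x
    by (auto simp: indicator_def)
qed (use assms in auto)

theorem test_functions_dense_L2:
  assumes "L2 f"
  shows "L2_approximable f"
proof -
  \<comment> \<open>An implication, since square integrability is assumed for the final function
    only; the pieces met in the induction inherit it because they are nonnegative and dominated by
    the whole.\<close>
  have nonneg: "L2 f \<longrightarrow> L2_approximable f"
    if "f \<in> borel_measurable lborel" "\<And>x. 0 \<le> f x" for f :: "'a \<Rightarrow> real"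
    using that
  proof (induction rule: borel_measurable_induct_real)
    case (set A)
    then show ?case by (auto intro: L2_approximable_indicator)
  next
    case (mult u c)
    show ?case
    proof (cases "c = 0")
      case False
      then show ?thesis
        using mult(4) L2_cmult[of "\<lambda>x. c * u x" "1/c"] by (auto intro: L2_approximable_cmult)
    qed (simp add: test_L2_approximable test_function_0)
  next
    case (add u v)
    have "L2 u" "L2 v" if "L2 (\<lambda>x. v x + u x)"
      using add.hyps by (auto intro!: L2_dominated[OF that])
    with add.IH show ?case by (auto intro: L2_approximable_add)
  next
    case (seq U)
    show ?case
    proof
      assume f: "L2 f"
      have le: "\<bar>U i x\<bar> \<le> \<bar>f x\<bar>" for i x
      proof -
        have "incseq (\<lambda>i. U i x)" using seq.hyps(3) by (simp add: incseq_def le_fun_def)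
        then have "U i x \<le> f x" using seq.hyps(4)[of x] by (intro incseq_le) auto
        then show ?thesis using seq.hyps(2)[of i x] by linarith
      qed
      show "L2_approximable f"
      proof (rule L2_approximable_dominated[where s=U and g=f])
        show "L2_approximable (U i)" for i
        proof -
          have "U i \<in> borel_measurable borel" using seq.hyps(1)[of i] by simp
          then have "L2 (U i)" by (rule L2_dominated[OF f _ le])
          with seq.IH[of i] show ?thesis by blast
        qed
        show "f \<in> borel_measurable borel" using f by (rule L2_measurable)
        show "(\<lambda>i. U i x) \<longlonglongrightarrow> f x" for x using seq.hyps(4)[of x] by simp
      qed (fact f le)+
    qed
  qed
  have [measurable]: "f \<in> borel_measurable borel" using assms by (rule L2_measurable)
  have "L2 (\<lambda>x. max 0 (f x))" "L2 (\<lambda>x. max 0 (- f x))"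
    by (auto intro!: L2_dominated[OF assms])
  then have "L2_approximable (\<lambda>x. max 0 (f x))" "L2_approximable (\<lambda>x. max 0 (- f x))"
    using nonneg[of "\<lambda>x. max 0 (f x)"] nonneg[of "\<lambda>x. max 0 (- f x)"] by auto
  then have "L2_approximable (\<lambda>x. max 0 (f x) - max 0 (- f x))" by (rule L2_approximable_diff)
  moreover have "(\<lambda>x. max 0 (f x) - max 0 (- f x)) = f" by (auto simp: max_def)
  ultimately show ?thesis by simp
qed

lemma Cauchy_Schwarz_L2:
  fixes f g :: "'a::euclidean_space \<Rightarrow> real"
  assumes "L2 f" "L2 g"
  shows "(LINT x|lborel. f x * g x)\<^sup>2 \<le> (LINT x|lborel. (f x)\<^sup>2) * (LINT x|lborel. (g x)\<^sup>2)"
proof -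
  let ?A = "LINT x|lborel. (f x)\<^sup>2" and ?B = "LINT x|lborel. f x * g x" and ?C = "LINT x|lborel. (g x)\<^sup>2"
  have i: "integrable lborel (\<lambda>x. (f x)\<^sup>2)" "integrable lborel (\<lambda>x. (g x)\<^sup>2)" "integrable lborel (\<lambda>x. f x * g x)"
    using assms L2_mult_integrable by (auto simp: L2_real_iff)
  have q: "0 \<le> s\<^sup>2 * ?A + 2 * s * t * ?B + t\<^sup>2 * ?C" for s t
  proof -
    have "0 \<le> (LINT x|lborel. (s * f x + t * g x)\<^sup>2)" by simp
    also have "(\<lambda>x. (s * f x + t * g x)\<^sup>2) = (\<lambda>x. s\<^sup>2 * (f x)\<^sup>2 + 2 * s * t * (f x * g x) + t\<^sup>2 * (g x)\<^sup>2)"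
      by (auto simp: power2_eq_square algebra_simps)
    finally show ?thesis using i by simp
  qed
  have AC: "0 \<le> ?A" "0 \<le> ?C" by simp_all
  show ?thesis
  proof (cases "?A = 0")
    case True
    have "?B = 0"
    proof (rule ccontr)
      assume B: "?B \<noteq> 0"
      \<comment> \<open>With \<open>?A = 0\<close> the quadratic form is affine in s once t = 1;
        this s makes its value -1.\<close>
      have "0 \<le> 2 * (- (?C + 1) / (2 * ?B)) * 1 * ?B + 1\<^sup>2 * ?C"
        using q[of "- (?C + 1) / (2 * ?B)" 1] True by simp
      also have "2 * (- (?C + 1) / (2 * ?B)) * 1 * ?B = - (?C + 1)" using B by simp
      finally show False by simp
    qed
    then show ?thesis by simp
  next
    case False
    with AC have A: "?A > 0" by linarith
    have "0 \<le> ?B\<^sup>2 * ?A + 2 * ?B * (- ?A) * ?B + (- ?A)\<^sup>2 * ?C" by (rule q)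
    then have "0 \<le> ?A * (?A * ?C - ?B\<^sup>2)" by (simp add: power2_eq_square algebra_simps)
    then show ?thesis using A by (simp add: zero_le_mult_iff)
  qed
qed

text \<open>If d had positive norm, a test function \<phi> closer to d than that norm would give
  |d|^2 = (d, d - \<phi>) \<le> |d| |d - \<phi>| < |d|^2.\<close>

lemma L2_orthogonal_test_functions:
  fixes d :: "'a::euclidean_space \<Rightarrow> real"
  assumes d: "L2 d" and orth: "\<And>\<phi>. test_function \<phi> \<Longrightarrow> (LINT x|lborel. d x * \<phi> x) = 0"
  shows "AE x in lborel. d x = 0"
proof -
  let ?D = "LINT x|lborel. (d x)\<^sup>2"
  have D0: "?D \<ge> 0" by simp
  have "?D = 0"
  proof (rule ccontr)
    assume "?D \<noteq> 0"
    with D0 have D: "?D > 0" by linarith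
    then obtain \<phi> where \<phi>: "test_function \<phi>" "(LINT x|lborel. (d x - \<phi> x)\<^sup>2) < ?D"
      using test_functions_dense_L2[OF d] unfolding L2_approximable_def by blast
    have "?D = (LINT x|lborel. d x * d x) - (LINT x|lborel. d x * \<phi> x)"
      using orth[OF \<phi>(1)] by (simp add: power2_eq_square)
    also have "\<dots> = (LINT x|lborel. d x * (d x - \<phi> x))"
      using L2_mult_integrable[OF d d] L2_mult_integrable[OF d test_function_L2[OF \<phi>(1)]]
      by (simp add: right_diff_distrib)
    finally have "?D\<^sup>2 \<le> ?D * (LINT x|lborel. (d x - \<phi> x)\<^sup>2)"
      using Cauchy_Schwarz_L2[OF d L2_diff[OF d test_function_L2[OF \<phi>(1)]]] by simp
    also have "\<dots> < ?D * ?D" using \<phi> D by simp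
    finally show False by (simp add: power2_eq_square)
  qed
  then have "AE x in lborel. (d x)\<^sup>2 = 0"
    using d by (subst (asm) integral_nonneg_eq_0_iff_AE) (auto simp: L2_real_iff)
  then show ?thesis by simp
qed

section \<open>Weak gradients and mollification\<close>

lemma L2_component:
  assumes "L2 g" "b \<in> Basis"
  shows "L2 (\<lambda>x. inner (g x) b)"
  unfolding L2_real_iff
proof
  have [measurable]: "g \<in> borel_measurable borel" using assms by (simp add: L2_def)
  show "(\<lambda>x. inner (g x) b) \<in> borel_measurable borel" by measurable
  show "integrable lborel (\<lambda>x. (inner (g x) b)\<^sup>2)"
  proof (rule Bochner_Integration.integrable_bound)
    show "integrable lborel (\<lambda>x. (norm (g x))\<^sup>2)" using assms by (simp add: L2_def)
    have "(inner (g x) b)\<^sup>2 \<le> (norm (g x))\<^sup>2" for x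
      using Basis_le_norm[OF assms(2), of "g x"] by (simp add: abs_le_square_iff[symmetric])
    then show "AE x in lborel. norm ((inner (g x) b)\<^sup>2) \<le> norm ((norm (g x))\<^sup>2)" by simp
  qed measurable
qed

lemma norm_square_sum_Basis: "(norm x)\<^sup>2 = (\<Sum>b\<in>Basis. (inner x b)\<^sup>2)"
  unfolding power2_norm_eq_inner by (subst euclidean_inner) (simp add: power2_eq_square)

lemma L2_componentI:
  assumes "\<And>b. b \<in> Basis \<Longrightarrow> L2 (\<lambda>x. inner (g x) b)"
  shows "L2 g"
  unfolding L2_def norm_square_sum_Basis
proof
  show "g \<in> borel_measurable lborel"
    by (subst borel_measurable_euclidean_space) (use assms in \<open>auto simp: L2_real_iff\<close>)
  show "integrable lborel (\<lambda>x. \<Sum>b\<in>Basis. (inner (g x) b)\<^sup>2)"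
    using assms by (auto simp: L2_real_iff)
qed

lemma integral_norm_square_components:
  assumes "L2 g"
  shows "(LINT x|lborel. (norm (g x))\<^sup>2) = (\<Sum>b\<in>Basis. LINT x|lborel. (inner (g x) b)\<^sup>2)"
  unfolding norm_square_sum_Basis
  by (rule Bochner_Integration.integral_sum) (use L2_component[OF assms] in \<open>auto simp: L2_real_iff\<close>)

lemma weak_grad_L2: "H1 \<psi> \<Longrightarrow> L2 (weak_grad \<psi>)"
  and weak_grad_has_weak_grad: "H1 \<psi> \<Longrightarrow> has_weak_grad \<psi> (weak_grad \<psi>)"
  unfolding H1_def weak_grad_def by (metis (mono_tags, lifting) someI_ex)+

lemma weak_grad_unique:
  assumes "L2 g" "has_weak_grad \<psi> g" "L2 g'" "has_weak_grad \<psi> g'"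
  shows "AE x in lborel. g x = g' x"
proof -
  have "AE x in lborel. inner (g x) b - inner (g' x) b = 0" if b: "b \<in> Basis" for b
  proof (rule L2_orthogonal_test_functions)
    show "L2 (\<lambda>x. inner (g x) b - inner (g' x) b)" by (intro L2_diff L2_component assms b)
    fix \<phi> :: "'a \<Rightarrow> real" assume \<phi>: "test_function \<phi>"
    have "(LINT x|lborel. inner (g x) b * \<phi> x) = (LINT x|lborel. inner (g' x) b * \<phi> x)"
      using assms(2,4) \<phi> b by (force simp: has_weak_grad_def)
    then show "(LINT x|lborel. (inner (g x) b - inner (g' x) b) * \<phi> x) = 0"
      using L2_mult_integrable[OF L2_component[OF assms(1) b] test_function_L2[OF \<phi>]]
        L2_mult_integrable[OF L2_component[OF assms(3) b] test_function_L2[OF \<phi>]]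
      by (simp add: left_diff_distrib)
  qed
  then have "AE x in lborel. \<forall>b\<in>Basis. inner (g x) b - inner (g' x) b = 0"
    by (intro AE_finite_allI) auto
  then show ?thesis by eventually_elim (auto intro: euclidean_eqI)
qed

section \<open>Weak gradients of products and the weak eigenvalue equation\<close>

lemma integral_by_parts:
  assumes "smooth f" "test_function \<phi>" "b \<in> Basis"
  shows "(LINT x|lborel. f x * partial_deriv b \<phi> x) = - (LINT x|lborel. partial_deriv b f x * \<phi> x)"
proof -
  have "(LINT x|lborel. partial_deriv b (\<lambda>x. f x * \<phi> x) x) = 0"
    using assms by (intro integral_partial_deriv_eq_0 smooth_intros)
  moreover have "partial_deriv b (\<lambda>x. f x * \<phi> x) x = f x * partial_deriv b \<phi> x + partial_deriv b f x * \<phi> x" for x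
    using assms by (intro partial_deriv_mult smooth_differentiable) (auto dest: test_functionD)
  moreover have "integrable lborel (\<lambda>x. f x * partial_deriv b \<phi> x)"
    "integrable lborel (\<lambda>x. partial_deriv b f x * \<phi> x)"
    using assms by (auto intro!: test_integrable smooth_intros)
  ultimately show ?thesis by simp
qed

lemma test_has_weak_grad: "test_function \<phi> \<Longrightarrow> has_weak_grad \<phi> (grad \<phi>)"
  unfolding has_weak_grad_def
  by (auto simp: integral_by_parts test_functionD grad_inner_Basis)

lemma test_grad_L2: "test_function \<phi> \<Longrightarrow> L2 (grad \<phi>)"
  by (rule L2_componentI) (auto simp: grad_inner_Basis intro!: test_function_L2 smooth_intros)

lemma test_H1: "test_function \<phi> \<Longrightarrow> H1 \<phi>"
  unfolding H1_def using test_function_L2 test_has_weak_grad test_grad_L2 by blast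

text \<open>Move \<eta> onto the test function: \<eta> \<phi> is again a test function, and the
  Leibniz rule for it produces the correction \<psi> \<nabla>\<eta>.\<close>

lemma test_mult_has_weak_grad:
  assumes \<psi>: "L2 \<psi>" and g: "L2 g" "has_weak_grad \<psi> g" and \<eta>: "test_function \<eta>"
  shows "has_weak_grad (\<lambda>x. \<eta> x * \<psi> x) (\<lambda>x. \<eta> x *\<^sub>R g x + \<psi> x *\<^sub>R grad \<eta> x)"
  unfolding has_weak_grad_def
proof (intro allI impI ballI)
  fix \<phi> :: "'a \<Rightarrow> real" and b :: 'a
  assume \<phi>: "test_function \<phi>" and b: "b \<in> Basis"
  have p: "partial_deriv b (\<lambda>x. \<eta> x * \<phi> x) x = \<eta> x * partial_deriv b \<phi> x + partial_deriv b \<eta> x * \<phi> x" for x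
    using \<eta> \<phi> by (intro partial_deriv_mult smooth_differentiable test_functionD)
  have t: "test_function (\<lambda>x. \<eta> x * \<phi> x)" "test_function (\<lambda>x. \<eta> x * partial_deriv b \<phi> x)"
    "test_function (\<lambda>x. partial_deriv b \<eta> x * \<phi> x)"
    using \<eta> \<phi> b by (auto intro!: smooth_intros dest: test_functionD)
  have i: "integrable lborel (\<lambda>x. \<psi> x * (\<eta> x * partial_deriv b \<phi> x))"
    "integrable lborel (\<lambda>x. \<psi> x * (partial_deriv b \<eta> x * \<phi> x))"
    "integrable lborel (\<lambda>x. inner (g x) b * (\<eta> x * \<phi> x))"
    by (intro L2_mult_integrable \<psi> L2_component g b test_function_L2 t)+
  have "(LINT x|lborel. \<psi> x * (\<eta> x * partial_deriv b \<phi> x)) + (LINT x|lborel. \<psi> x * (partial_deriv b \<eta> x * \<phi> x))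
      = (LINT x|lborel. \<psi> x * partial_deriv b (\<lambda>x. \<eta> x * \<phi> x) x)"
    using i by (simp add: p distrib_left)
  also have "\<dots> = - (LINT x|lborel. inner (g x) b * (\<eta> x * \<phi> x))"
    using g(2) t(1) b unfolding has_weak_grad_def by blast
  finally have "(LINT x|lborel. \<psi> x * (\<eta> x * partial_deriv b \<phi> x))
      = - (LINT x|lborel. inner (g x) b * (\<eta> x * \<phi> x) + \<psi> x * (partial_deriv b \<eta> x * \<phi> x))"
    using i by simp
  moreover have "inner (\<eta> x *\<^sub>R g x + \<psi> x *\<^sub>R grad \<eta> x) b * \<phi> x
      = inner (g x) b * (\<eta> x * \<phi> x) + \<psi> x * (partial_deriv b \<eta> x * \<phi> x)" for x
    using b by (simp add: inner_add_left grad_inner_Basis algebra_simps)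
  ultimately show "(LINT x|lborel. \<eta> x * \<psi> x * partial_deriv b \<phi> x)
      = - (LINT x|lborel. inner (\<eta> x *\<^sub>R g x + \<psi> x *\<^sub>R grad \<eta> x) b * \<phi> x)"
    by (simp add: mult_ac)
qed

lemma test_mult_grad_L2:
  assumes "L2 \<psi>" "L2 g" "test_function \<eta>"
  shows "L2 (\<lambda>x. \<eta> x *\<^sub>R g x + \<psi> x *\<^sub>R grad \<eta> x)"
proof (rule L2_componentI)
  fix b :: 'a assume b: "b \<in> Basis"
  have "L2 (\<lambda>x. \<eta> x * inner (g x) b + partial_deriv b \<eta> x * \<psi> x)"
    by (intro L2_add L2_test_mult L2_component assms b test_function_partial_deriv)
  then show "L2 (\<lambda>x. inner (\<eta> x *\<^sub>R g x + \<psi> x *\<^sub>R grad \<eta> x) b)"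
    using b by (simp add: inner_add_left grad_inner_Basis mult.commute)
qed

lemma test_form_domain:
  assumes "smooth v" "test_function \<phi>"
  shows "\<phi> \<in> form_domain v"
  unfolding form_domain_def power2_eq_square
  using assms by (auto intro!: test_H1 test_integrable smooth_intros dest: test_functionD)

text \<open>Compact support of \<eta> makes v \<eta> a test function, so v (\<eta> \<psi>)^2 is a
  product of two L2 functions however fast v grows.\<close>

lemma test_mult_form_domain:
  assumes v: "smooth v" and \<psi>: "H1 \<psi>" and \<eta>: "test_function \<eta>"
  shows "(\<lambda>x. \<eta> x * \<psi> x) \<in> form_domain v"
proof -
  have L: "L2 \<psi>" using \<psi> by (simp add: H1_def)
  have "H1 (\<lambda>x. \<eta> x * \<psi> x)"
    unfolding H1_def
    using L2_test_mult[OF L \<eta>] test_mult_has_weak_grad[OF L weak_grad_L2[OF \<psi>] weak_grad_has_weak_grad[OF \<psi>] \<eta>]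
      test_mult_grad_L2[OF L weak_grad_L2[OF \<psi>] \<eta>] by blast
  moreover have "integrable lborel (\<lambda>x. v x * (\<eta> x * \<psi> x)\<^sup>2)"
  proof -
    have "test_function (\<lambda>x. v x * \<eta> x)" using v \<eta> by (intro smooth_intros)
    from L2_mult_integrable[OF L2_test_mult[OF L this] L2_test_mult[OF L \<eta>]]
    show ?thesis by (simp add: power2_eq_square mult_ac)
  qed
  ultimately show ?thesis by (simp add: form_domain_def)
qed

text \<open>The operator is defined through \<open>weak_grad \<phi>\<close>, a representative picked
  by choice. Uniqueness up to null sets permits an explicitly computed gradient \<open>G\<close>
  instead, for \<phi> a test function or a product \<eta> \<psi>.\<close>

lemma eigenfunction_weak_equation:
  assumes e: "eigenfunction h v l \<psi>" and \<phi>: "\<phi> \<in> form_domain v"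
    and G: "L2 G" "has_weak_grad \<phi> G"
  shows "h\<^sup>2 * (LINT x|lborel. inner (weak_grad \<psi> x) (G x)) + (LINT x|lborel. v x * \<psi> x * \<phi> x)
      = l * (LINT x|lborel. \<psi> x * \<phi> x)"
proof -
  have H: "H1 \<psi>" "H1 \<phi>"
    using e \<phi> by (auto simp: eigenfunction_def schroedinger_op_def form_domain_def)
  have "schroedinger_form h v \<psi> \<phi> = (LINT x|lborel. l * \<psi> x * \<phi> x)"
    using e \<phi> by (auto simp: eigenfunction_def schroedinger_op_def)
  moreover have "(LINT x|lborel. inner (weak_grad \<psi> x) (weak_grad \<phi> x)) = (LINT x|lborel. inner (weak_grad \<psi> x) (G x))"
  proof (rule integral_cong_AE)
    have [measurable]: "weak_grad \<psi> \<in> borel_measurable borel" "weak_grad \<phi> \<in> borel_measurable borel"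
      "G \<in> borel_measurable borel"
      using weak_grad_L2[OF H(1)] weak_grad_L2[OF H(2)] G by (auto simp: L2_def)
    show "(\<lambda>x. inner (weak_grad \<psi> x) (weak_grad \<phi> x)) \<in> borel_measurable lborel" by measurable
    show "(\<lambda>x. inner (weak_grad \<psi> x) (G x)) \<in> borel_measurable lborel" by measurable
    show "AE x in lborel. inner (weak_grad \<psi> x) (weak_grad \<phi> x) = inner (weak_grad \<psi> x) (G x)"
      using weak_grad_unique[OF weak_grad_L2[OF H(2)] weak_grad_has_weak_grad[OF H(2)] G]
      by eventually_elim simp
  qed
  ultimately show ?thesis by (simp add: schroedinger_form_def mult.assoc)
qed

text \<open>The width e is a parameter of the predicate rather than the scale of one fixed kernel:
  the estimates below use sign, mass and support radius of \<rho>, never the size of its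
  derivatives.\<close>

definition mollifier :: "real \<Rightarrow> ('a::euclidean_space \<Rightarrow> real) \<Rightarrow> bool" where
  "mollifier e \<rho> \<longleftrightarrow> test_function \<rho> \<and> (\<forall>x. 0 \<le> \<rho> x) \<and> (LINT x|lborel. \<rho> x) = 1
     \<and> (\<forall>x. \<rho> x \<noteq> 0 \<longrightarrow> norm x < e)"

lemma mollifier_exists:
  assumes "e > 0"
  shows "\<exists>\<rho>. mollifier e (\<rho> :: 'a::euclidean_space \<Rightarrow> real)"
proof -
  define \<kappa> :: "'a \<Rightarrow> real" where "\<kappa> = (\<lambda>x. bump (e\<^sup>2 - inner x x))"
  have lt: "norm x < e \<longleftrightarrow> e\<^sup>2 - inner x x > 0" for x :: 'a
    using assms unfolding norm_lt_square by auto
  have supp: "\<kappa> x \<noteq> 0 \<longleftrightarrow> norm x < e" for x unfolding \<kappa>_def lt by (simp add: not_le)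
  have \<kappa>: "test_function \<kappa>"
    unfolding test_function_iff
  proof
    show "smooth \<kappa>" unfolding \<kappa>_def by (intro smooth_intros)
    show "\<exists>R. \<forall>x. \<kappa> x \<noteq> 0 \<longrightarrow> norm x \<le> R" using supp by (auto intro!: exI[of _ e])
  qed
  have nn: "\<kappa> x \<ge> 0" for x by (simp add: \<kappa>_def)
  have "(LINT x|lborel. \<kappa> x) \<noteq> 0"
  proof
    assume "(LINT x|lborel. \<kappa> x) = 0"
    then have "AE x in lborel. \<kappa> x = 0"
      using test_integrable[OF \<kappa>] nn by (subst (asm) integral_nonneg_eq_0_iff_AE) auto
    then have "AE x in lborel. x \<notin> ball (0::'a) e" by eventually_elim (use supp in auto)
    then have "ball (0::'a) e \<in> null_sets lborel" by (simp add: AE_iff_null_sets)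
    then have "negligible (ball (0::'a) e)" by (simp add: negligible_iff_null_sets null_sets_completionI)
    then show False using assms open_not_negligible[of "ball (0::'a) e"] by auto
  qed
  moreover have "(LINT x|lborel. \<kappa> x) \<ge> 0" using nn by simp
  ultimately have I: "(LINT x|lborel. \<kappa> x) > 0" by linarith
  have "mollifier e (\<lambda>x. (1 / (LINT x|lborel. \<kappa> x)) * \<kappa> x)"
    unfolding mollifier_def using I nn supp test_function_mult_right[OF \<kappa> smooth_const, of "1 / (LINT x|lborel. \<kappa> x)"] by auto
  then show ?thesis by blast
qed

lemma integrable_imp_locally_integrable: "integrable lborel f \<Longrightarrow> locally_integrable f"
  unfolding locally_integrable_def set_integrable_def
  by (auto intro!: integrable_mult_indicator[where 'b=real, simplified])

section \<open>Averaging with a mollifier\<close>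

context
  fixes e :: real and \<rho> :: "'a::euclidean_space \<Rightarrow> real"
  assumes \<rho>: "mollifier e \<rho>"
begin

lemma mollifier_test: "test_function \<rho>"
  and mollifier_nonneg: "0 \<le> \<rho> x"
  and mollifier_support: "\<rho> x \<noteq> 0 \<Longrightarrow> norm x < e"
  using \<rho> by (auto simp: mollifier_def)

lemma mollifier_integral: "(LINT y|lborel. \<rho> (x - y)) = 1"
  using \<rho> integral_reflect[OF test_function_borel_measurable[OF mollifier_test]]
  by (simp add: mollifier_def)

lemma mollifier_integral_translate: "(LINT x|lborel. \<rho> (x - y)) = 1"
proof -
  have [measurable]: "\<rho> \<in> borel_measurable borel"
    by (rule test_function_borel_measurable[OF mollifier_test])
  have "(LINT x|lborel. \<rho> (0 - (y - x))) = (LINT z|lborel. \<rho> (0 - z))"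
    by (rule integral_reflect[of "\<lambda>z. \<rho> (0 - z)"]) measurable
  then show ?thesis using mollifier_integral[of 0] by simp
qed

text \<open>Only points within distance e of x contribute. A Lipschitz increment is therefore at
  most a constant times e, both in \<open>mollifier_test_approx\<close> and in the commutator with
  v.\<close>

lemma conv_mollifier_abs_le:
  assumes k: "locally_integrable k" and f: "locally_integrable f"
    and le: "\<And>y. norm (x - y) < e \<Longrightarrow> \<bar>k y\<bar> \<le> M * f y"
  shows "\<bar>conv \<rho> k x\<bar> \<le> M * conv \<rho> f x"
proof -
  have "\<bar>conv \<rho> k x\<bar> \<le> (LINT y|lborel. \<bar>\<rho> (x - y) * k y\<bar>)"
    unfolding conv_def by (rule integral_abs_bound)
  also have "\<dots> \<le> (LINT y|lborel. M * (\<rho> (x - y) * f y))"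
  proof (rule integral_mono)
    show "integrable lborel (\<lambda>y. \<bar>\<rho> (x - y) * k y\<bar>)"
      by (intro integrable_abs conv_integrable k mollifier_test)
    show "integrable lborel (\<lambda>y. M * (\<rho> (x - y) * f y))"
      by (intro integrable_mult_right conv_integrable f mollifier_test)
    show "\<bar>\<rho> (x - y) * k y\<bar> \<le> M * (\<rho> (x - y) * f y)" for y
    proof (cases "\<rho> (x - y) = 0")
      case False
      then have "\<rho> (x - y) * \<bar>k y\<bar> \<le> \<rho> (x - y) * (M * f y)"
        by (intro mult_left_mono le mollifier_support mollifier_nonneg)
      then show ?thesis by (simp add: abs_mult mollifier_nonneg mult_ac)
    qed simp
  qed
  finally show ?thesis by (simp add: conv_def)
qed

text \<open>Jensen's inequality for the probability density y \<mapsto> \<rho> (x - y), proved as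
  nonnegativity of the variance of f around its mean \<open>m\<close>.\<close>

lemma conv_mollifier_square_le:
  assumes f: "L2 f"
  shows "(conv \<rho> f x)\<^sup>2 \<le> conv \<rho> (\<lambda>y. (f y)\<^sup>2) x"
proof -
  define m where "m = conv \<rho> f x"
  have i: "integrable lborel (\<lambda>y. \<rho> (x - y) * (f y)\<^sup>2)" "integrable lborel (\<lambda>y. \<rho> (x - y) * f y)"
    "integrable lborel (\<lambda>y. \<rho> (x - y))"
    using f integrable_imp_locally_integrable[of "\<lambda>y. (f y)\<^sup>2"]
    by (auto intro!: conv_integrable mollifier_test L2_locally_integrable simp: L2_real_iff[of f])
       (intro test_integrable test_function_reflect mollifier_test)
  have "0 \<le> (LINT y|lborel. \<rho> (x - y) * (f y - m)\<^sup>2)" by (simp add: mollifier_nonneg)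
  also have "(\<lambda>y. \<rho> (x - y) * (f y - m)\<^sup>2)
      = (\<lambda>y. \<rho> (x - y) * (f y)\<^sup>2 - 2 * m * (\<rho> (x - y) * f y) + m\<^sup>2 * \<rho> (x - y))"
    by (auto simp: power2_eq_square algebra_simps)
  also have "(LINT y|lborel. \<rho> (x - y) * (f y)\<^sup>2 - 2 * m * (\<rho> (x - y) * f y) + m\<^sup>2 * \<rho> (x - y))
      = conv \<rho> (\<lambda>y. (f y)\<^sup>2) x - 2 * m * m + m\<^sup>2"
    using i mollifier_integral by (simp add: conv_def m_def)
  finally show ?thesis by (simp add: m_def power2_eq_square)
qed

lemma conv_mollifier_integrable:
  assumes f: "integrable lborel f"
  shows "integrable lborel (conv \<rho> f)" "(LINT x|lborel. conv \<rho> f x) = (LINT x|lborel. f x)"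
proof -
  note [measurable] = test_function_borel_measurable[OF mollifier_test] borel_measurable_integrable[OF f]
  have [measurable]: "f \<in> borel_measurable borel" using borel_measurable_integrable[OF f] by simp
  have \<rho>i: "integrable lborel (\<lambda>x. \<rho> (x - y))" for y
    using test_integrable[OF test_function_affine[OF mollifier_test, of 1 "-y"]] by simp
  have 1: "integrable (lborel \<Otimes>\<^sub>M lborel) (\<lambda>(y, x). \<rho> (x - y) * f y)"
  proof (rule lborel_pair.Fubini_integrable)
    show "(\<lambda>(y, x). \<rho> (x - y) * f y) \<in> borel_measurable (lborel \<Otimes>\<^sub>M lborel)" by measurable
    have "(LINT x|lborel. norm (\<rho> (x - y) * f y)) = norm (f y)" for y
      using \<rho>i mollifier_integral_translate by (simp add: abs_mult mollifier_nonneg)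
    then show "integrable lborel (\<lambda>y. LINT x|lborel. norm (case (y, x) of (y, x) \<Rightarrow> \<rho> (x - y) * f y))"
      using integrable_norm[OF f] by simp
    show "AE y in lborel. integrable lborel (\<lambda>x. case (y, x) of (y, x) \<Rightarrow> \<rho> (x - y) * f y)"
      using \<rho>i by simp
  qed
  show "integrable lborel (conv \<rho> f)"
    using lborel_pair.integrable_snd[OF 1] by (simp add: conv_def[abs_def])
  show "(LINT x|lborel. conv \<rho> f x) = (LINT x|lborel. f x)"
    using lborel_pair.Fubini_integral[OF 1] \<rho>i mollifier_integral_translate by (simp add: conv_def)
qed

text \<open>Integrate Jensen's inequality; averaging preserves the integral of the square.\<close>

lemma conv_mollifier_L2:
  assumes f: "L2 f"
  shows "L2 (conv \<rho> f)" "(LINT x|lborel. (conv \<rho> f x)\<^sup>2) \<le> (LINT x|lborel. (f x)\<^sup>2)"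
proof -
  have f2: "integrable lborel (\<lambda>y. (f y)\<^sup>2)" using f by (simp add: L2_real_iff)
  have [measurable]: "conv \<rho> f \<in> borel_measurable borel"
    by (intro smooth_borel_measurable smooth_conv L2_locally_integrable f mollifier_test)
  have i: "integrable lborel (\<lambda>x. (conv \<rho> f x)\<^sup>2)"
  proof (rule Bochner_Integration.integrable_bound[OF conv_mollifier_integrable(1)[OF f2]])
    show "AE x in lborel. norm ((conv \<rho> f x)\<^sup>2) \<le> norm (conv \<rho> (\<lambda>y. (f y)\<^sup>2) x)"
      using conv_mollifier_square_le[OF f] by (auto intro: order_trans[OF _ abs_ge_self])
  qed measurable
  then show "L2 (conv \<rho> f)" by (simp add: L2_real_iff)
  have "(LINT x|lborel. (conv \<rho> f x)\<^sup>2) \<le> (LINT x|lborel. conv \<rho> (\<lambda>y. (f y)\<^sup>2) x)"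
    by (rule integral_mono[OF i conv_mollifier_integrable(1)[OF f2] conv_mollifier_square_le[OF f]])
  then show "(LINT x|lborel. (conv \<rho> f x)\<^sup>2) \<le> (LINT x|lborel. (f x)\<^sup>2)"
    using conv_mollifier_integrable(2)[OF f2] by simp
qed

lemma conv_mollifier_const: "conv \<rho> (\<lambda>_. c) x = c"
  using mollifier_integral[of x] by (simp add: conv_def)

end

lemma conv_diff:
  assumes "locally_integrable f" "locally_integrable g" "test_function \<kappa>"
  shows "conv \<kappa> (\<lambda>y. f y - g y) x = conv \<kappa> f x - conv \<kappa> g x"
  using conv_integrable[OF assms(1,3)] conv_integrable[OF assms(2,3)]
  by (simp add: conv_def right_diff_distrib)

lemma locally_integrable_diff:
  "locally_integrable f \<Longrightarrow> locally_integrable g \<Longrightarrow> locally_integrable (\<lambda>x. f x - g x)"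
  by (simp add: locally_integrable_def)

lemma mollifier_test_approx:
  assumes \<rho>: "mollifier e \<rho>" and \<phi>: "test_function \<phi>"
    and L: "L > 0" "\<And>x y. \<bar>\<phi> x - \<phi> y\<bar> \<le> L * norm (x - y)"
  shows "\<bar>conv \<rho> \<phi> x - \<phi> x\<bar> \<le> L * e"
proof -
  have l: "locally_integrable \<phi>" by (intro smooth_locally_integrable test_functionD \<phi>)
  have "conv \<rho> \<phi> x - \<phi> x = conv \<rho> (\<lambda>y. \<phi> y - \<phi> x) x"
    by (subst conv_diff[OF l _ mollifier_test[OF \<rho>]]) (simp_all add: conv_mollifier_const[OF \<rho>])
  also have "\<bar>\<dots>\<bar> \<le> (L * e) * conv \<rho> (\<lambda>_. 1) x"
  proof (rule conv_mollifier_abs_le[OF \<rho>])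
    show "locally_integrable (\<lambda>y. \<phi> y - \<phi> x)" by (intro locally_integrable_diff l) simp
    fix y assume "norm (x - y) < e"
    then have "L * norm (y - x) \<le> L * e" using L(1) by (simp add: norm_minus_commute)
    then show "\<bar>\<phi> y - \<phi> x\<bar> \<le> L * e * 1" using L(2)[of y x] by simp
  qed simp
  finally show ?thesis by (simp add: conv_mollifier_const[OF \<rho>])
qed

text \<open>Approximate \<psi> by a test function \<phi>. The L2 error of \<psi> - \<phi> does not
  grow under averaging, while \<phi> is reproduced up to L e uniformly; the integrable weight
  \<open>a\<close> turns this uniform bound into an integral one.\<close>

lemma mollifier_L2_approx:
  assumes \<psi>: "L2 \<psi>" and a: "test_function a" "\<And>x. 0 \<le> a x" and \<delta>: "\<delta> > 0"
  shows "\<exists>e0>0. \<forall>e \<rho>. 0 < e \<and> e < e0 \<and> mollifier e \<rho> \<longrightarrow>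
    (LINT x|lborel. a x * (conv \<rho> \<psi> x - \<psi> x)\<^sup>2) \<le> \<delta>"
proof -
  obtain A where A: "A > 0" "\<And>x. \<bar>a x\<bar> \<le> A" using test_function_bounded[OF a(1)] by metis
  have "\<delta> / (12 * A) > 0" using \<delta> A by simp
  then obtain \<phi> where \<phi>: "test_function \<phi>" "(LINT x|lborel. (\<psi> x - \<phi> x)\<^sup>2) < \<delta> / (12 * A)"
    using test_functions_dense_L2[OF \<psi>] unfolding L2_approximable_def by blast
  obtain L where L: "L > 0" "\<And>x y. \<bar>\<phi> x - \<phi> y\<bar> \<le> L * norm (x - y)"
    using test_function_Lipschitz[OF \<phi>(1)] by metis
  define J where "J = (LINT x|lborel. a x)"
  have J: "J \<ge> 0" unfolding J_def using a by simp
  \<comment> \<open>This makes the middle term 3 (L e)^2 J at most \<delta>/2; each of the two terms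
    with \<psi> - \<phi> takes \<delta>/4. \<open>J + 1\<close> avoids dividing by 0.\<close>
  define e0 where "e0 = sqrt (\<delta> / (6 * L\<^sup>2 * (J + 1)))"
  have e0: "e0 > 0" unfolding e0_def using \<delta> L J by (simp add: add_nonneg_pos)
  have "(LINT x|lborel. a x * (conv \<rho> \<psi> x - \<psi> x)\<^sup>2) \<le> \<delta>"
    if e: "0 < e" "e < e0" and \<rho>: "mollifier e \<rho>" for e \<rho>
  proof -
    let ?d = "\<lambda>x. \<psi> x - \<phi> x"
    have d: "L2 ?d" by (intro L2_diff \<psi> test_function_L2 \<phi>)
    have i: "integrable lborel (\<lambda>x. (?d x)\<^sup>2)" "integrable lborel (\<lambda>x. (conv \<rho> ?d x)\<^sup>2)" "integrable lborel a"
      using d conv_mollifier_L2(1)[OF \<rho> d] test_integrable[OF a(1)] by (auto simp: L2_real_iff)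
    have u: "conv \<rho> ?d x = conv \<rho> \<psi> x - conv \<rho> \<phi> x" for x
      by (intro conv_diff L2_locally_integrable \<psi> test_function_L2 \<phi> mollifier_test[OF \<rho>])
    have pw: "a x * (conv \<rho> \<psi> x - \<psi> x)\<^sup>2
        \<le> 3 * A * (conv \<rho> ?d x)\<^sup>2 + 3 * (L * e)\<^sup>2 * a x + 3 * A * (?d x)\<^sup>2" for x
    proof -
      let ?p = "conv \<rho> ?d x" and ?q = "conv \<rho> \<phi> x - \<phi> x"
      have "(conv \<rho> \<psi> x - \<psi> x)\<^sup>2 = (?p + ?q - ?d x)\<^sup>2" by (simp add: u)
      \<comment> \<open>The difference of the two sides is the sum of the three squares used
        here.\<close>
      also have "\<dots> \<le> 3 * ?p\<^sup>2 + 3 * ?q\<^sup>2 + 3 * (?d x)\<^sup>2"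
        using zero_le_power2[of "?p - ?q"] zero_le_power2[of "?p + ?d x"] zero_le_power2[of "?q + ?d x"]
        unfolding power2_eq_square by (simp only: algebra_simps)
      also have "?q\<^sup>2 \<le> (L * e)\<^sup>2"
        using mollifier_test_approx[OF \<rho> \<phi>(1) L, of x] by (simp add: abs_le_square_iff[symmetric])
      finally have "a x * (conv \<rho> \<psi> x - \<psi> x)\<^sup>2 \<le> a x * (3 * ?p\<^sup>2 + 3 * (L * e)\<^sup>2 + 3 * (?d x)\<^sup>2)"
        using a(2)[of x] by (intro mult_left_mono) auto
      also have "\<dots> = a x * (3 * ?p\<^sup>2 + 3 * (?d x)\<^sup>2) + 3 * (L * e)\<^sup>2 * a x"
        by (simp add: algebra_simps)
      also have "\<dots> \<le> A * (3 * ?p\<^sup>2 + 3 * (?d x)\<^sup>2) + 3 * (L * e)\<^sup>2 * a x"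
        using A(2)[of x] a(2)[of x] by (intro add_mono mult_right_mono) auto
      finally show ?thesis by (simp add: algebra_simps)
    qed
    have "integrable lborel (\<lambda>x. a x * (conv \<rho> \<psi> x - \<psi> x)\<^sup>2)"
      using L2_mult_integrable[OF L2_test_mult[OF _ a(1)], of "\<lambda>x. conv \<rho> \<psi> x - \<psi> x" "\<lambda>x. conv \<rho> \<psi> x - \<psi> x"]
        L2_diff[OF conv_mollifier_L2(1)[OF \<rho> \<psi>] \<psi>]
      by (simp add: power2_eq_square mult.assoc)
    then have "(LINT x|lborel. a x * (conv \<rho> \<psi> x - \<psi> x)\<^sup>2)
      \<le> (LINT x|lborel. 3 * A * (conv \<rho> ?d x)\<^sup>2 + 3 * (L * e)\<^sup>2 * a x + 3 * A * (?d x)\<^sup>2)"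
      using i pw by (intro integral_mono) auto
    also have "\<dots> = 3 * A * (LINT x|lborel. (conv \<rho> ?d x)\<^sup>2) + 3 * (L * e)\<^sup>2 * J + 3 * A * (LINT x|lborel. (?d x)\<^sup>2)"
      using i by (simp add: J_def)
    also have "\<dots> \<le> 3 * A * (\<delta> / (12 * A)) + \<delta> / 2 + 3 * A * (\<delta> / (12 * A))"
    proof (intro add_mono mult_left_mono)
      show "(LINT x|lborel. (conv \<rho> ?d x)\<^sup>2) \<le> \<delta> / (12 * A)"
        using conv_mollifier_L2(2)[OF \<rho> d] \<phi>(2) by linarith
      have "e\<^sup>2 \<le> e0\<^sup>2" using e by (intro power_mono) auto
      also have "\<dots> = \<delta> / (6 * L\<^sup>2 * (J + 1))" unfolding e0_def using \<delta> J by simp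
      finally have "e\<^sup>2 \<le> \<delta> / (6 * L\<^sup>2 * (J + 1))" .
      then have "6 * L\<^sup>2 * (J + 1) * e\<^sup>2 \<le> \<delta>"
        using L(1) J by (subst (asm) pos_le_divide_eq) (auto simp: mult.commute)
      moreover have "L\<^sup>2 * J * e\<^sup>2 \<le> L\<^sup>2 * (J + 1) * e\<^sup>2" by (intro mult_right_mono mult_left_mono) auto
      ultimately show "3 * (L * e)\<^sup>2 * J \<le> \<delta> / 2" by (simp add: power_mult_distrib mult_ac)
    qed (use A \<phi> in auto)
    also have "\<dots> = \<delta>" using A by (simp add: field_simps)
    finally show ?thesis .
  qed
  with e0 show ?thesis by blast
qed

section \<open>The virial identity\<close>

lemma partial_deriv_add_smooth: "smooth f \<Longrightarrow> smooth g \<Longrightarrow>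
    partial_deriv b (\<lambda>x. f x + g x) x = partial_deriv b f x + partial_deriv b g x"
  and partial_deriv_mult_smooth: "smooth f \<Longrightarrow> smooth g \<Longrightarrow>
    partial_deriv b (\<lambda>x. f x * g x) x = f x * partial_deriv b g x + partial_deriv b f x * g x"
  by (intro partial_deriv_add partial_deriv_mult smooth_differentiable; assumption)+

lemma partial_deriv_cmult_smooth: "smooth f \<Longrightarrow> partial_deriv b (\<lambda>x. k * f x) x = k * partial_deriv b f x"
  using partial_deriv_mult_smooth[OF smooth_const[of k], of f b x] by simp

lemma partial_deriv_sum_smooth: "(\<And>i. i \<in> I \<Longrightarrow> smooth (f i)) \<Longrightarrow>
    partial_deriv b (\<lambda>x. \<Sum>i\<in>I. f i x) x = (\<Sum>i\<in>I. partial_deriv b (f i) x)"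
  by (intro partial_deriv_sum smooth_differentiable)

text \<open>The multiplier \<open>2 \<langle>w, \<nabla>u\<rangle> + (div w) u\<close> turns \<open>(-h\<^sup>2 \<Delta> + v - l) u\<close> into the quadratic form of the
  commutator with \<open>\<langle>w, \<nabla>\<rangle>\<close>, up to the divergence of a compactly supported field.\<close>

lemma virial_identity:
  fixes u v :: "'a::euclidean_space \<Rightarrow> real" and w :: "'a \<Rightarrow> 'a \<Rightarrow> real"
  assumes u: "smooth u" and v: "smooth v" and w: "\<And>b. b \<in> Basis \<Longrightarrow> test_function (w b)"
  defines "\<phi> \<equiv> \<lambda>x. \<Sum>b\<in>Basis. 2 * (w b x * partial_deriv b u x) + partial_deriv b (w b) x * u x"
  shows "(LINT x|lborel. (- h\<^sup>2 * (\<Sum>c\<in>Basis. partial_deriv c (partial_deriv c u) x) + (v x - l) * u x) * \<phi> x)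
    = h\<^sup>2 * (LINT x|lborel. (\<Sum>b\<in>Basis. \<Sum>c\<in>Basis. 2 * partial_deriv c (w b) x * partial_deriv b u x * partial_deriv c u x
          + u x * partial_deriv c u x * partial_deriv c (partial_deriv b (w b)) x))
      - (LINT x|lborel. (\<Sum>b\<in>Basis. w b x * partial_deriv b v x) * (u x)\<^sup>2)"
proof -
  let ?D = "partial_deriv"
  let ?r = "\<lambda>x. - h\<^sup>2 * (\<Sum>c\<in>Basis. ?D c (?D c u) x) + (v x - l) * u x"
  let ?Q = "\<lambda>x. \<Sum>b\<in>Basis. \<Sum>c\<in>Basis. 2 * ?D c (w b) x * ?D b u x * ?D c u x + u x * ?D c u x * ?D c (?D b (w b)) x"
  let ?A = "\<lambda>x. (\<Sum>b\<in>Basis. w b x * ?D b v x) * (u x)\<^sup>2"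
  define S where "S = (\<lambda>x. \<Sum>c\<in>Basis. ?D c u x * ?D c u x)"
  \<comment> \<open>A compactly supported field whose divergence is the difference of the integrands
    (\<open>sumDX\<close>). Its part h^2 w |\<nabla>u|^2 cancels the second derivatives of u that
    arise when a derivative hits \<phi>; its part (v - l) w u^2 matches (v - l) u \<phi> and leaves
    the derivative of v.\<close>
  define X where "X = (\<lambda>b x. - h\<^sup>2 * (?D b u x * \<phi> x) + (h\<^sup>2 * (w b x * S x) + (v x - l) * (w b x * (u x * u x))))"
  note ws = test_functionD[OF w]
  have S: "smooth S" unfolding S_def by (intro smooth_intros u)
  have \<phi>t: "test_function \<phi>" unfolding \<phi>_def by (intro smooth_intros u w)
  note \<phi> = test_functionD[OF \<phi>t]
  have Xt: "test_function (X b)" if "b \<in> Basis" for b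
    unfolding X_def
    by (intro test_function_add test_function_mult_right test_function_mult_left \<phi>t w smooth_intros u v S that)
  have DS: "?D b S x = (\<Sum>c\<in>Basis. 2 * ?D c u x * ?D b (?D c u) x)" if "b \<in> Basis" for b x
    unfolding S_def
    by (subst partial_deriv_sum_smooth) (auto intro!: smooth_intros u sum.cong simp: partial_deriv_mult_smooth[OF smooth_partial_deriv[OF u] smooth_partial_deriv[OF u]])
  have D\<phi>: "?D c \<phi> x = (\<Sum>b\<in>Basis. 2 * (w b x * ?D c (?D b u) x + ?D c (w b) x * ?D b u x)
      + (?D b (w b) x * ?D c u x + ?D c (?D b (w b)) x * u x))" if "c \<in> Basis" for c x
  proof -
    have "?D c (\<lambda>x. 2 * (w b x * ?D b u x) + ?D b (w b) x * u x) x
      = 2 * (w b x * ?D c (?D b u) x + ?D c (w b) x * ?D b u x)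
      + (?D b (w b) x * ?D c u x + ?D c (?D b (w b)) x * u x)" if b: "b \<in> Basis" for b
      using b ws u by (simp add: partial_deriv_add_smooth partial_deriv_cmult_smooth partial_deriv_mult_smooth smooth_intros)
    moreover have "smooth (\<lambda>x. 2 * (w b x * ?D b u x) + ?D b (w b) x * u x)" if "b \<in> Basis" for b
      by (intro smooth_intros u ws that)
    ultimately show ?thesis unfolding \<phi>_def by (subst partial_deriv_sum_smooth) auto
  qed
  have DX: "?D b (X b) x = - h\<^sup>2 * (?D b u x * ?D b \<phi> x + ?D b (?D b u) x * \<phi> x)
      + (h\<^sup>2 * (w b x * ?D b S x + ?D b (w b) x * S x)
      + ((v x - l) * (w b x * (2 * u x * ?D b u x) + ?D b (w b) x * (u x * u x))
         + ?D b v x * (w b x * (u x * u x))))" if b: "b \<in> Basis" for b x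
  proof -
    have vl: "smooth (\<lambda>x. v x - l)" by (intro smooth_intros v)
    have Dvl: "?D b (\<lambda>x. v x - l) x = ?D b v x"
      using partial_deriv_add_smooth[OF v smooth_const[of "-l"], of b x] by simp
    have w2: "smooth (\<lambda>x. w b x * (u x * u x))" by (intro smooth_intros u ws b)
    have "?D b (X b) x = - h\<^sup>2 * ?D b (\<lambda>x. ?D b u x * \<phi> x) x
      + (h\<^sup>2 * ?D b (\<lambda>x. w b x * S x) x + ?D b (\<lambda>x. (v x - l) * (w b x * (u x * u x))) x)"
      unfolding X_def
      by (subst partial_deriv_add_smooth, (intro smooth_intros u \<phi> ws S v b)+, subst partial_deriv_add_smooth, (intro smooth_intros u \<phi> ws S v b)+)
         (simp only: partial_deriv_cmult_smooth[OF smooth_mult[OF smooth_partial_deriv[OF u b] \<phi>]] partial_deriv_cmult_smooth[OF smooth_mult[OF ws[OF b] S]])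
    also have "?D b (\<lambda>x. ?D b u x * \<phi> x) x = ?D b u x * ?D b \<phi> x + ?D b (?D b u) x * \<phi> x"
      by (intro partial_deriv_mult_smooth smooth_intros u b \<phi>)
    also have "?D b (\<lambda>x. w b x * S x) x = w b x * ?D b S x + ?D b (w b) x * S x"
      by (intro partial_deriv_mult_smooth ws b S)
    also have "?D b (\<lambda>x. (v x - l) * (w b x * (u x * u x))) x
        = (v x - l) * ?D b (\<lambda>x. w b x * (u x * u x)) x + ?D b v x * (w b x * (u x * u x))"
      by (subst partial_deriv_mult_smooth[OF vl w2]) (simp add: Dvl)
    also have "?D b (\<lambda>x. w b x * (u x * u x)) x = w b x * (2 * u x * ?D b u x) + ?D b (w b) x * (u x * u x)"
      by (subst partial_deriv_mult_smooth[OF ws[OF b] smooth_mult[OF u u]]) (simp add: partial_deriv_mult_smooth[OF u u])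
    finally show ?thesis .
  qed
  have sumDX: "(\<Sum>b\<in>Basis. ?D b (X b) x) = ?r x * \<phi> x - h\<^sup>2 * ?Q x + ?A x" for x
  proof -
    \<comment> \<open>Symmetry of second derivatives lets the sum over c of 2 w_b D_c u D_c D_b u be
      read as w_b D_b S.\<close>
    have comm: "?D c (?D b u) x = ?D b (?D c u) x" if "b \<in> Basis" "c \<in> Basis" for b c
      by (rule partial_deriv_commute[OF u that])
    have grad_part: "(\<Sum>b\<in>Basis. ?D b u x * ?D b \<phi> x)
        = ?Q x + (\<Sum>b\<in>Basis. w b x * ?D b S x + ?D b (w b) x * S x)"
    proof -
      have "(\<Sum>b\<in>Basis. ?D b u x * ?D b \<phi> x) = (\<Sum>c\<in>Basis. \<Sum>b\<in>Basis. ?D c u x * (2 * (w b x * ?D c (?D b u) x + ?D c (w b) x * ?D b u x)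
      + (?D b (w b) x * ?D c u x + ?D c (?D b (w b)) x * u x)))"
        by (auto simp: D\<phi> sum_distrib_left intro!: sum.cong)
      also have "\<dots> = (\<Sum>b\<in>Basis. \<Sum>c\<in>Basis. ?D c u x * (2 * (w b x * ?D c (?D b u) x + ?D c (w b) x * ?D b u x)
      + (?D b (w b) x * ?D c u x + ?D c (?D b (w b)) x * u x)))"
        by (rule sum.swap)
      also have "\<dots> = (\<Sum>b\<in>Basis. \<Sum>c\<in>Basis. (2 * ?D c (w b) x * ?D b u x * ?D c u x + u x * ?D c u x * ?D c (?D b (w b)) x)
         + (w b x * (2 * ?D c u x * ?D b (?D c u) x) + ?D b (w b) x * (?D c u x * ?D c u x)))"
        by (intro sum.cong refl) (simp add: comm algebra_simps)
      also have "\<dots> = ?Q x + (\<Sum>b\<in>Basis. w b x * ?D b S x + ?D b (w b) x * S x)"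
        using fun_cong[OF S_def, of x] unfolding sum.distrib by (simp add: DS sum_distrib_left)
      finally show ?thesis .
    qed
    have pot: "(\<Sum>b\<in>Basis. (v x - l) * (w b x * (2 * u x * ?D b u x) + ?D b (w b) x * (u x * u x))
         + ?D b v x * (w b x * (u x * u x))) = (v x - l) * u x * \<phi> x + ?A x"
    proof -
      have "(v x - l) * u x * \<phi> x + ?A x
        = (\<Sum>b\<in>Basis. (v x - l) * u x * (2 * (w b x * ?D b u x) + ?D b (w b) x * u x) + w b x * ?D b v x * (u x)\<^sup>2)"
        unfolding \<phi>_def by (subst sum.distrib) (simp only: sum_distrib_left sum_distrib_right)
      also have "\<dots> = (\<Sum>b\<in>Basis. (v x - l) * (w b x * (2 * u x * ?D b u x) + ?D b (w b) x * (u x * u x))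
         + ?D b v x * (w b x * (u x * u x)))"
        by (intro sum.cong refl) (simp add: algebra_simps power2_eq_square)
      finally show ?thesis ..
    qed
    have "(\<Sum>b\<in>Basis. ?D b (X b) x) = - h\<^sup>2 * ((\<Sum>b\<in>Basis. ?D b u x * ?D b \<phi> x) + (\<Sum>b\<in>Basis. ?D b (?D b u) x) * \<phi> x)
      + (h\<^sup>2 * (\<Sum>b\<in>Basis. w b x * ?D b S x + ?D b (w b) x * S x)
      + (\<Sum>b\<in>Basis. (v x - l) * (w b x * (2 * u x * ?D b u x) + ?D b (w b) x * (u x * u x))
         + ?D b v x * (w b x * (u x * u x))))"
      by (simp only: DX cong: sum.cong) (simp only: sum.distrib sum_distrib_left[symmetric] sum_distrib_right[symmetric])
    also have "\<dots> = ?r x * \<phi> x - h\<^sup>2 * ?Q x + ?A x"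
      unfolding grad_part pot by (simp only: algebra_simps)
    finally show ?thesis .
  qed
  have "(LINT x|lborel. (\<Sum>b\<in>Basis. ?D b (X b) x)) = (\<Sum>b\<in>Basis. LINT x|lborel. ?D b (X b) x)"
    by (intro Bochner_Integration.integral_sum test_integrable test_function_partial_deriv Xt)
  also have "\<dots> = 0" using integral_partial_deriv_eq_0[OF Xt] by simp
  finally have "(LINT x|lborel. ?r x * \<phi> x - h\<^sup>2 * ?Q x + ?A x) = 0" unfolding sumDX .
  moreover have "integrable lborel (\<lambda>x. ?r x * \<phi> x)"
    by (intro test_integrable test_function_mult_right \<phi>t smooth_intros u v)
  moreover have "integrable lborel ?Q"
    by (intro test_integrable test_function_sum test_function_add test_function_mult_right test_function_mult_left
        smooth_intros u w)
  moreover have "integrable lborel ?A"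
    by (intro test_integrable test_function_mult_left test_function_sum smooth_intros u v w)
  ultimately show ?thesis by simp
qed

section \<open>Friedrichs' commutator and the virial estimate\<close>

lemma smooth_Lipschitz_cball:
  assumes "smooth f"
  obtains L where "L > 0"
    "\<And>x y. norm x \<le> R \<Longrightarrow> norm y \<le> R \<Longrightarrow> \<bar>f x - f y\<bar> \<le> L * norm (x - y)"
proof -
  have "\<exists>B>0. \<forall>x. norm x \<le> R \<longrightarrow> \<bar>partial_deriv b f x\<bar> \<le> B" if "b \<in> Basis" for b
    using smooth_bounded_cball[OF smooth_partial_deriv[OF assms that]] by metis
  then obtain B where B: "\<And>b. b \<in> Basis \<Longrightarrow> B b > 0"
    "\<And>b x. b \<in> Basis \<Longrightarrow> norm x \<le> R \<Longrightarrow> \<bar>partial_deriv b f x\<bar> \<le> B b"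
    by metis
  define L where "L = (\<Sum>b\<in>Basis. B b)"
  have gradL: "norm (grad f x) \<le> L" if "norm x \<le> R" for x
    unfolding grad_def L_def by (rule sum_norm_le) (use B that in auto)
  have "norm (f x - f y) \<le> L * norm (x - y)" if "norm x \<le> R" "norm y \<le> R" for x y
  proof (rule differentiable_bound[of "cball 0 R" f "\<lambda>x h. inner h (grad f x)"])
    show "(f has_derivative (\<lambda>h. h \<bullet> grad f x)) (at x within cball 0 R)" for x
      using smooth_has_derivative[OF assms] by (rule has_derivative_at_withinI)
    show "onorm (\<lambda>h. h \<bullet> grad f x) \<le> L" if "x \<in> cball 0 R" for x
    proof (rule onorm_le)
      fix h
      have "norm (h \<bullet> grad f x) \<le> norm h * norm (grad f x)"
        using Cauchy_Schwarz_ineq2 by simp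
      also have "\<dots> \<le> norm h * L" using gradL that by (intro mult_left_mono) auto
      finally show "norm (h \<bullet> grad f x) \<le> L * norm h" by (simp add: mult.commute)
    qed
  qed (use that in auto)
  moreover have "L > 0" unfolding L_def using B by (intro sum_pos) auto
  ultimately show thesis by (intro that) auto
qed

text \<open>Test the weak gradient with y \<mapsto> \<kappa> (x - y): the sign of the reflection
  cancels that of the integration by parts. Thus a derivative may be moved from the kernel to
  \<psi>.\<close>

lemma partial_deriv_conv_weak_grad:
  assumes "L2 \<psi>" "L2 g" "has_weak_grad \<psi> g" "test_function \<kappa>" "b \<in> Basis"
  shows "partial_deriv b (conv \<kappa> \<psi>) = conv \<kappa> (\<lambda>y. inner (g y) b)"
proof
  fix x
  have "(LINT y|lborel. \<psi> y * partial_deriv b (\<lambda>y. \<kappa> (x - y)) y) = - (LINT y|lborel. inner (g y) b * \<kappa> (x - y))"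
    using assms(3) test_function_reflect[OF assms(4)] assms(5) unfolding has_weak_grad_def by blast
  then have "conv (partial_deriv b \<kappa>) \<psi> x = conv \<kappa> (\<lambda>y. inner (g y) b) x"
    by (simp add: partial_deriv_reflect[OF test_functionD[OF assms(4)]] conv_def mult.commute)
  then show "partial_deriv b (conv \<kappa> \<psi>) x = conv \<kappa> (\<lambda>y. inner (g y) b) x"
    by (simp add: partial_deriv_conv[OF L2_locally_integrable[OF assms(1)] assms(4,5)])
qed

lemma eigenfunction_H1: "eigenfunction h v l \<psi> \<Longrightarrow> H1 \<psi>"
  by (auto simp: eigenfunction_def schroedinger_op_def form_domain_def)

lemma eigenfunction_L2: "eigenfunction h v l \<psi> \<Longrightarrow> L2 \<psi>"
  using eigenfunction_H1 by (auto simp: H1_def)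

text \<open>Friedrichs' commutator: the mollified eigenfunction solves the equation up to
  the error on the right-hand side, which is small because \<open>v\<close> is locally Lipschitz.\<close>

lemma eigenfunction_conv:
  assumes e: "eigenfunction h v l \<psi>" and v: "smooth v" and \<rho>: "test_function \<rho>"
  shows "- h\<^sup>2 * (\<Sum>c\<in>Basis. partial_deriv c (partial_deriv c (conv \<rho> \<psi>)) x) + (v x - l) * conv \<rho> \<psi> x
    = conv \<rho> (\<lambda>y. (v x - v y) * \<psi> y) x"
proof -
  let ?g = "weak_grad \<psi>" and ?\<phi> = "\<lambda>y. \<rho> (x - y)"
  note H = eigenfunction_H1[OF e] and L = eigenfunction_L2[OF e]
  note g = weak_grad_L2[OF H] weak_grad_has_weak_grad[OF H]
  have \<phi>: "test_function ?\<phi>" by (rule test_function_reflect[OF \<rho>])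
  \<comment> \<open>One derivative goes to \<psi> and the other stays on the kernel, which is the
    form of the weak equation tested with y \<mapsto> \<rho> (x - y).\<close>
  have D2: "partial_deriv c (partial_deriv c (conv \<rho> \<psi>)) x = (LINT y|lborel. partial_deriv c \<rho> (x - y) * inner (?g y) c)"
    if "c \<in> Basis" for c
    unfolding partial_deriv_conv_weak_grad[OF L g \<rho> that]
    by (subst partial_deriv_conv[OF L2_locally_integrable[OF L2_component[OF g(1) that]] \<rho> that]) (simp add: conv_def)
  have "(\<Sum>c\<in>Basis. partial_deriv c (partial_deriv c (conv \<rho> \<psi>)) x)
      = (\<Sum>c\<in>Basis. LINT y|lborel. partial_deriv c \<rho> (x - y) * inner (?g y) c)"
    by (intro sum.cong refl D2)
  also have "\<dots> = (LINT y|lborel. (\<Sum>c\<in>Basis. partial_deriv c \<rho> (x - y) * inner (?g y) c))"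
    by (rule Bochner_Integration.integral_sum[symmetric])
      (intro conv_integrable L2_locally_integrable L2_component g(1) test_function_partial_deriv \<rho>)
  also have "\<dots> = (LINT y|lborel. - inner (?g y) (grad ?\<phi> y))"
    by (simp add: grad_def inner_sum_right partial_deriv_reflect[OF test_functionD[OF \<rho>]] sum_negf)
  finally have lap: "(\<Sum>c\<in>Basis. partial_deriv c (partial_deriv c (conv \<rho> \<psi>)) x) = - (LINT y|lborel. inner (?g y) (grad ?\<phi> y))"
    by simp
  have eq: "h\<^sup>2 * (LINT y|lborel. inner (?g y) (grad ?\<phi> y)) + (LINT y|lborel. v y * \<psi> y * \<rho> (x - y))
      = l * (LINT y|lborel. \<psi> y * \<rho> (x - y))"
    by (rule eigenfunction_weak_equation[OF e test_form_domain[OF v \<phi>] test_grad_L2[OF \<phi>] test_has_weak_grad[OF \<phi>]])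
  have i: "integrable lborel (\<lambda>y. \<rho> (x - y) * \<psi> y)" "integrable lborel (\<lambda>y. \<rho> (x - y) * (v y * \<psi> y))"
    by (intro conv_integrable locally_integrable_mult_smooth L2_locally_integrable L v \<rho>)+
  have "conv \<rho> (\<lambda>y. (v x - v y) * \<psi> y) x = (LINT y|lborel. v x * (\<rho> (x - y) * \<psi> y) - \<rho> (x - y) * (v y * \<psi> y))"
    unfolding conv_def by (simp add: algebra_simps)
  also have "\<dots> = v x * conv \<rho> \<psi> x - (LINT y|lborel. \<rho> (x - y) * (v y * \<psi> y))"
    using i by (simp add: conv_def)
  also have "(LINT y|lborel. \<rho> (x - y) * (v y * \<psi> y)) = (LINT y|lborel. v y * \<psi> y * \<rho> (x - y))"
    by (simp add: mult_ac)
  also have "(LINT y|lborel. v y * \<psi> y * \<rho> (x - y)) = l * conv \<rho> \<psi> x - h\<^sup>2 * (LINT y|lborel. inner (?g y) (grad ?\<phi> y))"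
    using eq by (simp add: conv_def mult.commute)
  finally show ?thesis unfolding lap by (simp add: algebra_simps)
qed

text \<open>Apply the virial identity to u = \<open>conv \<rho> \<psi>\<close>. Its quadratic part
  is controlled by the H1 norm of \<psi> with the constant \<open>C1\<close>, which depends on w
  alone, and the residual of u contributes O(e). Returning from u to \<psi> by \<psi>^2 \<le> 2 u^2
  + 2 (u - \<psi>)^2 costs the factor 2 in front of \<open>C1\<close>.\<close>

lemma virial_bound:
  fixes v :: "'a::euclidean_space \<Rightarrow> real" and w :: "'a \<Rightarrow> 'a \<Rightarrow> real"
  assumes v: "smooth v" and w: "\<And>b. b \<in> Basis \<Longrightarrow> test_function (w b)"
  defines "a \<equiv> \<lambda>x. \<Sum>b\<in>Basis. w b x * partial_deriv b v x"
  assumes a0: "\<And>x. 0 \<le> a x"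
  obtains C where "C > 0" "\<And>h l \<psi>. eigenfunction h v l \<psi> \<Longrightarrow>
    (LINT x|lborel. a x * (\<psi> x)\<^sup>2) \<le> C * h\<^sup>2 * ((LINT x|lborel. (norm (weak_grad \<psi> x))\<^sup>2) + (LINT x|lborel. (\<psi> x)\<^sup>2))"
proof -
  let ?D = "partial_deriv" and ?n = "real DIM('a)"
  have n: "?n \<ge> 1" by (simp add: DIM_positive Suc_leI)
  have at: "test_function a" unfolding a_def by (intro smooth_intros w v)
  obtain A where A: "A > 0" "\<And>b c x. b \<in> Basis \<Longrightarrow> c \<in> Basis \<Longrightarrow>
      \<bar>w b x\<bar> \<le> A \<and> \<bar>?D c (w b) x\<bar> \<le> A \<and> \<bar>?D c (?D b (w b)) x\<bar> \<le> A"
  proof -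
    have "\<exists>B>0. \<forall>x. \<bar>w b x\<bar> \<le> B \<and> \<bar>?D c (w b) x\<bar> \<le> B \<and> \<bar>?D c (?D b (w b)) x\<bar> \<le> B"
      if bc: "b \<in> Basis" "c \<in> Basis" for b c
    proof -
      obtain B1 where B1: "B1 > 0" "\<And>x. \<bar>w b x\<bar> \<le> B1"
        using test_function_bounded[OF w[OF bc(1)]] by metis
      obtain B2 where B2: "B2 > 0" "\<And>x. \<bar>?D c (w b) x\<bar> \<le> B2"
        using test_function_bounded[OF test_function_partial_deriv[OF w[OF bc(1)] bc(2)]] by metis
      obtain B3 where B3: "B3 > 0" "\<And>x. \<bar>?D c (?D b (w b)) x\<bar> \<le> B3"
        using test_function_bounded[OF test_function_partial_deriv[OF test_function_partial_deriv[OF w[OF bc(1)] bc(1)] bc(2)]]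
        by metis
      have "B1 \<le> B1 + B2 + B3" "B2 \<le> B1 + B2 + B3" "B3 \<le> B1 + B2 + B3"
        using B1(1) B2(1) B3(1) by auto
      then show ?thesis
        using B1 B2 B3 by (intro exI[of _ "B1 + B2 + B3"] conjI allI) (auto intro: order_trans[OF B1(2)] order_trans[OF B2(2)] order_trans[OF B3(2)])
    qed
    then obtain B where B: "\<And>b c. b \<in> Basis \<Longrightarrow> c \<in> Basis \<Longrightarrow> B b c > 0"
      "\<And>b c x. b \<in> Basis \<Longrightarrow> c \<in> Basis \<Longrightarrow>
        \<bar>w b x\<bar> \<le> B b c \<and> \<bar>?D c (w b) x\<bar> \<le> B b c \<and> \<bar>?D c (?D b (w b)) x\<bar> \<le> B b c"
      by metis
    have le: "B b c \<le> (\<Sum>b\<in>Basis. \<Sum>c\<in>Basis. B b c)" if bc: "b \<in> Basis" "c \<in> Basis" for b c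
    proof -
      have "B b c \<le> (\<Sum>c\<in>Basis. B b c)"
        using bc B(1) by (intro member_le_sum) (auto intro: less_imp_le)
      also have "\<dots> \<le> (\<Sum>b\<in>Basis. \<Sum>c\<in>Basis. B b c)"
        using bc B(1) by (intro member_le_sum sum_nonneg) (auto intro: less_imp_le)
      finally show ?thesis .
    qed
    show thesis
    proof (rule that[of "\<Sum>b\<in>Basis. \<Sum>c\<in>Basis. B b c"])
      show "0 < (\<Sum>b\<in>Basis. \<Sum>c\<in>Basis. B b c)" using B(1) by (intro sum_pos) auto
    qed (use B(2) le order_trans in blast)
  qed
  have "\<exists>R. \<forall>x. norm x > R \<longrightarrow> w b x = 0" if "b \<in> Basis" for b
    using test_functionE[OF w[OF that]] by metis
  then obtain R' where R': "\<And>b x. b \<in> Basis \<Longrightarrow> norm x > R' b \<Longrightarrow> w b x = 0" by metis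
  define R where "R = Max (R' ` Basis)"
  have R: "w b x = 0" if "b \<in> Basis" "norm x > R" for b x
  proof -
    have "R' b \<le> R" unfolding R_def using that by (intro Max_ge) auto
    then show ?thesis using R'[OF that(1)] that by simp
  qed
  \<comment> \<open>At a point of the ball of radius R, which carries all w b, the commutator sees v
    up to distance e < 1; hence R + 1.\<close>
  obtain L where L: "L > 0"
    "\<And>x y. norm x \<le> R + 1 \<Longrightarrow> norm y \<le> R + 1 \<Longrightarrow> \<bar>v x - v y\<bar> \<le> L * norm (x - y)"
    using smooth_Lipschitz_cball[OF v] by metis
  \<comment> \<open>With n the dimension, summing Young's inequalities over pairs of basis vectors
    gives A (3 n T + n^2 u^2) for \<open>Q\<close>, and summing over single ones gives A (2 n P + T
    + n u^2) for the residual term. \<open>C1\<close> and \<open>C2\<close> dominate all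
    coefficients at once.\<close>
  define C1 where "C1 = A * (3 * ?n + ?n\<^sup>2)"
  define C2 where "C2 = A * (3 * ?n + 2)"
  have C: "C1 > 0" "C2 > 0" unfolding C1_def C2_def using A n by (auto intro!: mult_pos_pos add_pos_pos)
  have "(LINT x|lborel. a x * (\<psi> x)\<^sup>2)
      \<le> 2 * C1 * h\<^sup>2 * ((LINT x|lborel. (norm (weak_grad \<psi> x))\<^sup>2) + (LINT x|lborel. (\<psi> x)\<^sup>2))"
    if ef: "eigenfunction h v l \<psi>" for h l \<psi>
  proof -
    let ?g = "weak_grad \<psi>"
    define G where "G = (LINT x|lborel. (norm (?g x))\<^sup>2)"
    define M where "M = (LINT x|lborel. (\<psi> x)\<^sup>2)"
    note H = eigenfunction_H1[OF ef] and \<psi> = eigenfunction_L2[OF ef]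
    note g = weak_grad_L2[OF H] weak_grad_has_weak_grad[OF H]
    have GM: "G \<ge> 0" "M \<ge> 0" by (simp_all add: G_def M_def)
    have abs\<psi>: "L2 (\<lambda>x. \<bar>\<psi> x\<bar>)" using \<psi> by (auto simp: L2_real_iff)
    have \<psi>2: "integrable lborel (\<lambda>x. (\<psi> x)\<^sup>2)" using \<psi> by (simp add: L2_real_iff)
    have moll: "(LINT x|lborel. a x * (conv \<rho> \<psi> x)\<^sup>2) \<le> C1 * h\<^sup>2 * (G + M) + L * e * C2 * (G + 2 * M)"
      if e: "0 < e" "e < 1" and \<rho>: "mollifier e \<rho>" for e \<rho>
    proof -
      define u where "u = conv \<rho> \<psi>"
      define P where "P = conv \<rho> (\<lambda>y. (\<psi> y)\<^sup>2)"
      define T where "T = (\<lambda>x. \<Sum>b\<in>Basis. (?D b u x)\<^sup>2)"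
      note \<rho>t = mollifier_test[OF \<rho>]
      have u: "smooth u" unfolding u_def by (intro smooth_conv L2_locally_integrable \<psi> \<rho>t)
      have Du: "?D b u = conv \<rho> (\<lambda>y. inner (?g y) b)" if "b \<in> Basis" for b
        unfolding u_def by (rule partial_deriv_conv_weak_grad[OF \<psi> g \<rho>t that])
      have Du2: "integrable lborel (\<lambda>x. (?D b u x)\<^sup>2)"
        "(LINT x|lborel. (?D b u x)\<^sup>2) \<le> (LINT x|lborel. (inner (?g x) b)\<^sup>2)" if "b \<in> Basis" for b
        using conv_mollifier_L2[OF \<rho> L2_component[OF g(1) that]] by (simp_all add: Du[OF that] L2_real_iff)
      have T: "integrable lborel T" "(LINT x|lborel. T x) \<le> G"
      proof -
        show "integrable lborel T" unfolding T_def using Du2(1) by auto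
        have "(LINT x|lborel. T x) = (\<Sum>b\<in>Basis. LINT x|lborel. (?D b u x)\<^sup>2)"
          unfolding T_def by (rule Bochner_Integration.integral_sum) (rule Du2(1))
        also have "\<dots> \<le> (\<Sum>b\<in>Basis. LINT x|lborel. (inner (?g x) b)\<^sup>2)"
          by (intro sum_mono Du2(2))
        finally show "(LINT x|lborel. T x) \<le> G"
          unfolding G_def integral_norm_square_components[OF g(1)] .
      qed
      have u2: "integrable lborel (\<lambda>x. (u x)\<^sup>2)" "(LINT x|lborel. (u x)\<^sup>2) \<le> M"
        using conv_mollifier_L2[OF \<rho> \<psi>] by (simp_all add: u_def M_def L2_real_iff)
      have P: "integrable lborel P" "(LINT x|lborel. P x) = M"
        using conv_mollifier_integrable[OF \<rho> \<psi>2] by (simp_all add: P_def M_def)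
      define \<phi> where "\<phi> = (\<lambda>x. \<Sum>b\<in>Basis. 2 * (w b x * ?D b u x) + ?D b (w b) x * u x)"
      define r where "r = (\<lambda>x. - h\<^sup>2 * (\<Sum>c\<in>Basis. ?D c (?D c u) x) + (v x - l) * u x)"
      define Q where "Q = (\<lambda>x. \<Sum>b\<in>Basis. \<Sum>c\<in>Basis. 2 * ?D c (w b) x * ?D b u x * ?D c u x
          + u x * ?D c u x * ?D c (?D b (w b)) x)"
      have virial: "(LINT x|lborel. r x * \<phi> x) = h\<^sup>2 * (LINT x|lborel. Q x) - (LINT x|lborel. a x * (u x)\<^sup>2)"
        unfolding r_def \<phi>_def Q_def a_def by (rule virial_identity[OF u v w])
      have \<phi>t: "test_function \<phi>" unfolding \<phi>_def by (intro smooth_intros u w)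
      have rs: "smooth r" unfolding r_def by (intro smooth_intros u v)
      have Qt: "test_function Q" unfolding Q_def
        by (intro test_function_sum test_function_add test_function_mult_right test_function_mult_left
            smooth_intros u w)
      have am: "\<bar>s * t\<bar> \<le> (s\<^sup>2 + t\<^sup>2) / 2" for s t :: real
        using sum_squares_bound[of "\<bar>s\<bar>" "\<bar>t\<bar>"] by (simp add: abs_mult)
      have half: "(s + t) / 2 \<le> q + t" if "s \<le> q" "0 \<le> s" "0 \<le> t" for q s t :: real
        using that by simp
      have Qle: "Q x \<le> C1 * (T x + (u x)\<^sup>2)" for x
      proof -
        have "Q x \<le> (\<Sum>b\<in>Basis. \<Sum>c\<in>Basis. A * ((?D b u x)\<^sup>2 + (?D c u x)\<^sup>2) + A * ((u x)\<^sup>2 + (?D c u x)\<^sup>2))"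
          unfolding Q_def
        proof (intro sum_mono add_mono)
          fix b c :: 'a assume bc: "b \<in> Basis" "c \<in> Basis"
          have "2 * ?D c (w b) x * ?D b u x * ?D c u x \<le> 2 * (\<bar>?D c (w b) x\<bar> * \<bar>?D b u x * ?D c u x\<bar>)"
            using abs_ge_self[of "?D c (w b) x * (?D b u x * ?D c u x)"] by (simp add: abs_mult mult.assoc)
          also have "\<dots> \<le> 2 * (A * (((?D b u x)\<^sup>2 + (?D c u x)\<^sup>2) / 2))"
            using A(1) A(2)[OF bc, of x] am by (intro mult_left_mono mult_mono) auto
          finally show "2 * ?D c (w b) x * ?D b u x * ?D c u x \<le> A * ((?D b u x)\<^sup>2 + (?D c u x)\<^sup>2)" by simp
          have "u x * ?D c u x * ?D c (?D b (w b)) x \<le> \<bar>?D c (?D b (w b)) x\<bar> * \<bar>u x * ?D c u x\<bar>"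
            using abs_ge_self[of "u x * ?D c u x * ?D c (?D b (w b)) x"] by (simp add: abs_mult mult_ac)
          also have "\<dots> \<le> A * (((u x)\<^sup>2 + (?D c u x)\<^sup>2) / 2)"
            using A(1) A(2)[OF bc, of x] am by (intro mult_mono) auto
          also have "\<dots> \<le> A * ((u x)\<^sup>2 + (?D c u x)\<^sup>2)" using A(1) by (intro mult_left_mono) auto
          finally show "u x * ?D c u x * ?D c (?D b (w b)) x \<le> A * ((u x)\<^sup>2 + (?D c u x)\<^sup>2)" .
        qed
        also have "\<dots> = A * (3 * ?n * T x + ?n\<^sup>2 * (u x)\<^sup>2)"
          unfolding T_def by (simp add: sum.distrib sum_distrib_left[symmetric] algebra_simps power2_eq_square)
        also have "\<dots> \<le> A * ((3 * ?n + ?n\<^sup>2) * T x + (3 * ?n + ?n\<^sup>2) * (u x)\<^sup>2)"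
          using A(1) n by (intro mult_left_mono add_mono mult_right_mono) (auto simp: T_def sum_nonneg)
        finally show ?thesis by (simp add: C1_def algebra_simps)
      qed
      \<comment> \<open>The residual \<open>r\<close> is at most L e times the average of |\<psi>|,
        whose square is below \<open>P\<close> by Jensen. The multiplier \<open>\<phi>\<close>
        contains only first derivatives of u, so no derivative of the residual has to be
        estimated.\<close>
      have r\<phi>: "\<bar>r x * \<phi> x\<bar> \<le> L * e * C2 * (P x + T x + (u x)\<^sup>2)" for x
      proof (cases "norm x \<le> R")
        case True
        define p where "p = conv \<rho> (\<lambda>y. \<bar>\<psi> y\<bar>) x"
        have p: "0 \<le> p" unfolding p_def conv_def using mollifier_nonneg[OF \<rho>] by simp
        have p2: "p\<^sup>2 \<le> P x" using conv_mollifier_square_le[OF \<rho> abs\<psi>, of x] by (simp add: p_def P_def)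
        have "r x = conv \<rho> (\<lambda>y. (v x - v y) * \<psi> y) x"
          unfolding r_def u_def by (rule eigenfunction_conv[OF ef v \<rho>t])
        also have "\<bar>\<dots>\<bar> \<le> (L * e) * p"
          unfolding p_def
        proof (rule conv_mollifier_abs_le[OF \<rho>])
          show "locally_integrable (\<lambda>y. (v x - v y) * \<psi> y)"
            by (intro locally_integrable_mult_smooth L2_locally_integrable \<psi> smooth_intros v)
          show "locally_integrable (\<lambda>y. \<bar>\<psi> y\<bar>)" by (rule L2_locally_integrable[OF abs\<psi>])
          fix y assume y: "norm (x - y) < e"
          have "norm y \<le> R + 1" using True y e norm_triangle_ineq4[of x "x - y"] by simp
          then have "\<bar>v x - v y\<bar> \<le> L * norm (x - y)" using L(2)[of x y] True by simp
          also have "\<dots> \<le> L * e" using y L(1) by simp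
          finally show "\<bar>(v x - v y) * \<psi> y\<bar> \<le> L * e * \<bar>\<psi> y\<bar>" by (simp add: abs_mult mult_right_mono)
        qed
        finally have r: "\<bar>r x\<bar> \<le> L * e * p" .
        have "\<bar>\<phi> x\<bar> \<le> (\<Sum>b\<in>Basis. 2 * (A * \<bar>?D b u x\<bar>) + A * \<bar>u x\<bar>)"
          unfolding \<phi>_def
        proof (intro order_trans[OF sum_abs] sum_mono)
          fix b :: 'a assume b: "b \<in> Basis"
          have "\<bar>2 * (w b x * ?D b u x) + ?D b (w b) x * u x\<bar> \<le> 2 * (\<bar>w b x\<bar> * \<bar>?D b u x\<bar>) + \<bar>?D b (w b) x\<bar> * \<bar>u x\<bar>"
            using abs_triangle_ineq[of "2 * (w b x * ?D b u x)" "?D b (w b) x * u x"] by (simp add: abs_mult)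
          also have "\<dots> \<le> 2 * (A * \<bar>?D b u x\<bar>) + A * \<bar>u x\<bar>"
            using A(2)[OF b b, of x] by (intro add_mono mult_left_mono mult_right_mono) auto
          finally show "\<bar>2 * (w b x * ?D b u x) + ?D b (w b) x * u x\<bar> \<le> 2 * (A * \<bar>?D b u x\<bar>) + A * \<bar>u x\<bar>" .
        qed
        with r have "\<bar>r x * \<phi> x\<bar> \<le> (L * e * p) * (\<Sum>b\<in>Basis. 2 * (A * \<bar>?D b u x\<bar>) + A * \<bar>u x\<bar>)"
          unfolding abs_mult using L e p by (intro mult_mono) auto
        also have "\<dots> = (L * e * A) * (\<Sum>b\<in>Basis. 2 * \<bar>p * ?D b u x\<bar> + \<bar>p * u x\<bar>)"
          using p by (simp add: sum_distrib_left abs_mult algebra_simps)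
        also have "\<dots> \<le> (L * e * A) * (\<Sum>b\<in>Basis. (P x + (?D b u x)\<^sup>2) + (P x + (u x)\<^sup>2))"
        proof (intro mult_left_mono sum_mono add_mono)
          fix b :: 'a
          show "2 * \<bar>p * ?D b u x\<bar> \<le> P x + (?D b u x)\<^sup>2" 
            using mult_left_mono[OF am[of p "?D b u x"], of 2] p2 by simp
          show "\<bar>p * u x\<bar> \<le> P x + (u x)\<^sup>2"
            by (rule order_trans[OF am half[OF p2 zero_le_power2 zero_le_power2]])
        qed (use L e A in auto)
        also have "(\<Sum>b\<in>Basis. (P x + (?D b u x)\<^sup>2) + (P x + (u x)\<^sup>2)) = 2 * ?n * P x + T x + ?n * (u x)\<^sup>2"
          by (simp add: T_def sum.distrib algebra_simps)
        also have "(L * e * A) * \<dots> \<le> (L * e * A) * ((3 * ?n + 2) * P x + (3 * ?n + 2) * T x + (3 * ?n + 2) * (u x)\<^sup>2)"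
        proof -
          have "P x \<ge> 0" using p2 zero_le_power2[of p] by linarith
          moreover have "T x \<ge> 0" by (simp add: T_def sum_nonneg)
          moreover have "1 * T x \<le> (3 * ?n + 2) * T x" using \<open>T x \<ge> 0\<close> n by (intro mult_right_mono) auto
          ultimately show ?thesis
            using L e A n by (intro mult_left_mono add_mono mult_right_mono) auto
        qed
        finally show ?thesis by (simp add: C2_def algebra_simps)
      next
        case False
        have "w b x = 0 \<and> ?D b (w b) x = 0" if "b \<in> Basis" for b
          using R[OF that] partial_deriv_eq_0_outside[of R "w b" x b] False by auto
        then have "\<phi> x = 0" by (simp add: \<phi>_def)
        moreover have "P x \<ge> 0" "T x \<ge> 0"
          unfolding P_def conv_def T_def using mollifier_nonneg[OF \<rho>] by (auto intro!: sum_nonneg)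
        ultimately show ?thesis using L e C by simp
      qed
      have iQ: "(LINT x|lborel. Q x) \<le> C1 * (G + M)"
      proof -
        have "(LINT x|lborel. Q x) \<le> (LINT x|lborel. C1 * (T x + (u x)\<^sup>2))"
          using T u2 Qle by (intro integral_mono test_integrable[OF Qt]) auto
        also have "\<dots> = C1 * ((LINT x|lborel. T x) + (LINT x|lborel. (u x)\<^sup>2))" using T u2 by simp
        also have "\<dots> \<le> C1 * (G + M)" using T u2 C by (intro mult_left_mono add_mono) auto
        finally show ?thesis .
      qed
      have ir: "\<bar>LINT x|lborel. r x * \<phi> x\<bar> \<le> L * e * C2 * (G + 2 * M)"
      proof -
        have "\<bar>LINT x|lborel. r x * \<phi> x\<bar> \<le> (LINT x|lborel. \<bar>r x * \<phi> x\<bar>)" by (rule integral_abs_bound)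
        also have "\<dots> \<le> (LINT x|lborel. L * e * C2 * (P x + T x + (u x)\<^sup>2))"
        proof (rule integral_mono[OF _ _ r\<phi>])
          show "integrable lborel (\<lambda>x. \<bar>r x * \<phi> x\<bar>)"
            by (intro integrable_abs test_integrable test_function_mult_right \<phi>t rs)
          show "integrable lborel (\<lambda>x. L * e * C2 * (P x + T x + (u x)\<^sup>2))"
            using T(1) u2(1) P(1) by simp
        qed
        also have "\<dots> = L * e * C2 * ((LINT x|lborel. P x) + (LINT x|lborel. T x) + (LINT x|lborel. (u x)\<^sup>2))"
          using T u2 P by simp
        also have "\<dots> \<le> L * e * C2 * (M + G + M)"
          using T u2 P C L e by (intro mult_left_mono add_mono) auto
        finally show ?thesis by (simp add: algebra_simps)
      qed
      have "(LINT x|lborel. a x * (u x)\<^sup>2) = h\<^sup>2 * (LINT x|lborel. Q x) - (LINT x|lborel. r x * \<phi> x)"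
        using virial by simp
      also have "\<dots> \<le> h\<^sup>2 * (C1 * (G + M)) + L * e * C2 * (G + 2 * M)"
        using mult_left_mono[OF iQ, of "h\<^sup>2"] ir by (simp add: abs_le_iff)
      finally show ?thesis by (simp add: u_def mult_ac)
    qed
    \<comment> \<open>Here h and \<psi> are fixed, so the width e may depend on them through
      \<open>G\<close>, \<open>M\<close> and \<open>e0\<close>.\<close>
    have "(LINT x|lborel. a x * (\<psi> x)\<^sup>2) \<le> 2 * C1 * h\<^sup>2 * (G + M) + \<epsilon>" if \<epsilon>: "\<epsilon> > 0" for \<epsilon>
    proof -
      obtain e0 where e0: "e0 > 0" "\<And>e \<rho>. 0 < e \<Longrightarrow> e < e0 \<Longrightarrow> mollifier e \<rho> \<Longrightarrow>
          (LINT x|lborel. a x * (conv \<rho> \<psi> x - \<psi> x)\<^sup>2) \<le> \<epsilon> / 4"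
        using mollifier_L2_approx[OF \<psi> at a0, of "\<epsilon> / 4"] \<epsilon> by auto
      define k where "k = L * C2 * (G + 2 * M) + 1"
      have k: "k > 0" unfolding k_def using L C GM by (intro add_nonneg_pos) auto
      define e where "e = min (min (e0 / 2) (1 / 2)) (\<epsilon> / (4 * k))"
      have e: "0 < e" "e < 1" "e < e0" "e \<le> \<epsilon> / (4 * k)" unfolding e_def using e0(1) \<epsilon> k by auto
      obtain \<rho> :: "'a \<Rightarrow> real" where \<rho>: "mollifier e \<rho>" using mollifier_exists[OF e(1)] by blast
      have small: "L * e * C2 * (G + 2 * M) \<le> \<epsilon> / 4"
      proof -
        have "L * e * C2 * (G + 2 * M) \<le> e * k" unfolding k_def using e(1) by (simp add: algebra_simps)
        also have "\<dots> \<le> \<epsilon> / (4 * k) * k" using e(4) k by (intro mult_right_mono) auto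
        finally show ?thesis using k by simp
      qed
      have i1: "integrable lborel (\<lambda>x. a x * (f x)\<^sup>2)" if "L2 f" for f
        using L2_mult_integrable[OF L2_test_mult[OF that at] that] by (simp add: power2_eq_square mult.assoc)
      note c = conv_mollifier_L2(1)[OF \<rho> \<psi>]
      have "(LINT x|lborel. a x * (\<psi> x)\<^sup>2)
          \<le> (LINT x|lborel. 2 * (a x * (conv \<rho> \<psi> x)\<^sup>2) + 2 * (a x * (conv \<rho> \<psi> x - \<psi> x)\<^sup>2))"
      proof (rule integral_mono)
        show "a x * (\<psi> x)\<^sup>2 \<le> 2 * (a x * (conv \<rho> \<psi> x)\<^sup>2) + 2 * (a x * (conv \<rho> \<psi> x - \<psi> x)\<^sup>2)" for x
        proof -
          have "(\<psi> x)\<^sup>2 \<le> 2 * (conv \<rho> \<psi> x)\<^sup>2 + 2 * (conv \<rho> \<psi> x - \<psi> x)\<^sup>2"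
            using zero_le_power2[of "2 * conv \<rho> \<psi> x - \<psi> x"] by (simp add: power2_eq_square algebra_simps)
          from mult_left_mono[OF this a0[of x]] show ?thesis by (simp add: algebra_simps)
        qed
      qed (use i1[OF \<psi>] i1[OF c] i1[OF L2_diff[OF c \<psi>]] in auto)
      also have "\<dots> = 2 * (LINT x|lborel. a x * (conv \<rho> \<psi> x)\<^sup>2) + 2 * (LINT x|lborel. a x * (conv \<rho> \<psi> x - \<psi> x)\<^sup>2)"
        using i1[OF c] i1[OF L2_diff[OF c \<psi>]] by simp
      also have "\<dots> \<le> 2 * (C1 * h\<^sup>2 * (G + M) + \<epsilon> / 4) + 2 * (\<epsilon> / 4)"
        using moll[OF e(1,2) \<rho>] small e0(2)[OF e(1,3) \<rho>] by (intro add_mono mult_left_mono) auto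
      finally show ?thesis by simp
    qed
    then show ?thesis unfolding G_def M_def by (rule field_le_epsilon)
  qed
  then show thesis using C(1) by (intro that[of "2 * C1"]) auto
qed

text \<open>Testing the equation with \<eta> \<psi> expresses the integral as -h^2 times the
  integral of \<langle>\<nabla>\<psi>, \<eta> \<nabla>\<psi> + \<psi> \<nabla>\<eta>\<rangle>.
  Young's inequality with bounds on \<eta> and \<nabla>\<eta> gives a constant independent of the
  energy l.\<close>

lemma localized_potential_bound:
  fixes v :: "'a::euclidean_space \<Rightarrow> real"
  assumes v: "smooth v" and \<eta>: "test_function \<eta>"
  obtains C where "C > 0" "\<And>h l \<psi>. eigenfunction h v l \<psi> \<Longrightarrow>
    \<bar>LINT x|lborel. \<eta> x * (v x - l) * (\<psi> x)\<^sup>2\<bar>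
      \<le> C * h\<^sup>2 * ((LINT x|lborel. (norm (weak_grad \<psi> x))\<^sup>2) + (LINT x|lborel. (\<psi> x)\<^sup>2))"
proof -
  obtain B where B: "B > 0" "\<And>x. \<bar>\<eta> x\<bar> \<le> B" using test_function_bounded[OF \<eta>] by metis
  have "\<exists>K>0. \<forall>x. \<bar>partial_deriv b \<eta> x\<bar> \<le> K" if "b \<in> Basis" for b
    using test_function_bounded[OF test_function_partial_deriv[OF \<eta> that]] by metis
  then obtain K where K: "\<And>b. b \<in> Basis \<Longrightarrow> K b > 0" "\<And>b x. b \<in> Basis \<Longrightarrow> \<bar>partial_deriv b \<eta> x\<bar> \<le> K b"
    by metis
  define N where "N = (\<Sum>b\<in>Basis. K b)"
  have N: "N > 0" unfolding N_def using K by (intro sum_pos) auto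
  have gN: "norm (grad \<eta> x) \<le> N" for x
    unfolding grad_def N_def by (rule sum_norm_le) (use K in auto)
  have "\<bar>LINT x|lborel. \<eta> x * (v x - l) * (\<psi> x)\<^sup>2\<bar>
      \<le> (B + N) * h\<^sup>2 * ((LINT x|lborel. (norm (weak_grad \<psi> x))\<^sup>2) + (LINT x|lborel. (\<psi> x)\<^sup>2))"
    if ef: "eigenfunction h v l \<psi>" for h l \<psi>
  proof -
    let ?g = "weak_grad \<psi>"
    note H = eigenfunction_H1[OF ef] and \<psi> = eigenfunction_L2[OF ef]
    note g = weak_grad_L2[OF H] weak_grad_has_weak_grad[OF H]
    let ?G = "\<lambda>x. \<eta> x *\<^sub>R ?g x + \<psi> x *\<^sub>R grad \<eta> x"
    have G: "L2 ?G" by (rule test_mult_grad_L2[OF \<psi> g(1) \<eta>])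
    have eq: "h\<^sup>2 * (LINT x|lborel. inner (?g x) (?G x)) + (LINT x|lborel. v x * \<psi> x * (\<eta> x * \<psi> x))
      = l * (LINT x|lborel. \<psi> x * (\<eta> x * \<psi> x))"
      by (rule eigenfunction_weak_equation[OF ef test_mult_form_domain[OF v H \<eta>] G test_mult_has_weak_grad[OF \<psi> g \<eta>]])
    have i: "integrable lborel (\<lambda>x. v x * \<psi> x * (\<eta> x * \<psi> x))" "integrable lborel (\<lambda>x. \<psi> x * (\<eta> x * \<psi> x))"
      "integrable lborel (\<lambda>x. (norm (?g x))\<^sup>2)" "integrable lborel (\<lambda>x. (\<psi> x)\<^sup>2)"
      using L2_mult_integrable[OF L2_test_mult[OF \<psi> test_function_mult_right[OF \<eta> v]] \<psi>]
        L2_mult_integrable[OF L2_test_mult[OF \<psi> \<eta>] \<psi>] g(1) \<psi>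
      by (simp_all add: mult_ac L2_real_iff L2_def)
    have ig: "integrable lborel (\<lambda>x. inner (?g x) (?G x))"
    proof -
      have "integrable lborel (\<lambda>x. \<Sum>b\<in>Basis. inner (?g x) b * inner (?G x) b)"
        by (intro Bochner_Integration.integrable_sum L2_mult_integrable L2_component g G)
      then show ?thesis by (subst euclidean_inner)
    qed
    have "(LINT x|lborel. \<eta> x * (v x - l) * (\<psi> x)\<^sup>2)
        = (LINT x|lborel. v x * \<psi> x * (\<eta> x * \<psi> x) - l * (\<psi> x * (\<eta> x * \<psi> x)))"
      by (simp add: power2_eq_square algebra_simps)
    also have "\<dots> = - (h\<^sup>2 * (LINT x|lborel. inner (?g x) (?G x)))"
      using eq i by simp
    finally have 1: "\<bar>LINT x|lborel. \<eta> x * (v x - l) * (\<psi> x)\<^sup>2\<bar> = h\<^sup>2 * \<bar>LINT x|lborel. inner (?g x) (?G x)\<bar>"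
      by (simp add: abs_mult)
    have "\<bar>LINT x|lborel. inner (?g x) (?G x)\<bar>
        \<le> (LINT x|lborel. (B + N) * ((norm (?g x))\<^sup>2 + (\<psi> x)\<^sup>2))"
    proof (rule order_trans[OF integral_abs_bound integral_mono])
      show "integrable lborel (\<lambda>x. \<bar>inner (?g x) (?G x)\<bar>)" using ig by (rule integrable_abs)
      show "integrable lborel (\<lambda>x. (B + N) * ((norm (?g x))\<^sup>2 + (\<psi> x)\<^sup>2))" using i by auto
      fix x
      have "\<bar>inner (?g x) (?G x)\<bar> = \<bar>\<eta> x * (norm (?g x))\<^sup>2 + \<psi> x * inner (?g x) (grad \<eta> x)\<bar>"
        by (simp add: inner_add_right power2_norm_eq_inner)
      also have "\<dots> \<le> \<bar>\<eta> x\<bar> * (norm (?g x))\<^sup>2 + \<bar>\<psi> x\<bar> * \<bar>inner (?g x) (grad \<eta> x)\<bar>"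
        using abs_triangle_ineq[of "\<eta> x * (norm (?g x))\<^sup>2" "\<psi> x * inner (?g x) (grad \<eta> x)"] by (simp add: abs_mult)
      also have "\<dots> \<le> B * (norm (?g x))\<^sup>2 + \<bar>\<psi> x\<bar> * (norm (?g x) * N)"
      proof (intro add_mono mult_right_mono mult_left_mono B)
        show "\<bar>inner (?g x) (grad \<eta> x)\<bar> \<le> norm (?g x) * N"
          using gN[of x] by (intro order_trans[OF Cauchy_Schwarz_ineq2] mult_left_mono) auto
      qed auto
      also have "\<dots> = B * (norm (?g x))\<^sup>2 + N * (\<bar>\<psi> x\<bar> * norm (?g x))" by (simp add: mult_ac)
      also have "\<dots> \<le> (B * (norm (?g x))\<^sup>2 + B * (\<psi> x)\<^sup>2) + N * ((norm (?g x))\<^sup>2 + (\<psi> x)\<^sup>2)"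
      proof (intro add_mono mult_left_mono)
        have "0 \<le> \<bar>\<psi> x\<bar> * norm (?g x)" by simp
        moreover have "2 * (\<bar>\<psi> x\<bar> * norm (?g x)) \<le> (\<psi> x)\<^sup>2 + (norm (?g x))\<^sup>2"
          using sum_squares_bound[of "\<bar>\<psi> x\<bar>" "norm (?g x)"] by simp
        ultimately show "\<bar>\<psi> x\<bar> * norm (?g x) \<le> (norm (?g x))\<^sup>2 + (\<psi> x)\<^sup>2" by linarith
      qed (use B N in auto)
      finally show "\<bar>inner (?g x) (?G x)\<bar> \<le> (B + N) * ((norm (?g x))\<^sup>2 + (\<psi> x)\<^sup>2)"
        by (simp add: algebra_simps)
    qed
    also have "\<dots> = (B + N) * ((LINT x|lborel. (norm (?g x))\<^sup>2) + (LINT x|lborel. (\<psi> x)\<^sup>2))"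
      using i by simp
    finally have "h\<^sup>2 * \<bar>LINT x|lborel. inner (?g x) (?G x)\<bar>
        \<le> h\<^sup>2 * ((B + N) * ((LINT x|lborel. (norm (?g x))\<^sup>2) + (LINT x|lborel. (\<psi> x)\<^sup>2)))"
      by (intro mult_left_mono) auto
    then show ?thesis unfolding 1 by (simp only: mult_ac)
  qed
  then show thesis using B N by (intro that[of "B + N"]) auto
qed

text \<open>With s = lam0 + eps0 - v and t = lam0 + eps0 - lam this is the weight \<Theta>(v) (v -
  lam). By monotonicity of \<open>bump\<close> its two factors have the same sign.\<close>

lemma bump_weight_nonneg:
  assumes "0 < t"
  shows "0 \<le> (1 - bump s / bump t) * (t - s)"
proof (cases "s \<le> t")
  case True
  then have "bump s / bump t \<le> 1" using bump_mono[OF True] assms by (simp add: divide_le_eq_1)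
  then show ?thesis using True by simp
next
  case False
  then have "bump s / bump t \<ge> 1" using bump_mono[of t s] assms by (simp add: le_divide_eq_1)
  then show ?thesis using False by (intro mult_nonpos_nonpos) auto
qed

lemma bump_quotient: "0 < s \<Longrightarrow> 0 < t \<Longrightarrow> bump s / bump t = exp (1 / t - 1 / s)"
  by (simp add: flat_def exp_diff[symmetric])

text \<open>By monotonicity it suffices to compare \<open>bump\<close> at t with its values at t -
  e/4 and t + e/4, which are positive points; s itself may be nonpositive. There the quotient is exp
  (1/t - 1/s), and the exponent is (e/4) / (t (t - e/4)) or (e/4) / (t (t + e/4)) in absolute value.
  Inserting t \<le> 3e/2 and t + e/4 \<le> 7e/4 produces 1/(9e) and 2/(21e), so the bound does not
  depend on t and hence not on lam.\<close>

lemma bump_weight_lower_bound: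
  assumes e: "0 < e" and t: "e / 2 \<le> t" "t \<le> 3 * e / 2" and s: "e / 4 \<le> \<bar>t - s\<bar>"
  shows "(e / 4) * min (1 - exp (- (1 / (9 * e)))) (2 / (21 * e)) \<le> (1 - bump s / bump t) * (t - s)"
proof -
  let ?a = "e / 4" and ?m = "min (1 - exp (- (1 / (9 * e)))) (2 / (21 * e))"
  have t0: "0 < t" using e t by linarith
  have m0: "?m > 0" using e by simp
  show ?thesis
  proof (cases "s \<le> t")
    case True
    then have st: "s \<le> t - ?a" and ta: "0 < t - ?a" using s e t by auto
    have "t * (t - ?a) \<le> (3 * e / 2) * (3 * e / 2)" using t t0 ta e by (intro mult_mono) auto
    then have "?a / ((3 * e / 2) * (3 * e / 2)) \<le> ?a / (t * (t - ?a))"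
      using e t0 ta by (intro divide_left_mono mult_pos_pos) auto
    moreover have "?a / ((3 * e / 2) * (3 * e / 2)) = 1 / (9 * e)" using e by (simp add: field_simps)
    moreover have "1 / t - 1 / (t - ?a) = - (?a / (t * (t - ?a)))" using t0 ta by (simp add: field_simps)
    ultimately have "1 / t - 1 / (t - ?a) \<le> - (1 / (9 * e))" by simp
    then have "bump (t - ?a) / bump t \<le> exp (- (1 / (9 * e)))" using bump_quotient[OF ta t0] by simp
    moreover have "bump s / bump t \<le> bump (t - ?a) / bump t"
      using bump_mono[OF st] by (intro divide_right_mono) auto
    ultimately have "?m \<le> 1 - bump s / bump t" by linarith
    moreover from this m0 have "0 \<le> 1 - bump s / bump t" by linarith
    ultimately have "?m * ?a \<le> (1 - bump s / bump t) * (t - s)"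
      using st e by (intro mult_mono) auto
    then show ?thesis by (simp only: mult.commute)
  next
    case False
    then have st: "t + ?a \<le> s" and ta: "0 < t + ?a" using s e t by auto
    have "t * (t + ?a) \<le> (3 * e / 2) * (7 * e / 4)" using t t0 ta e by (intro mult_mono) auto
    then have "?a / ((3 * e / 2) * (7 * e / 4)) \<le> ?a / (t * (t + ?a))"
      using e t0 ta by (intro divide_left_mono mult_pos_pos) auto
    moreover have "?a / ((3 * e / 2) * (7 * e / 4)) = 2 / (21 * e)" using e by (simp add: field_simps)
    moreover have "1 / t - 1 / (t + ?a) = ?a / (t * (t + ?a))" using t0 ta by (simp add: field_simps)
    ultimately have "2 / (21 * e) \<le> 1 / t - 1 / (t + ?a)" by simp
    then have "1 + 2 / (21 * e) \<le> bump (t + ?a) / bump t"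
      using bump_quotient[OF ta t0] exp_ge_add_one_self[of "1 / t - 1 / (t + ?a)"] by linarith
    moreover have "bump (t + ?a) / bump t \<le> bump s / bump t"
      using bump_mono[OF st] by (intro divide_right_mono) auto
    ultimately have "?m \<le> bump s / bump t - 1" by linarith
    moreover from this m0 have "0 \<le> bump s / bump t - 1" by linarith
    ultimately have "?m * ?a \<le> (bump s / bump t - 1) * (s - t)"
      using st e by (intro mult_mono) auto
    then show ?thesis using minus_mult_minus[of "1 - bump s / bump t" "t - s"] by (simp add: mult.commute)
  qed
qed

theorem theorem3p3:
  fixes v :: "'a::euclidean_space \<Rightarrow> real"
    and lam0 eps0 c0 :: real
    and N :: nat
    and Fw :: "nat \<Rightarrow> real \<Rightarrow> 'a set"
    and xw :: "nat \<Rightarrow> 'a"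
  assumes "smooth v"
    and "\<forall>x. 0 \<le> v x" and "\<exists>x. v x = 0"
    and "0 < v_infty v"
    and "0 < lam0" and "ereal lam0 < v_infty v"
    and "non_critical v lam0"
    and "0 < eps0" and "ereal (lam0 + eps0) < v_infty v"
    and "\<forall>l\<in>{lam0 - eps0 .. lam0 + eps0}.
           F_set v l = (\<Union>n\<in>{1..N}. Fw n l) \<and>
           (\<forall>n\<in>{1..N}. \<forall>m\<in>{1..N}. n \<noteq> m \<longrightarrow> Fw n l \<inter> Fw m l = {})"
    and "\<forall>n\<in>{1..N}. xw n \<in> Fw n (lam0 - eps0)"
    and "0 < c0"
    and "\<forall>n\<in>{1..N}. \<forall>x \<in> Fw n (lam0 + eps0) \<inter> G_set v (lam0 - eps0).
           inner (x - xw n) (grad v x) \<ge> c0"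
  shows "\<exists>c>0. \<exists>h0>0. \<forall>h. 0 < h \<and> h < h0 \<longrightarrow>
           (\<forall>lam \<psi>. lam \<in> {lam0 - eps0/2 <..< lam0 + eps0/2} \<and>
              eigenfunction h v lam \<psi> \<and> normalized \<psi> \<longrightarrow>
              kinetic_energy h \<psi> \<ge> c)"
proof -
  note v = assms(1) and eps0 = \<open>0 < eps0\<close>
  let ?b = "lam0 + eps0"
  have grad_nonzero: "grad v x \<noteq> 0" if x: "lam0 - eps0 \<le> v x" "v x < ?b" for x
  proof
    assume g0: "grad v x = 0"
    have "x \<in> F_set v ?b" using x by (simp add: F_set_def)
    then obtain n where n: "n \<in> {1..N}" "x \<in> Fw n ?b"
      using bspec[OF assms(10), of ?b] eps0 by auto
    have "x \<in> G_set v (lam0 - eps0)" using x by (simp add: G_set_def F_set_def)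
    then have "inner (x - xw n) (grad v x) \<ge> c0" using n assms(13) by blast
    then show False using g0 \<open>0 < c0\<close> by simp
  qed
  obtain R where R: "\<And>x. v x \<le> ?b \<Longrightarrow> norm x \<le> R"
  proof -
    have "eventually (\<lambda>x. ereal ?b < ereal (v x)) at_infinity"
      using assms(9) unfolding v_infty_def by (rule less_LiminfD)
    then obtain R where "\<And>x. R \<le> norm x \<Longrightarrow> ?b < v x" by (auto simp: eventually_at_infinity)
    then show thesis by (intro that[of R]) (meson linorder_not_le nle_le)
  qed
  \<comment> \<open>The nonconstant part of \<Theta>, up to a scalar. It does not involve lam, so
    the constant \<open>C2\<close> obtained from it is uniform in lam.\<close>
  define \<eta> where "\<eta> = (\<lambda>x. bump (?b - v x))"
  have \<eta>: "test_function \<eta>"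
  proof -
    have "norm x \<le> R" if "\<eta> x \<noteq> 0" for x using that by (intro R) (simp add: \<eta>_def)
    moreover have "smooth \<eta>" unfolding \<eta>_def by (intro smooth_intros v)
    ultimately show ?thesis unfolding test_function_iff by blast
  qed
  \<comment> \<open>The field \<chi>(v) \<nabla>v, where \<chi> is a product of two bumps and
    positive exactly between lam0 - eps0 and lam0 + eps0. The upper bump gives bounded
    support.\<close>
  define w where "w = (\<lambda>c x. bump (?b - v x) * (bump (v x - (lam0 - eps0)) * partial_deriv c v x))"
  define a where "a = (\<lambda>x. \<Sum>c\<in>Basis. w c x * partial_deriv c v x)"
  have w: "test_function (w c)" if "c \<in> Basis" for c
    unfolding w_def using \<eta>[unfolded \<eta>_def]
    by (intro test_function_mult_left smooth_intros v that)
  have a_eq: "a x = bump (?b - v x) * bump (v x - (lam0 - eps0)) * (norm (grad v x))\<^sup>2" for x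
    unfolding a_def w_def norm_square_sum_Basis
    by (simp add: grad_inner_Basis sum_distrib_left power2_eq_square mult_ac)
  have a0: "0 \<le> a x" for x unfolding a_eq by simp
  \<comment> \<open>3/4 = 1/2 + 1/4: this shell contains every x with |v x - lam| < eps0/4, for each
    lam within eps0/2 of lam0. It is compact and lies strictly inside the region where \<chi>(v)
    |\<nabla>v|^2 is positive.\<close>
  obtain c where c: "c > 0" "\<And>x. \<bar>v x - lam0\<bar> \<le> 3 * eps0 / 4 \<Longrightarrow> c \<le> a x"
  proof -
    let ?S = "{x. \<bar>v x - lam0\<bar> \<le> 3 * eps0 / 4}"
    have "closed ?S"
      by (intro closed_Collect_le continuous_intros smooth_continuous v)
    moreover have "bounded ?S"
    proof -
      have "norm x \<le> R" if "\<bar>v x - lam0\<bar> \<le> 3 * eps0 / 4" for x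
        by (rule R) (use that eps0 in linarith)
      then show ?thesis by (auto simp: bounded_iff)
    qed
    ultimately have S: "compact ?S" by (simp add: compact_eq_bounded_closed)
    have pos: "a x > 0" if "x \<in> ?S" for x
    proof -
      have "\<bar>v x - lam0\<bar> \<le> 3 * eps0 / 4" using that by simp
      then have "v x < ?b" "lam0 - eps0 < v x" using eps0 by linarith+
      then show ?thesis unfolding a_eq using grad_nonzero[of x] by simp
    qed
    show thesis
    proof (cases "?S = {}")
      case True
      then show ?thesis by (intro that[of 1]) auto
    next
      case False
      have "continuous_on ?S a"
        unfolding a_def by (intro smooth_continuous smooth_intros v test_functionD[OF w])
      then obtain x where "x \<in> ?S" "\<forall>y\<in>?S. a x \<le> a y"
        using continuous_attains_inf[OF S False] by blast
      then show ?thesis using pos by (intro that[of "a x"]) auto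
    qed
  qed
  obtain C1 where C1: "C1 > 0" "\<And>h l \<psi>. eigenfunction h v l \<psi> \<Longrightarrow> (LINT x|lborel. a x * (\<psi> x)\<^sup>2)
      \<le> C1 * h\<^sup>2 * ((LINT x|lborel. (norm (weak_grad \<psi> x))\<^sup>2) + (LINT x|lborel. (\<psi> x)\<^sup>2))"
    using virial_bound[OF v w a0[unfolded a_def]] unfolding a_def by blast
  obtain C2 where C2: "C2 > 0" "\<And>h l \<psi>. eigenfunction h v l \<psi> \<Longrightarrow> \<bar>LINT x|lborel. \<eta> x * (v x - l) * (\<psi> x)\<^sup>2\<bar>
      \<le> C2 * h\<^sup>2 * ((LINT x|lborel. (norm (weak_grad \<psi> x))\<^sup>2) + (LINT x|lborel. (\<psi> x)\<^sup>2))"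
    using localized_potential_bound[OF v \<eta>] by blast
  define \<delta> where "\<delta> = (eps0 / 4) * min (1 - exp (- (1 / (9 * eps0)))) (2 / (21 * eps0))"
  have \<delta>: "\<delta> > 0" unfolding \<delta>_def using eps0 by (intro mult_pos_pos) auto
  \<comment> \<open>The two estimates divided by the lower bounds \<delta> and c of their weights; 1
    / bump (eps0/2) dominates 1 / bump t for all admissible lam.\<close>
  define C where "C = C2 / (bump (eps0 / 2) * \<delta>) + C1 / c"
  have C: "C > 0" unfolding C_def using C1 C2 \<delta> c eps0 by (intro add_pos_pos divide_pos_pos mult_pos_pos) auto
  have key: "1 \<le> C * (kinetic_energy h \<psi> + h\<^sup>2)"
    if lam: "lam \<in> {lam0 - eps0/2 <..< lam0 + eps0/2}" and ef: "eigenfunction h v lam \<psi>"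
      and nrm: "normalized \<psi>" for h lam \<psi>
  proof -
    define K where "K = kinetic_energy h \<psi>"
    define t where "t = ?b - lam"
    \<comment> \<open>\<open>bump t\<close> is the value of \<open>\<eta>\<close> on {v = lam}, so
      \<open>\<Theta>\<close> vanishes there; where v \<ge> lam0 + eps0 it equals 1.\<close>
    define \<Theta> where "\<Theta> = (\<lambda>x. 1 - bump (?b - v x) / bump t)"
    have t: "eps0 / 2 \<le> t" "t \<le> 3 * eps0 / 2" "0 < t" using lam eps0 by (auto simp: t_def)
    note \<psi> = eigenfunction_L2[OF ef] and H = eigenfunction_H1[OF ef]
    have M: "(LINT x|lborel. (\<psi> x)\<^sup>2) = 1" using nrm by (simp add: normalized_def)
    have K: "K = h\<^sup>2 * (LINT x|lborel. (norm (weak_grad \<psi> x))\<^sup>2)" by (simp add: K_def kinetic_energy_def)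
    have K0: "K \<ge> 0" unfolding K by simp
    have fd: "\<psi> \<in> form_domain v" using ef by (auto simp: eigenfunction_def schroedinger_op_def)
    have energy: "K + (LINT x|lborel. v x * (\<psi> x)\<^sup>2) = lam"
      using eigenfunction_weak_equation[OF ef fd weak_grad_L2[OF H] weak_grad_has_weak_grad[OF H]] M
      unfolding K power2_norm_eq_inner by (simp add: power2_eq_square mult.assoc)
    have i: "integrable lborel (\<lambda>x. (\<psi> x)\<^sup>2)" "integrable lborel (\<lambda>x. v x * (\<psi> x)\<^sup>2)"
      using \<psi> fd by (auto simp: L2_real_iff form_domain_def)
    have ti: "integrable lborel (\<lambda>x. f x * (\<psi> x)\<^sup>2)" if "test_function f" for f
      using L2_mult_integrable[OF L2_test_mult[OF \<psi> that] \<psi>] by (simp add: power2_eq_square mult.assoc)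
    have at: "test_function a" unfolding a_def by (intro smooth_intros w v)
    have i\<eta>: "integrable lborel (\<lambda>x. \<eta> x * (v x - lam) * (\<psi> x)\<^sup>2)"
      by (intro ti test_function_mult_left \<eta> smooth_intros v)
    have split: "\<Theta> x * (v x - lam) * (\<psi> x)\<^sup>2
        = v x * (\<psi> x)\<^sup>2 - lam * (\<psi> x)\<^sup>2 - (1 / bump t) * (\<eta> x * (v x - lam) * (\<psi> x)\<^sup>2)" for x
      by (simp add: \<Theta>_def \<eta>_def algebra_simps diff_divide_distrib)
    have i\<Theta>: "integrable lborel (\<lambda>x. \<Theta> x * (v x - lam) * (\<psi> x)\<^sup>2)"
      unfolding split using i i\<eta> by (intro Bochner_Integration.integrable_diff integrable_mult_right)
    have E: "0 < bump (eps0 / 2)" "bump (eps0 / 2) \<le> bump t" using eps0 t bump_mono by auto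
    \<comment> \<open>The term -K comes from testing with \<psi> itself, which lies in the form
      domain; being nonpositive, it is dropped in the next estimate.\<close>
    have "(LINT x|lborel. \<Theta> x * (v x - lam) * (\<psi> x)\<^sup>2)
        = - K - (1 / bump t) * (LINT x|lborel. \<eta> x * (v x - lam) * (\<psi> x)\<^sup>2)"
      unfolding split using i i\<eta> energy M by simp
    also have "\<dots> \<le> (1 / bump t) * \<bar>LINT x|lborel. \<eta> x * (v x - lam) * (\<psi> x)\<^sup>2\<bar>"
    proof -
      have "- ((1 / bump t) * (LINT x|lborel. \<eta> x * (v x - lam) * (\<psi> x)\<^sup>2))
        \<le> (1 / bump t) * \<bar>LINT x|lborel. \<eta> x * (v x - lam) * (\<psi> x)\<^sup>2\<bar>"
        unfolding mult_minus_right[symmetric] by (intro mult_left_mono abs_ge_minus_self) simp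
      then show ?thesis using K0 by linarith
    qed
    also have "\<dots> \<le> (1 / bump (eps0 / 2)) * (C2 * (K + h\<^sup>2))"
    proof (rule mult_mono)
      show "1 / bump t \<le> 1 / bump (eps0 / 2)" using E by (intro frac_le) auto
      show "\<bar>LINT x|lborel. \<eta> x * (v x - lam) * (\<psi> x)\<^sup>2\<bar> \<le> C2 * (K + h\<^sup>2)"
        using C2(2)[OF ef] unfolding K M by (simp only: distrib_left mult.assoc mult_1_right)
    qed (use E in auto)
    finally have \<Theta>le: "(LINT x|lborel. \<Theta> x * (v x - lam) * (\<psi> x)\<^sup>2) \<le> C2 / bump (eps0 / 2) * (K + h\<^sup>2)"
      by simp
    have ale: "(LINT x|lborel. a x * (\<psi> x)\<^sup>2) \<le> C1 * (K + h\<^sup>2)"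
      using C1(2)[OF ef] by (simp add: K M algebra_simps)
    have pw: "(\<psi> x)\<^sup>2 \<le> (1 / \<delta>) * (\<Theta> x * (v x - lam) * (\<psi> x)\<^sup>2) + (1 / c) * (a x * (\<psi> x)\<^sup>2)" for x
    proof -
      have ts: "t - (?b - v x) = v x - lam" by (simp add: t_def)
      have \<Theta>0: "0 \<le> \<Theta> x * (v x - lam)"
        using bump_weight_nonneg[OF t(3), of "?b - v x"] by (simp add: ts \<Theta>_def)
      have "1 \<le> (1 / \<delta>) * (\<Theta> x * (v x - lam)) + (1 / c) * a x"
      \<comment> \<open>Away from {v = lam} the potential weight alone is at least \<delta>; near it
        the virial weight is at least c. The other weight is nonnegative in either case.\<close>
      proof (cases "eps0 / 4 \<le> \<bar>v x - lam\<bar>")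
        case True
        then have "\<delta> \<le> \<Theta> x * (v x - lam)"
          using bump_weight_lower_bound[OF eps0 t(1,2), of "?b - v x"] by (simp add: ts \<Theta>_def \<delta>_def)
        then have "1 \<le> (1 / \<delta>) * (\<Theta> x * (v x - lam))" using \<delta> by (simp add: le_divide_eq)
        then show ?thesis using a0[of x] c(1) by (simp add: add_increasing2)
      next
        case False
        then have "\<bar>v x - lam0\<bar> \<le> 3 * eps0 / 4" using lam unfolding greaterThanLessThan_iff by linarith
        then have "1 \<le> (1 / c) * a x" using c by (simp add: le_divide_eq)
        then show ?thesis using \<Theta>0 \<delta> by (simp add: add_increasing)
      qed
      from mult_right_mono[OF this zero_le_power2[of "\<psi> x"]] show ?thesis by (simp add: algebra_simps)
    qed
    have "1 = (LINT x|lborel. (\<psi> x)\<^sup>2)" using M by simp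
    also have "\<dots> \<le> (LINT x|lborel. (1 / \<delta>) * (\<Theta> x * (v x - lam) * (\<psi> x)\<^sup>2) + (1 / c) * (a x * (\<psi> x)\<^sup>2))"
      using pw i(1) i\<Theta> ti[OF at] by (intro integral_mono) auto
    also have "\<dots> = (1 / \<delta>) * (LINT x|lborel. \<Theta> x * (v x - lam) * (\<psi> x)\<^sup>2) + (1 / c) * (LINT x|lborel. a x * (\<psi> x)\<^sup>2)"
      using i\<Theta> ti[OF at] by simp
    also have "\<dots> \<le> (1 / \<delta>) * (C2 / bump (eps0 / 2) * (K + h\<^sup>2)) + (1 / c) * (C1 * (K + h\<^sup>2))"
      using \<Theta>le ale \<delta> c(1) by (intro add_mono mult_left_mono) auto
    also have "\<dots> = C * (K + h\<^sup>2)" unfolding C_def distrib_right[of _ _ "K + h\<^sup>2"] by (simp add: mult_ac)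
    finally show ?thesis by (simp add: K_def)
  qed
  show ?thesis
  proof (intro exI conjI allI impI)
    \<comment> \<open>\<open>key\<close> gives K + h^2 \<ge> 1/C. Half of this is spent on h^2,
      which fixes both witnesses.\<close>
    show "0 < 1 / (2 * C)" using C by simp
    show "0 < sqrt (1 / (2 * C))" using C by simp
    fix h lam \<psi>
    assume h: "0 < h \<and> h < sqrt (1 / (2 * C))"
      and ef: "lam \<in> {lam0 - eps0/2 <..< lam0 + eps0/2} \<and> eigenfunction h v lam \<psi> \<and> normalized \<psi>"
    have "h\<^sup>2 < (sqrt (1 / (2 * C)))\<^sup>2" using h by (intro power_strict_mono) auto
    then have "h\<^sup>2 < 1 / (2 * C)" using C by simp
    moreover have "1 / C \<le> kinetic_energy h \<psi> + h\<^sup>2"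
      using key[of lam h \<psi>] ef C by (simp add: divide_le_eq mult.commute)
    moreover have "1 / C = 1 / (2 * C) + 1 / (2 * C)" using C by simp
    ultimately show "1 / (2 * C) \<le> kinetic_energy h \<psi>" by linarith
  qed
qed

end
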